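(* Let $a>0$ and consider the boundary value problem $$(\Phi''+\Phi\Phi')'=\frac{2m-1}{m}(\Phi')^2,\quad -\infty<\tau\le0,$$ $$\lim_{\tau\to-\infty}e^{-\varepsilon\tau}[\Phi(\tau)+a]=\lim_{\tau\to-\infty}e^{-\varepsilon\tau}\Phi'(\tau)=\lim_{\tau\to-\infty}e^{-\varepsilon\tau}\Phi''(\tau)=0\quad\forall\,\varepsilon\in(0,a),\qquad \Phi(0)=0.$$ (1) For any fixed $m$ with $1/3\le m\le1/2$ the problem has a unique solution $\Phi_m(\tau,a)$; it is a strictly increasing function, belonging to the Lyapunov family (see context) with some $d=d(a,m)>0$, and satisfying the estimates $$\Phi_{1/3}(\tau,a)\le\Phi_m(\tau,a)\le\Phi_{1/2}(\tau,a),\qquad\tau\le0,$$ with $\Phi_{1/2}$ and $\Phi_{1/3}$ as in the context. (2) For fixed $m$ with $1/3\le m<1/2$ the solution has a point of inflection $\tau=\tau_{\rm in}<0$ defined by the relation $$\Phi_m(\tau_{\rm in},a)\,\Phi_m'(\tau_{\rm in},a)=-\int_{-\infty}^{\tau_{\rm in}}[\Phi_m'(s,a)]^2ds ,$$ and (extended to the right as a solution of the ODE) it does not exist globally on $\mathbb R$: it has a simple pole singularity at a finite point $\tau=\tau_p(a,m)>0$, where $\tau_p(a,1/3)=2\pi\sqrt3/(3a)$ and $\tau_p(a,m)>\tau_p(a,1/3)$ for all $m$ with $1/3<m<1/2$. (3) For any fixed $m$ with $0<m<1/3$ the problem has no solutions.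
   Context: Lyapunov family: for $a>0$, $m\neq0$ and a parameter $d\in\mathbb R$, $\Phi_m(\tau,a,d)$ denotes the solution of the ODE given for $|d\,e^{a\tau}|$ small (i.e. near $\tau=-\infty$) by the convergent series $$\Phi_m(\tau,a,d)=-a+\sum_{l=1}^\infty h_l d^l e^{la\tau},\quad h_1=1,\quad h_l=\frac{1}{al^2(l-1)}\sum_{k=1}^{l-1}k\Big(\frac{(m-1)(l-k)}{m}-k\Big)h_kh_{l-k}\ (l\ge2),$$ and continued to the right as a solution of the ODE. $\Phi_{1/2}(\tau,a)=a\tanh(a\tau/2)$. The function $\Phi_{1/3}(\tau,a)$ for $\tau\le0$ is defined implicitly, with values in $(-a,0]$, by $$\tau=\frac{\sqrt3\,\pi}{6a}-\frac1{2a}\ln\frac{a+\sqrt{-a\Phi_{1/3}}-\Phi_{1/3}}{[\sqrt a-\sqrt{-\Phi_{1/3}}]^2}-\frac{\sqrt3}{a}\arctan\frac{\sqrt a+2\sqrt{-\Phi_{1/3}}}{\sqrt{3a}} .$$ These are the solutions of the problem for $m=1/2$ and $m=1/3$, respectively. "Simple pole singularity at $\tau_p$" refers to blow-up of the real solution as $\tau\to\tau_p-0$ with leading behaviour $\Phi(\tau)\sim\frac{6m}{(m+1)(\tau-\tau_p)}$.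
   Formalization: For 1/3<m<1/2 uniqueness is stated among solutions ≤0 on τ≤0 (a translate is a second solution); the estimates read Φ_{1/2}≤Φ_m≤Φ_{1/3}; the inflection relation carries the factor (1−2m)/m before the integral. As printed these three clauses fail. *)

theory Defs
  imports "HOL-Analysis.Analysis" "HOL-Library.Landau_Symbols"
begin

(* I is an interval; derivatives at an endpoint belonging to I are one-sided.
   f1 and f2 are the first and second derivatives of f. *)
definition ode_solution :: "real \<Rightarrow> real set \<Rightarrow> (real \<Rightarrow> real) \<Rightarrow> (real \<Rightarrow> real) \<Rightarrow> (real \<Rightarrow> real) \<Rightarrow> bool"
  where "ode_solution m I f f1 f2 \<longleftrightarrow>
    (\<forall>t\<in>I. (f has_real_derivative f1 t) (at t within I) \<and>
           (f1 has_real_derivative f2 t) (at t within I) \<and>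
           ((\<lambda>s. f2 s + f s * f1 s) has_real_derivative ((2 * m - 1) / m) * (f1 t)\<^sup>2) (at t within I))"

definition solves_ode_on :: "real \<Rightarrow> real set \<Rightarrow> (real \<Rightarrow> real) \<Rightarrow> bool"
  where "solves_ode_on m I f \<longleftrightarrow> (\<exists>f1 f2. ode_solution m I f f1 f2)"

(* Pitfall: for 1/3 < m < 1/2 the increasing solution, continued past its zero at 0, becomes
   positive and has a second zero before it blows down to minus infinity. Translating that
   second zero to 0 gives another solution of this problem, one that takes positive values.
   Hence uniqueness for these m holds among the nonpositive solutions only. *)
definition bvp_solution :: "real \<Rightarrow> real \<Rightarrow> (real \<Rightarrow> real) \<Rightarrow> bool"
  where "bvp_solution m a f \<longleftrightarrow>
    (\<exists>f1 f2. ode_solution m {..0} f f1 f2 \<and>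
       (\<forall>\<epsilon>. 0 < \<epsilon> \<and> \<epsilon> < a \<longrightarrow>
          ((\<lambda>t. exp (- \<epsilon> * t) * (f t + a)) \<longlongrightarrow> 0) at_bot \<and>
          ((\<lambda>t. exp (- \<epsilon> * t) * f1 t) \<longlongrightarrow> 0) at_bot \<and>
          ((\<lambda>t. exp (- \<epsilon> * t) * f2 t) \<longlongrightarrow> 0) at_bot)) \<and>
    f 0 = 0"

(* The index starts at 1; the value 0 at index 0 only makes the series below start there. *)
fun lyapunov_coeff :: "real \<Rightarrow> real \<Rightarrow> nat \<Rightarrow> real"
  where "lyapunov_coeff m a l =
    (if l = 0 then 0 else if l = 1 then 1
     else 1 / (a * (real l)\<^sup>2 * (real l - 1)) *
       (\<Sum>k\<in>{1..<l}. real k * ((m - 1) * (real l - real k) / m - real k)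
          * lyapunov_coeff m a k * lyapunov_coeff m a (l - k)))"

declare lyapunov_coeff.simps [simp del]

(* f is the restriction to I (an interval unbounded below) of the member of the Lyapunov
   family with parameter d: it is given by the series near minus infinity and continued
   to the right by the differential equation. *)
definition lyapunov_member :: "real \<Rightarrow> real \<Rightarrow> real \<Rightarrow> real set \<Rightarrow> (real \<Rightarrow> real) \<Rightarrow> bool"
  where "lyapunov_member m a d I f \<longleftrightarrow>
    solves_ode_on m I f \<and>
    (\<exists>\<delta>>0. \<forall>t\<in>I. \<bar>d * exp (a * t)\<bar> < \<delta> \<longrightarrow>
       (\<lambda>l. lyapunov_coeff m a l * d ^ l * exp (real l * a * t)) sums (f t + a))"

definition phi_half :: "real \<Rightarrow> real \<Rightarrow> real"
  where "phi_half a t = a * tanh (a * t / 2)"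

(* Meaningful for t \<le> 0, where the implicit equation has exactly one root in (-a, 0].
   As t tends to 0 from the left, phi_third a t is quadratic in t while phi_half a t is
   linear, so that phi_half is the lower of the two. *)
definition phi_third :: "real \<Rightarrow> real \<Rightarrow> real"
  where "phi_third a t = (THE y. - a < y \<and> y \<le> 0 \<and>
    t = sqrt 3 * pi / (6 * a)
      - 1 / (2 * a) * ln ((a + sqrt (- a * y) - y) / (sqrt a - sqrt (- y))\<^sup>2)
      - sqrt 3 / a * arctan ((sqrt a + 2 * sqrt (- y)) / sqrt (3 * a)))"

definition inflection_point :: "(real \<Rightarrow> real) \<Rightarrow> real \<Rightarrow> bool"
  where "inflection_point f t \<longleftrightarrow>
    (\<exists>e>0. (\<forall>s. \<bar>s - t\<bar> < e \<longrightarrow> f differentiable at s \<and> deriv f differentiable at s) \<and>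
      ((\<forall>s\<in>{t - e<..<t}. deriv (deriv f) s > 0) \<and> (\<forall>s\<in>{t<..<t + e}. deriv (deriv f) s < 0) \<or>
       (\<forall>s\<in>{t - e<..<t}. deriv (deriv f) s < 0) \<and> (\<forall>s\<in>{t<..<t + e}. deriv (deriv f) s > 0)))"

(* Integrating the equation from minus infinity gives
     f'' + f f' = ((2 m - 1) / m) * (integral of f'^2 over (-infinity, t]),
   so that f'' vanishes at t exactly when the relation below holds. The coefficient
   (1 - 2 m) / m equals 1 if and only if m = 1/3. *)
definition inflection_relation :: "real \<Rightarrow> (real \<Rightarrow> real) \<Rightarrow> real \<Rightarrow> bool"
  where "inflection_relation m f t \<longleftrightarrow>
    (\<lambda>s. (deriv f s)\<^sup>2) integrable_on {..t} \<and>
    f t * deriv f t = - ((1 - 2 * m) / m) * integral {..t} (\<lambda>s. (deriv f s)\<^sup>2)"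

definition simple_pole_at :: "real \<Rightarrow> (real \<Rightarrow> real) \<Rightarrow> real \<Rightarrow> bool"
  where "simple_pole_at m f p \<longleftrightarrow> f \<sim>[at_left p] (\<lambda>t. 6 * m / ((m + 1) * (t - p)))"

end

theory Submission
  imports Defs
begin

text \<open>
  Put \<open>\<beta> = (1 - 2 m) / m\<close>, so that \<open>m \<in> [1/3, 1/2]\<close> means \<open>\<beta> \<in> [0, 1]\<close>, and \<open>B = - (f'' + f f')\<close>. The
  equation becomes the flow \<open>f' = v\<close>, \<open>v' = - f v - B\<close>, \<open>B' = \<beta> v\<^sup>2\<close>, and the conditions at
  \<open>-\<infinity>\<close> say \<open>f \<rightarrow> - a\<close>, \<open>v \<rightarrow> 0\<close>, \<open>B \<rightarrow> 0\<close>. Almost everything follows from three monotone quantities: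
  \<open>v + f\<^sup>2 / 2\<close> has derivative \<open>- B \<le> 0\<close>, which gives the bound by \<open>phi_half\<close>;
  \<open>J = - f B - v\<^sup>2 / 2\<close> has derivative \<open>(1 - \<beta>) f v\<^sup>2\<close>, whose sign excludes solutions for \<open>\<beta> > 1\<close>
  (at a zero of \<open>f\<close> one has \<open>J \<le> 0\<close>) and gives the bound by \<open>phi_third\<close> for \<open>\<beta> \<le> 1\<close>; and
  \<open>G = B - 2 f v / 3 - 2 f ^ 3 / 9\<close>, which together with \<open>J\<close> integrates the case \<open>\<beta> = 1\<close>.

  Existence: the Lyapunov series converges because its coefficients are bounded by a geometric sequence,
  and it is continued to the right until the state becomes unbounded. Uniqueness: as functions of
  \<open>y = f\<close> the pair \<open>p = f'\<close>, \<open>b = B\<close> solves \<open>p' = - y - b / p\<close>, \<open>b' = \<beta> p\<close>; the singularity at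
  \<open>y = - a\<close> is harmless because \<open>p\<close> vanishes there linearly and \<open>b\<close> quadratically.

  To the right of the zero, \<open>B\<close> is bounded below by \<open>B 0 > 0\<close> when \<open>\<beta> > 0\<close>, so the Riccati
  equation for \<open>f\<close> forces blow-up at a finite time. With \<open>z = - f\<close>, any asymptotic bounds
  \<open>b z\<^sup>2 \<le> z' \<le> c z\<^sup>2\<close> improve to \<open>1/2 + \<beta> b / (6 c)\<close> and \<open>1/2 + \<beta> c / (6 b)\<close>, which pins
  \<open>z' / z\<^sup>2\<close> to \<open>(3 + \<beta>) / 6\<close>. The blow-up times for \<open>\<beta> < 1\<close> and \<open>\<beta> = 1\<close> are compared by a
  cooperative comparison principle started at the maximum of \<open>f\<close>.
\<close>

section \<open>Calculus on the line\<close>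

text \<open>The delicate point is the order of the blow-up times. For \<open>\<beta> < 1\<close> the
  solution crosses zero with positive speed and climbs to a crest at some
  \<open>\<sigma> > 0\<close>. This delays the blow-up, but \<open>B\<close>, which drives the
  descent, keeps growing meanwhile, so the delay has to be weighed against the growth. Two
  quantitative facts decide: \<open>B 0\<close> is at most \<open>2 / 9 * a ^ 3\<close>, its value
  for \<open>\<beta> = 1\<close>, and up to the crest \<open>B\<close> grows at a rate of at most
  \<open>a ^ 4 / 16\<close>. Since \<open>l * F (l * s)\<close> solves the equation whenever
  \<open>F s\<close> does, the solution for \<open>\<beta> = 1\<close> can be enlarged by a factor
  above 1 so that it dominates from the crest on and is still finite on the interval under
  consideration.

  The sharp estimates to the left of the zero come from the substitution
  \<open>f = - w\<^sup>2\<close>, which breaks down at the zero itself. \<open>J\<close> and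
  \<open>G\<close> are the polynomial expressions that carry the same information across it.\<close>

lemma le_limit_at_bot:
  fixes F F' :: "real \<Rightarrow> real"
  assumes "\<And>x. x \<le> t \<Longrightarrow> (F has_real_derivative F' x) (at x)"
    and "\<And>x. x \<le> t \<Longrightarrow> F' x \<le> 0" and "(F \<longlongrightarrow> L) at_bot"
  shows "F t \<le> L"
proof (rule tendsto_lowerbound[OF assms(3)])
  have "F t \<le> F x" if "x \<le> t" for x
  proof (rule DERIV_nonpos_imp_nonincreasing[OF that])
    fix u assume "x \<le> u" "u \<le> t"
    then show "\<exists>y. (F has_real_derivative y) (at u) \<and> y \<le> 0" using assms(1,2) by blast
  qed
  then show "\<forall>\<^sub>F x in at_bot. F t \<le> F x"
    using eventually_le_at_bot[of t] by (rule eventually_mono[rotated])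
qed simp

lemma ge_limit_at_bot:
  fixes F F' :: "real \<Rightarrow> real"
  assumes "\<And>x. x \<le> t \<Longrightarrow> (F has_real_derivative F' x) (at x)"
    and "\<And>x. x \<le> t \<Longrightarrow> 0 \<le> F' x" and "(F \<longlongrightarrow> L) at_bot"
  shows "L \<le> F t"
  using le_limit_at_bot[of t "\<lambda>x. - F x" "\<lambda>x. - F' x" "- L"] assms
  by (auto intro!: derivative_eq_intros tendsto_minus)

lemma nondecreasing_of_derivative:
  fixes F F' :: "real \<Rightarrow> real"
  assumes "\<And>x. s \<le> x \<Longrightarrow> x \<le> t \<Longrightarrow> (F has_real_derivative F' x) (at x)"
    and "\<And>x. s \<le> x \<Longrightarrow> x \<le> t \<Longrightarrow> 0 \<le> F' x" and "s \<le> t"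
  shows "F s \<le> F t"
proof (rule DERIV_nonneg_imp_nondecreasing[OF assms(3)])
  fix x assume "s \<le> x" "x \<le> t"
  then show "\<exists>y. (F has_real_derivative y) (at x) \<and> 0 \<le> y"
    using assms(1)[of x] assms(2)[of x] by (intro exI[of _ "F' x"]) simp
qed

lemma nonincreasing_of_derivative:
  fixes F F' :: "real \<Rightarrow> real"
  assumes "\<And>x. s \<le> x \<Longrightarrow> x \<le> t \<Longrightarrow> (F has_real_derivative F' x) (at x)"
    and "\<And>x. s \<le> x \<Longrightarrow> x \<le> t \<Longrightarrow> F' x \<le> 0" and "s \<le> t"
  shows "F t \<le> F s"
proof (rule DERIV_nonpos_imp_nonincreasing[OF assms(3)])
  fix x assume "s \<le> x" "x \<le> t"
  then show "\<exists>y. (F has_real_derivative y) (at x) \<and> y \<le> 0"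
    using assms(1)[of x] assms(2)[of x] by (intro exI[of _ "F' x"]) simp
qed

text \<open>\<open>E\<close> is the exponential of an antiderivative of \<open>f\<close>. That
  antiderivative is taken within \<open>{s..t}\<close> and is one-sided at the ends, so the product
  is differentiated inside the interval and only continuous up to its ends, as the open-interval
  monotonicity rules require.\<close>

lemma integrating_factor:
  fixes x f b :: "real \<Rightarrow> real"
  assumes "s \<le> t" and f: "continuous_on {s..t} f"
    and x: "\<And>u. u \<in> {s..t} \<Longrightarrow> (x has_real_derivative (- f u * x u - b u)) (at u)"
  obtains E where "\<And>u. u \<in> {s..t} \<Longrightarrow> E u > 0"
    "continuous_on {s..t} (\<lambda>u. x u * E u)"
    "\<And>u. s < u \<Longrightarrow> u < t \<Longrightarrow> ((\<lambda>u. x u * E u) has_real_derivative (- b u * E u)) (at u)"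
proof -
  obtain P where P: "\<And>u. u \<in> {s..t} \<Longrightarrow> (P has_vector_derivative f u) (at u within {s..t})"
    using antiderivative_continuous[OF f] by blast
  have P': "(P has_real_derivative f u) (at u)" if "s < u" "u < t" for u
    using P[of u] that by (simp add: at_within_Icc_at has_real_derivative_iff_has_vector_derivative)
  have "continuous_on {s..t} P"
    using P by (rule continuous_on_vector_derivative)
  moreover have "continuous_on {s..t} x"
    using x by (meson DERIV_isCont continuous_at_imp_continuous_on)
  ultimately have "continuous_on {s..t} (\<lambda>u. x u * exp (P u))"
    by (intro continuous_intros)
  moreover have "((\<lambda>u. x u * exp (P u)) has_real_derivative (- b u * exp (P u))) (at u)"
    if "s < u" "u < t" for u
    using that
    by (auto intro!: derivative_eq_intros x P' simp: algebra_simps)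
  ultimately show ?thesis
    by (intro that[of "\<lambda>u. exp (P u)"]) auto
qed

text \<open>After multiplication by the integrating factor the forcing \<open>- b\<close> can only
  push \<open>x\<close> down. With \<open>x = v\<close> and \<open>b = B\<close> this makes a
  descent of \<open>f\<close> permanent.\<close>

lemma linear_ode_nonpos:
  fixes x f b :: "real \<Rightarrow> real"
  assumes "s \<le> t" "continuous_on {s..t} f"
    "\<And>u. u \<in> {s..t} \<Longrightarrow> (x has_real_derivative (- f u * x u - b u)) (at u)"
    and b: "\<And>u. s < u \<Longrightarrow> u < t \<Longrightarrow> 0 \<le> b u" and "x s \<le> 0"
  shows "x t \<le> 0"
proof -
  obtain E where E: "\<And>u. u \<in> {s..t} \<Longrightarrow> E u > 0" "continuous_on {s..t} (\<lambda>u. x u * E u)"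
    "\<And>u. s < u \<Longrightarrow> u < t \<Longrightarrow> ((\<lambda>u. x u * E u) has_real_derivative (- b u * E u)) (at u)"
    using integrating_factor[OF assms(1-3)] by blast
  have "x t * E t \<le> x s * E s"
    using assms(1)
    by (intro DERIV_nonpos_imp_decreasing_open[of s t])
      (use E b in \<open>force intro: mult_nonneg_nonneg less_imp_le\<close>)+
  also have "\<dots> \<le> 0"
    using E(1)[of s] assms by (simp add: mult_le_0_iff)
  finally show ?thesis
    using E(1)[of t] assms(1) by (simp add: mult_le_0_iff)
qed

lemma linear_ode_neg:
  fixes x f b :: "real \<Rightarrow> real"
  assumes "s < t" "continuous_on {s..t} f"
    "\<And>u. u \<in> {s..t} \<Longrightarrow> (x has_real_derivative (- f u * x u - b u)) (at u)"
    and b: "\<And>u. s < u \<Longrightarrow> u < t \<Longrightarrow> 0 < b u" and "x s \<le> 0"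
  shows "x t < 0"
proof -
  obtain E where E: "\<And>u. u \<in> {s..t} \<Longrightarrow> E u > 0" "continuous_on {s..t} (\<lambda>u. x u * E u)"
    "\<And>u. s < u \<Longrightarrow> u < t \<Longrightarrow> ((\<lambda>u. x u * E u) has_real_derivative (- b u * E u)) (at u)"
    using integrating_factor[OF less_imp_le[OF assms(1)] assms(2,3)] by blast
  have "x t * E t < x s * E s"
    using E b assms(1) 
    by (intro DERIV_neg_imp_decreasing_open[of s t]) (auto intro!: exI mult_neg_pos)
  also have "\<dots> \<le> 0"
    using E(1)[of s] assms by (simp add: mult_le_0_iff)
  finally show ?thesis
    using E(1)[of t] assms(1) by (simp add: mult_less_0_iff)
qed

text \<open>At the supremum \<open>c\<close> of the times up to which \<open>g\<close> has stayed
  nonnegative, \<open>0 < g' c\<close> carries \<open>g\<close> beyond \<open>c\<close>. The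
  derivative is controlled from the whole past of \<open>g\<close>, not only from its current value,
  because in the comparison of blow-up times further inequalities are first integrated from
  it.\<close>

lemma barrier:
  fixes g g' :: "real \<Rightarrow> real"
  assumes g: "\<And>t. s \<le> t \<Longrightarrow> t \<le> T \<Longrightarrow> (g has_real_derivative g' t) (at t)"
    and pos: "\<And>t. s \<le> t \<Longrightarrow> t \<le> T \<Longrightarrow> (\<And>u. s \<le> u \<Longrightarrow> u \<le> t \<Longrightarrow> 0 \<le> g u) \<Longrightarrow> 0 < g' t"
    and "0 \<le> g s" "s \<le> t" "t \<le> T"
  shows "0 \<le> g t"
proof (rule ccontr)
  assume neg: "\<not> 0 \<le> g t"
  define A where "A = {u. s \<le> u \<and> u \<le> t \<and> (\<forall>r. s \<le> r \<and> r \<le> u \<longrightarrow> 0 \<le> g r)}"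
  define c where "c = Sup A"
  have "s \<in> A" using assms by (auto simp: A_def)
  moreover have bdd: "bdd_above A" by (auto simp: A_def bdd_above_def)
  ultimately have sc: "s \<le> c" unfolding c_def by (rule cSup_upper)
  have ct: "c \<le> t" unfolding c_def using \<open>s \<in> A\<close> by (intro cSup_least) (auto simp: A_def)
  have below: "0 \<le> g r" if r: "s \<le> r" "r < c" for r
  proof -
    obtain u where "u \<in> A" "r < u" using r(2) less_cSupD[of A r] \<open>s \<in> A\<close> unfolding c_def by blast
    then show ?thesis using r by (auto simp: A_def)
  qed
  have gc: "0 \<le> g c"
  proof (cases "s = c")
    case False
    have "isCont g c" using g sc ct assms by (meson DERIV_isCont order_trans)
    then have "(g \<longlongrightarrow> g c) (at_left c)" by (simp add: isCont_def filterlim_at_split)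
    then show ?thesis
    proof (rule tendsto_lowerbound)
      show "\<forall>\<^sub>F x in at_left c. 0 \<le> g x"
        using eventually_at_left_real[of s c] False sc below by (auto elim!: eventually_mono)
    qed simp
  qed (use assms in auto)
  have le: "0 \<le> g u" if "s \<le> u" "u \<le> c" for u
    using below[of u] gc that by (cases "u = c") auto
  have "0 < g' c" using sc ct assms le by (intro pos) auto
  then obtain d where d: "d > 0" "\<And>h. 0 < h \<Longrightarrow> h < d \<Longrightarrow> g c < g (c + h)"
    using DERIV_pos_inc_right[OF g[of c]] sc ct assms by auto
  have "c \<noteq> t" using gc neg by auto
  define h where "h = min (d / 2) (t - c)"
  have h: "0 < h" "h < d" "c + h \<le> t" using d ct \<open>c \<noteq> t\<close> by (auto simp: h_def min_def)
  have "c + h \<in> A"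
  proof -
    have "0 \<le> g r" if "s \<le> r" "r \<le> c + h" for r
      using le[of r] d(2)[of "r - c"] gc that h by (cases "r \<le> c") auto
    then show ?thesis using h sc by (auto simp: A_def)
  qed
  then have "c + h \<le> c" unfolding c_def using bdd by (rule cSup_upper)
  then show False using h by simp
qed

lemma first_nonneg:
  fixes f :: "real \<Rightarrow> real"
  assumes cont: "continuous_on {s..y} f" and neg: "\<And>t. t \<le> s \<Longrightarrow> f t < 0" and y: "0 \<le> f y"
  obtains z where "s < z" "z \<le> y" "f z = 0" "\<And>t. t < z \<Longrightarrow> f t < 0"
proof -
  have sy: "s < y" using neg[of y] y by force
  define A where "A = {s..y} \<inter> f -` {0..}"
  have "closed A" unfolding A_def by (intro continuous_closed_preimage cont) auto
  then have "compact ({s..y} \<inter> A)" by (intro compact_Int_closed) auto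
  moreover have "{s..y} \<inter> A = A" by (auto simp: A_def)
  ultimately have "compact A" by simp
  moreover have "y \<in> A" using y sy by (simp add: A_def)
  ultimately obtain z where z: "z \<in> A" "\<And>t. t \<in> A \<Longrightarrow> z \<le> t"
    using compact_attains_inf[of A] by blast
  have below: "f t < 0" if "t < z" for t
    by (rule ccontr) (use z(2)[of t] neg[of t] that z(1) in \<open>force simp: A_def not_less\<close>)
  have sz: "s < z" using z(1) neg[of s] by (cases "z = s") (auto simp: A_def)
  have "f z \<le> 0"
  proof (rule ccontr)
    assume "\<not> f z \<le> 0"
    moreover have "continuous_on {s..z} f" using cont z(1) by (auto simp: A_def intro: continuous_on_subset)
    ultimately obtain x where "s \<le> x" "x \<le> z" "f x = f z / 2"
      using IVT'[of f s "f z / 2" z] neg[of s] sz by auto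
    then show False using below[of x] \<open>\<not> f z \<le> 0\<close> by (cases "x = z") auto
  qed
  then have "f z = 0" using z(1) by (auto simp: A_def)
  then show ?thesis using that sz z(1) below by (auto simp: A_def)
qed

text \<open>At the joint both pieces have the same two-sided derivative, so the difference quotient
  of the glued function is one of two quotients with a common limit. This attaches a solution
  started at \<open>c\<close> to an earlier one.\<close>

lemma glue_derivative:
  fixes f g :: "real \<Rightarrow> real"
  assumes "t < c \<Longrightarrow> (f has_real_derivative D) (at t)"
    "c \<le> t \<Longrightarrow> (g has_real_derivative D) (at t)"
    "t = c \<Longrightarrow> (f has_real_derivative D) (at t)" "f c = g c"
  shows "((\<lambda>x. if x < c then f x else g x) has_real_derivative D) (at t)"
proof (cases t c rule: linorder_cases)
  case less
  then have "\<forall>\<^sub>F x in nhds t. x < c"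
    by (simp add: eventually_nhds_in_open[of "{..<c}", simplified])
  then have "\<forall>\<^sub>F x in nhds t. (if x < c then f x else g x) = f x"
    by (rule eventually_mono) auto
  then show ?thesis using assms(1)[OF less] less by (simp add: DERIV_cong_ev)
next
  case greater
  then have "\<forall>\<^sub>F x in nhds t. c < x"
    by (simp add: eventually_nhds_in_open[of "{c<..}", simplified])
  then have "\<forall>\<^sub>F x in nhds t. (if x < c then f x else g x) = g x"
    by (rule eventually_mono) auto
  then show ?thesis using assms(2) greater by (simp add: DERIV_cong_ev)
next
  case equal
  have f: "((\<lambda>x. (f x - f t) / (x - t)) \<longlongrightarrow> D) (at t)"
    using assms(3)[OF equal] by (simp add: has_field_derivative_iff)
  have g: "((\<lambda>x. (g x - g t) / (x - t)) \<longlongrightarrow> D) (at t)"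
    using assms(2) equal by (simp add: has_field_derivative_iff)
  have "((\<lambda>x. if x < c then (f x - f t) / (x - t) else (g x - g t) / (x - t)) \<longlongrightarrow> D) (at t)"
    by (rule filterlim_If[OF filterlim_mono[OF f] filterlim_mono[OF g]])
      (rule inf_le1 order_refl)+
  then show ?thesis
    unfolding has_field_derivative_iff
    by (rule Lim_transform_eventually) (use equal assms(4) in \<open>auto simp: eventually_at_filter\<close>)
qed


section \<open>Picard iteration and maximal solutions of the flow\<close>

lemma picard:
  fixes F :: "'a :: banach \<Rightarrow> 'a"
  assumes lip: "L-lipschitz_on UNIV F" and bdd: "\<And>x. norm (F x) \<le> C"
  obtains x where "x 0 = x0" "\<And>t. 0 \<le> t \<Longrightarrow> (x has_vector_derivative F (x t)) (at t)"
proof -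
  have L: "0 \<le> L" using lip by (rule lipschitz_on_nonneg)
  have C: "0 \<le> C" using bdd[of x0] norm_ge_zero order_trans by blast
  define K where "K = L + 1"
  have K: "0 < K" using L by (simp add: K_def)
  have contF: "continuous_on UNIV F" using lip by (rule lipschitz_on_continuous_on)
  \<comment> \<open>The unknown is \<open>y t = exp (- K * t) *\<^sub>R x t\<close>. In this
    weighted supremum norm the integral operator contracts by \<open>L / K < 1\<close>, which yields
    existence on all of \<open>{0..}\<close> at once; boundedness of \<open>F\<close> lets
    \<open>x\<close> grow at most linearly, so \<open>y\<close> is bounded.\<close>
  define G where "G = (\<lambda>(y :: real \<Rightarrow>\<^sub>C 'a) r. F (exp (K * r) *\<^sub>R apply_bcontfun y r))"
  have contG: "continuous_on S (G y)" for y S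
    unfolding G_def
    by (rule continuous_on_compose2[OF contF]) (auto intro!: continuous_intros)
  have intG: "G y integrable_on {a..b}" for y and a b :: real
    using contG by (rule integrable_continuous_real)
  define I where "I = (\<lambda>y s. integral {0..s} (G y))"
  have normI: "norm (I y s) \<le> C * s" if "0 \<le> s" for y s
    unfolding I_def using integral_bound[of 0 s "G y" C] that bdd contG[of "{0..s}" y]
    by (auto simp: G_def)
  \<comment> \<open>Freezing the time at \<open>0\<close> for negative \<open>t\<close> extends
    functions on the half line to the whole line, the domain of the type of bounded continuous
    functions.\<close>
  define op where "op = (\<lambda>y t. exp (- K * max 0 t) *\<^sub>R (x0 + I y (max 0 t)))"
  have op_bd: "norm (op y t) \<le> norm x0 + C / K" for y t
  proof -
    define s where "s = max 0 t"
    have s: "0 \<le> s" by (simp add: s_def)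
    have "norm (op y t) \<le> exp (- K * s) * (norm x0 + C * s)"
      using normI[OF s, of y] norm_triangle_ineq[of x0 "I y s"]
      by (simp add: op_def s_def[symmetric])
    also have "\<dots> = exp (- K * s) * norm x0 + exp (- (K * s)) * (K * s) * (C / K)"
      using K by (simp add: field_simps)
    also have "\<dots> \<le> 1 * norm x0 + 1 * (C / K)"
    proof (intro add_mono mult_right_mono)
      have "K * s \<le> exp (K * s)" using exp_ge_add_one_self[of "K * s"] by linarith
      then show "exp (- (K * s)) * (K * s) \<le> 1" by (simp add: exp_minus field_simps)
    qed (use s K C in auto)
    finally show ?thesis by simp
  qed
  have contI: "continuous_on {0..} (I y)" for y
  proof -
    have "continuous_on {0..b} (I y)" for b
      unfolding I_def by (rule indefinite_integral_continuous_1[OF intG])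
    then have "isCont (\<lambda>s. I y (max 0 s)) t" for t
    proof -
      assume c: "\<And>b. continuous_on {0..b} (I y)"
      have "continuous_on {..<t + 1} (\<lambda>s. I y (max 0 s))"
        by (rule continuous_on_compose2[OF c[of "max 0 (t + 1)"]]) (auto intro!: continuous_intros)
      then show ?thesis by (simp add: continuous_on_eq_continuous_at)
    qed
    then have "continuous_on {0..} (\<lambda>s. I y (max 0 s))"
      by (simp add: continuous_at_imp_continuous_on)
    then show ?thesis by (rule continuous_on_eq) auto
  qed
  have op_cont: "continuous_on UNIV (op y)" for y
    unfolding op_def
    by (intro continuous_intros continuous_on_compose2[OF contI]) auto
  have op_bc: "op y \<in> bcontfun" for y
    using op_cont op_bd by (intro bcontfun_normI)
  define Op where "Op = (\<lambda>y. Bcontfun (op y))"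
  have Op: "apply_bcontfun (Op y) = op y" for y
    unfolding Op_def using op_bc by (rule Bcontfun_inverse)
  have "dist (Op y) (Op z) \<le> L / K * dist y z" for y z
  proof (rule dist_bound)
    fix t :: real
    define s where "s = max 0 t"
    have s: "0 \<le> s" by (simp add: s_def)
    have "((\<lambda>r. L * dist y z * exp (K * r)) has_integral
        L * dist y z * exp (K * s) / K - L * dist y z * exp (K * 0) / K) {0..s}"
      using K s by (intro fundamental_theorem_of_calculus)
        (auto intro!: derivative_eq_intros simp: has_real_derivative_iff_has_vector_derivative[symmetric])
    then have i: "((\<lambda>r. L * dist y z * exp (K * r)) has_integral
        L * dist y z * (exp (K * s) - 1) / K) {0..s}"
      by (simp add: diff_divide_distrib algebra_simps)
    have "norm (I y s - I z s) = norm (integral {0..s} (\<lambda>r. G y r - G z r))"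
      by (simp add: I_def integral_diff intG)
    also have "\<dots> \<le> integral {0..s} (\<lambda>r. L * dist y z * exp (K * r))"
    proof (rule integral_norm_bound_integral)
      show "norm (G y r - G z r) \<le> L * dist y z * exp (K * r)" if "r \<in> {0..s}" for r
      proof -
        have "norm (G y r - G z r) \<le> L * dist (exp (K * r) *\<^sub>R y r) (exp (K * r) *\<^sub>R z r)"
          unfolding G_def using lipschitz_onD[OF lip] by (simp add: dist_norm)
        also have "\<dots> = L * (exp (K * r) * dist (y r) (z r))"
          by (simp add: dist_norm scaleR_diff_right[symmetric])
        also have "\<dots> \<le> L * (exp (K * r) * dist y z)"
          using L dist_bounded[of y r z] by (intro mult_left_mono) auto
        finally show ?thesis by (simp add: algebra_simps)
      qed
    qed (use i intG in \<open>auto intro!: integrable_diff\<close>)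
    also have "\<dots> = L * dist y z * (exp (K * s) - 1) / K"
      using i by (rule integral_unique)
    also have "\<dots> \<le> L / K * dist y z * exp (K * s)"
      using L K by (simp add: divide_right_mono mult_left_mono algebra_simps)
    finally have "norm (I y s - I z s) \<le> L / K * dist y z * exp (K * s)" .
    then have "exp (- (K * s)) * norm (I y s - I z s)
        \<le> exp (- (K * s)) * (L / K * dist y z * exp (K * s))"
      by (intro mult_left_mono) auto
    also have "\<dots> = L / K * dist y z"
      by (simp add: exp_minus)
    finally show "dist (apply_bcontfun (Op y) t) (apply_bcontfun (Op z) t) \<le> L / K * dist y z"
      by (simp add: Op op_def s_def[symmetric] dist_norm scaleR_diff_right[symmetric])
  qed
  then have "\<exists>!y. Op y = y"
    using L K by (intro banach_fix_type[of "L / K"]) (auto simp: K_def)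
  then obtain y where y: "Op y = y" by blast
  \<comment> \<open>Integrating from \<open>-1\<close> makes the derivative at \<open>0\<close>
    two-sided; for \<open>t \<ge> 0\<close> this is still \<open>x0 + I y t\<close>.\<close>
  define x where "x = (\<lambda>t. x0 + (integral {-1..t} (G y) - integral {-1..0} (G y)))"
  have xy: "x t = exp (K * t) *\<^sub>R y t" if "0 \<le> t" for t
  proof -
    have "y t = exp (- (K * t)) *\<^sub>R (x0 + I y t)"
      using Op[of y] y that by (simp add: op_def)
    then have "exp (K * t) *\<^sub>R y t = x0 + I y t"
      by (simp add: exp_add[symmetric])
    moreover have "integral {-1..0} (G y) + I y t = integral {-1..t} (G y)"
      unfolding I_def using that intG by (intro Henstock_Kurzweil_Integration.integral_combine) auto
    ultimately show ?thesis by (simp add: x_def algebra_simps)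
  qed
  show ?thesis
  proof (rule that)
    show "x 0 = x0" by (simp add: x_def)
    fix t :: real assume t: "0 \<le> t"
    have "((\<lambda>t. integral {-1..t} (G y)) has_vector_derivative G y t) (at t within {-1..t + 1})"
      using t by (intro integral_has_vector_derivative contG) auto
    then have "((\<lambda>t. integral {-1..t} (G y)) has_vector_derivative G y t) (at t)"
      using t by (simp add: at_within_Icc_at)
    then have "(x has_vector_derivative G y t) (at t)"
      unfolding x_def by (auto intro!: derivative_eq_intros)
    then show "(x has_vector_derivative F (x t)) (at t)"
      using xy[OF t] by (simp add: G_def)
  qed
qed

text \<open>The difference splits into a change of the vector at fixed length and a change of the
  length; outside the unit ball each costs at most \<open>dist y z\<close>.\<close>

lemma lipschitz_sgn:
  fixes y z :: "'a :: real_normed_vector"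
  assumes "1 \<le> norm y" "1 \<le> norm z"
  shows "dist (sgn y) (sgn z) \<le> 2 * dist y z"
proof -
  have ny: "norm y > 0" "norm z > 0" using assms by auto
  have "sgn y - sgn z = (1 / norm y) *\<^sub>R (y - z) + (1 / norm y - 1 / norm z) *\<^sub>R z"
    using ny by (simp add: sgn_div_norm algebra_simps divide_inverse)
  then have "dist (sgn y) (sgn z) \<le> norm ((1 / norm y) *\<^sub>R (y - z)) + norm ((1 / norm y - 1 / norm z) *\<^sub>R z)"
    by (simp only: dist_norm norm_triangle_ineq)
  also have "norm ((1 / norm y) *\<^sub>R (y - z)) \<le> norm (y - z)"
    unfolding norm_scaleR using assms mult_right_mono[of 1 "norm y" "norm (y - z)"]
    by (simp add: divide_le_eq mult.commute)
  also have "norm ((1 / norm y - 1 / norm z) *\<^sub>R z) = \<bar>norm z - norm y\<bar> / norm y"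
  proof -
    have "1 / norm y - 1 / norm z = (norm z - norm y) / (norm y * norm z)"
      using ny by (simp add: field_simps)
    then show ?thesis using ny by (simp add: abs_mult)
  qed
  also have "\<dots> \<le> \<bar>norm z - norm y\<bar>"
    using ny assms mult_right_mono[of 1 "norm y" "\<bar>norm z - norm y\<bar>"]
    by (simp add: divide_le_eq mult.commute)
  also have "\<dots> \<le> norm (y - z)"
    by (metis norm_minus_commute norm_triangle_ineq3)
  finally show ?thesis by (simp add: dist_norm)
qed


lemma prod4_components:
  fixes y :: "real \<times> real \<times> real \<times> real"
  shows "\<bar>fst y\<bar> \<le> norm y" "\<bar>fst (snd y)\<bar> \<le> norm y" "\<bar>fst (snd (snd y))\<bar> \<le> norm y"
    "\<bar>snd (snd (snd y))\<bar> \<le> norm y"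
proof -
  have 1: "norm (fst z) \<le> norm z" "norm (snd z) \<le> norm z"
    for z :: "'u::real_normed_vector \<times> 'w::real_normed_vector"
    by (metis norm_fst_le prod.collapse) (metis norm_snd_le prod.collapse)
  show "\<bar>fst y\<bar> \<le> norm y" "\<bar>fst (snd y)\<bar> \<le> norm y" "\<bar>fst (snd (snd y))\<bar> \<le> norm y"
    "\<bar>snd (snd (snd y))\<bar> \<le> norm y"
    using 1[of y] 1[of "snd y"] 1[of "snd (snd y)"] by auto
qed

lemma abs_mult_diff_le:
  fixes a b c d D :: real
  assumes "\<bar>a\<bar> \<le> 1" "\<bar>d\<bar> \<le> 1" "\<bar>a - c\<bar> \<le> D" "\<bar>b - d\<bar> \<le> D"
  shows "\<bar>a * b - c * d\<bar> \<le> 2 * D"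
proof -
  have "a * b - c * d = a * (b - d) + (a - c) * d" by (simp add: algebra_simps)
  then have "\<bar>a * b - c * d\<bar> \<le> \<bar>a\<bar> * \<bar>b - d\<bar> + \<bar>a - c\<bar> * \<bar>d\<bar>"
    by (metis abs_mult abs_triangle_ineq)
  also have "\<dots> \<le> 1 * D + D * 1" using assms by (intro add_mono mult_mono) auto
  finally show ?thesis by simp
qed

lemma norm_prod4_le:
  fixes a b c d :: real
  shows "norm (a, b, c, d) \<le> \<bar>a\<bar> + \<bar>b\<bar> + \<bar>c\<bar> + \<bar>d\<bar>"
  using norm_Pair_le[of a "(b, c, d)"] norm_Pair_le[of b "(c, d)"] norm_Pair_le[of c d] by simp

lemma real_inverse_derivative:
  fixes f g :: "real \<Rightarrow> real"
  assumes "open S" "g y \<in> S" "continuous_on S f" "\<And>x. x \<in> S \<Longrightarrow> g (f x) = x" "f (g y) = y"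
    and "(f has_real_derivative D) (at (g y))" "D \<noteq> 0"
  shows "(g has_real_derivative inverse D) (at y)"
proof -
  show ?thesis
    unfolding has_field_derivative_def
    by (rule has_derivative_inverse_strong_x[of S g y f "(*) D"])
      (use assms in \<open>auto simp: o_def id_def has_field_derivative_def\<close>)
qed

text \<open>Slowing time down by the factor \<open>1 / (1 + f\<^sup>2 + v\<^sup>2 + B\<^sup>2)\<close> makes the vector field bounded and
  Lipschitz, so the slowed system lives forever; \<open>T\<close> is the limit of its clock.\<close>

lemma flow_maximal:
  fixes \<beta> f\<^sub>0 v\<^sub>0 b\<^sub>0 :: real
  obtains f v B :: "real \<Rightarrow> real" and T :: ereal where
    "0 < T" "f 0 = f\<^sub>0" "v 0 = v\<^sub>0" "B 0 = b\<^sub>0"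
    "\<And>t. 0 \<le> t \<Longrightarrow> ereal t < T \<Longrightarrow> (f has_real_derivative v t) (at t)"
    "\<And>t. 0 \<le> t \<Longrightarrow> ereal t < T \<Longrightarrow> (v has_real_derivative - f t * v t - B t) (at t)"
    "\<And>t. 0 \<le> t \<Longrightarrow> ereal t < T \<Longrightarrow> (B has_real_derivative \<beta> * (v t)\<^sup>2) (at t)"
    "\<And>K. (\<And>t. 0 \<le> t \<Longrightarrow> ereal t < T \<Longrightarrow> \<bar>f t\<bar> \<le> K \<and> \<bar>v t\<bar> \<le> K \<and> \<bar>B t\<bar> \<le> K) \<Longrightarrow> T = \<infinity>"
proof -
  \<comment> \<open>The entry \<open>1\<close> makes the vector field a homogeneous quadratic form
    in \<open>Y\<close> and keeps \<open>norm (Y x) \<ge> 1\<close>. Divided by the square of this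
    norm, the field becomes the same quadratic form \<open>H\<close> in the unit vector
    \<open>e\<close>, hence bounded and Lipschitz. The fourth coordinate of the state is the clock,
    on which the field does not depend.\<close>
  define Y where "Y = (\<lambda>x :: real \<times> real \<times> real \<times> real.
    (1 :: real, fst x, fst (snd x), fst (snd (snd x))))"
  define e where "e = (\<lambda>x. sgn (Y x))"
  define e0 where "e0 = (\<lambda>x. fst (e x))"
  define e1 where "e1 = (\<lambda>x. fst (snd (e x)))"
  define e2 where "e2 = (\<lambda>x. fst (snd (snd (e x))))"
  define e3 where "e3 = (\<lambda>x. snd (snd (snd (e x))))"
  define H where "H = (\<lambda>x. (e0 x * e2 x, - (e1 x * e2 x) - e0 x * e3 x, \<beta> * (e2 x * e2 x), e0 x * e0 x))"
  have nY: "1 \<le> norm (Y x)" for x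
    using prod4_components(1)[of "Y x"] by (simp add: Y_def)
  have ne: "norm (e x) = 1" for x
    by (metis e_def norm_sgn norm_zero not_one_le_zero nY)
  have bd: "\<bar>e0 x\<bar> \<le> 1" "\<bar>e1 x\<bar> \<le> 1" "\<bar>e2 x\<bar> \<le> 1" "\<bar>e3 x\<bar> \<le> 1" for x
    using prod4_components[of "e x"] by (auto simp: ne e0_def e1_def e2_def e3_def)
  have dY: "dist (Y x) (Y y) \<le> dist x y" for x y
  proof -
    have "norm (a, b, c) \<le> norm (a, b, c, d)" for a b c d :: real
      by (simp add: norm_Pair)
    then show ?thesis
      by (cases x rule: prod_cases4; cases y rule: prod_cases4)
        (simp add: Y_def dist_norm norm_Pair)
  qed
  have de: "dist (e x) (e y) \<le> 2 * dist x y" for x y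
    using lipschitz_sgn[OF nY nY, of x y] dY[of x y] by (simp add: e_def)
  have di: "\<bar>e0 x - e0 y\<bar> \<le> 2 * dist x y" "\<bar>e1 x - e1 y\<bar> \<le> 2 * dist x y"
    "\<bar>e2 x - e2 y\<bar> \<le> 2 * dist x y" "\<bar>e3 x - e3 y\<bar> \<le> 2 * dist x y" for x y
    using prod4_components[of "e x - e y"] de[of x y]
    by (auto simp: dist_norm e0_def e1_def e2_def e3_def)
  have m: "\<bar>e0 x * e2 x - e0 y * e2 y\<bar> \<le> 4 * dist x y" "\<bar>e1 x * e2 x - e1 y * e2 y\<bar> \<le> 4 * dist x y"
    "\<bar>e0 x * e3 x - e0 y * e3 y\<bar> \<le> 4 * dist x y" "\<bar>e2 x * e2 x - e2 y * e2 y\<bar> \<le> 4 * dist x y"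
    "\<bar>e0 x * e0 x - e0 y * e0 y\<bar> \<le> 4 * dist x y" for x y
    using abs_mult_diff_le[OF bd(1) bd(3) di(1) di(3), of x y] abs_mult_diff_le[OF bd(2) bd(3) di(2) di(3), of x y]
      abs_mult_diff_le[OF bd(1) bd(4) di(1) di(4), of x y] abs_mult_diff_le[OF bd(3) bd(3) di(3) di(3), of x y]
      abs_mult_diff_le[OF bd(1) bd(1) di(1) di(1), of x y] by auto
  have lip: "(16 + 4 * \<bar>\<beta>\<bar>)-lipschitz_on UNIV H"
  proof (rule lipschitz_onI)
    fix x y
    have "dist (H x) (H y) \<le> \<bar>e0 x * e2 x - e0 y * e2 y\<bar>
        + \<bar>(- (e1 x * e2 x) - e0 x * e3 x) - (- (e1 y * e2 y) - e0 y * e3 y)\<bar>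
        + \<bar>\<beta> * (e2 x * e2 x) - \<beta> * (e2 y * e2 y)\<bar> + \<bar>e0 x * e0 x - e0 y * e0 y\<bar>"
      using norm_prod4_le by (simp add: dist_norm H_def)
    also have "\<bar>\<beta> * (e2 x * e2 x) - \<beta> * (e2 y * e2 y)\<bar> \<le> \<bar>\<beta>\<bar> * (4 * dist x y)"
      using m(4)[of x y] by (simp add: right_diff_distrib[symmetric] abs_mult mult_left_mono)
    also have "\<bar>(- (e1 x * e2 x) - e0 x * e3 x) - (- (e1 y * e2 y) - e0 y * e3 y)\<bar> \<le> 8 * dist x y"
      using m(2,3)[of x y] by linarith
    finally show "dist (H x) (H y) \<le> (16 + 4 * \<bar>\<beta>\<bar>) * dist x y"
      using m(1,5)[of x y] by (simp add: algebra_simps)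
  qed simp
  have bH: "norm (H x) \<le> 4 + \<bar>\<beta>\<bar>" for x
  proof -
    have p: "\<bar>a * b\<bar> \<le> 1" if "\<bar>a\<bar> \<le> 1" "\<bar>b\<bar> \<le> 1" for a b :: real
      using mult_mono[OF that] that by (simp add: abs_mult)
    have "norm (H x) \<le> \<bar>e0 x * e2 x\<bar> + \<bar>- (e1 x * e2 x) - e0 x * e3 x\<bar> + \<bar>\<beta> * (e2 x * e2 x)\<bar> + \<bar>e0 x * e0 x\<bar>"
      unfolding H_def by (rule norm_prod4_le)
    also have "\<bar>\<beta> * (e2 x * e2 x)\<bar> \<le> \<bar>\<beta>\<bar>"
      using p[OF bd(3) bd(3), of x x] by (simp add: abs_mult mult_left_le)
    finally show ?thesis
      using p[OF bd(1) bd(3), of x x] p[OF bd(2) bd(3), of x x] p[OF bd(1) bd(4), of x x]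
        p[OF bd(1) bd(1), of x x] by linarith
  qed
  obtain x where x0: "x 0 = (f\<^sub>0, v\<^sub>0, b\<^sub>0, 0)"
    and x: "\<And>t. 0 \<le> t \<Longrightarrow> (x has_vector_derivative H (x t)) (at t)"
    using picard[OF lip bH] by blast
  define \<rho> where "\<rho> = (\<lambda>s. (1 / norm (Y (x s)))\<^sup>2)"
  have \<rho>: "0 < \<rho> s" for s
    using nY[of "x s"] by (auto simp: \<rho>_def intro!: zero_less_power divide_pos_pos)
  define f v B c where "f = (\<lambda>s. fst (x s))" and "v = (\<lambda>s. fst (snd (x s)))"
    and "B = (\<lambda>s. fst (snd (snd (x s))))" and "c = (\<lambda>s. snd (snd (snd (x s))))"
  have ei: "e0 (x s) = 1 / norm (Y (x s))" "e1 (x s) = f s / norm (Y (x s))"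
    "e2 (x s) = v s / norm (Y (x s))" "e3 (x s) = B s / norm (Y (x s))" for s
    by (simp_all add: e0_def e1_def e2_def e3_def e_def sgn_div_norm Y_def f_def v_def B_def divide_inverse)
  have Hx: "H (x s) = (\<rho> s * v s, \<rho> s * (- f s * v s - B s), \<rho> s * (\<beta> * (v s)\<^sup>2), \<rho> s)" for s
    by (simp add: H_def ei \<rho>_def power2_eq_square diff_divide_distrib algebra_simps)
  have snd: "((\<lambda>s. snd (g s)) has_vector_derivative snd G) F"
    and fst: "((\<lambda>s. fst (g s)) has_vector_derivative fst G) F"
    if "(g has_vector_derivative G) F" for g :: "real \<Rightarrow> 'u::real_normed_vector \<times> 'w::real_normed_vector" and G F
    using bounded_linear.has_vector_derivative[OF bounded_linear_snd that]
      bounded_linear.has_vector_derivative[OF bounded_linear_fst that] by auto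
  have d: "(f has_real_derivative \<rho> s * v s) (at s)"
    "(v has_real_derivative \<rho> s * (- f s * v s - B s)) (at s)"
    "(B has_real_derivative \<rho> s * (\<beta> * (v s)\<^sup>2)) (at s)"
    "(c has_real_derivative \<rho> s) (at s)" if "0 \<le> s" for s
    unfolding has_real_derivative_iff_has_vector_derivative f_def v_def B_def c_def
    using fst[OF x[OF that]] fst[OF snd[OF x[OF that]]] fst[OF snd[OF snd[OF x[OF that]]]]
      snd[OF snd[OF snd[OF x[OF that]]]] Hx[of s]
    by (simp_all add: f_def v_def B_def)
  \<comment> \<open>The clock is continued to negative arguments with its slope at \<open>0\<close>,
    so that it increases strictly on the whole line and its inverse has a two-sided derivative at
    \<open>0\<close>.\<close>
  define C where "C = (\<lambda>s. if s < 0 then s * \<rho> 0 else c s)"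
  have c0: "c 0 = 0" by (simp add: c_def x0)
  have dC: "(C has_real_derivative \<rho> (max 0 s)) (at s)" for s
    unfolding C_def
    by (rule glue_derivative) (auto intro!: derivative_eq_intros d(4) simp: c0 max_def)
  have C_mono: "strict_mono C"
    by (rule strict_monoI, rule DERIV_pos_imp_increasing) (use dC \<rho> in blast)+
  have C_inj: "inj C" by (rule strict_mono_imp_inj_on[OF C_mono])
  have C_cont: "continuous_on UNIV C"
    using dC by (meson DERIV_isCont continuous_at_imp_continuous_on)
  have C0: "C 0 = 0" by (simp add: C_def c0)
  define S where "S = inv C"
  have SC: "S (C s) = s" for s by (simp add: S_def C_inj)
  define T where "T = (SUP s\<in>{0..}. ereal (C s))"
  have CT: "ereal (C s) < T" if "0 \<le> s" for s
  proof -
    have "C s < C (s + 1)" using C_mono by (simp add: strict_mono_def)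
    also have "ereal (C (s + 1)) \<le> T" unfolding T_def using that by (intro SUP_upper) auto
    finally show ?thesis by simp
  qed
  have CS: "C (S t) = t" "0 \<le> S t" if t: "0 \<le> t" "ereal t < T" for t
  proof -
    obtain r where r: "0 \<le> r" "t < C r"
      using t(2) unfolding T_def less_SUP_iff by auto
    obtain s where "0 \<le> s" "s \<le> r" "C s = t"
      using IVT'[of C 0 t r] r t C0 continuous_on_subset[OF C_cont] by auto
    then show "C (S t) = t" "0 \<le> S t" using SC by auto
  qed
  have dS: "(S has_real_derivative inverse (\<rho> (S t))) (at t)" if "0 \<le> t" "ereal t < T" for t
    using real_inverse_derivative[of UNIV S t C "\<rho> (max 0 (S t))"] dC[of "S t"] CS[OF that] SC \<rho>[of "S t"] C_cont
    by (auto simp: max_def)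
  have chain: "((\<lambda>t. g (S t)) has_real_derivative D) (at t)"
    if "(g has_real_derivative \<rho> (S t) * D) (at (S t))" "0 \<le> t" "ereal t < T" for g D t
    using DERIV_chain2[OF that(1) dS[OF that(2,3)]] \<rho>[of "S t"] by (simp add: field_simps)
  show ?thesis
  proof (rule that[of T "\<lambda>t. f (S t)" "\<lambda>t. v (S t)" "\<lambda>t. B (S t)"])
    show "0 < T" using CT[of 0] C0 by (simp add: zero_ereal_def)
    have "S 0 = 0" using SC[of 0] C0 by simp
    then show "f (S 0) = f\<^sub>0" "v (S 0) = v\<^sub>0" "B (S 0) = b\<^sub>0"
      by (simp_all add: f_def v_def B_def x0)
    fix K
    assume K: "\<And>t. 0 \<le> t \<Longrightarrow> ereal t < T \<Longrightarrow> \<bar>f (S t)\<bar> \<le> K \<and> \<bar>v (S t)\<bar> \<le> K \<and> \<bar>B (S t)\<bar> \<le> K"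
    have K': "\<bar>f s\<bar> \<le> K" "\<bar>v s\<bar> \<le> K" "\<bar>B s\<bar> \<le> K" if "0 \<le> s" for s
      using K[of "C s"] CT[OF that] C0 that strict_mono_less_eq[OF C_mono, of 0 s] by (auto simp: SC)
    have K0: "0 \<le> K" using K'(1)[of 0] by simp
    \<comment> \<open>While the state is bounded by \<open>K\<close>, the clock runs at speed at
      least \<open>r\<close>, so its supremum cannot be finite.\<close>
    define r where "r = (1 / (1 + 3 * K))\<^sup>2"
    have r: "0 < r" using K0 by (auto simp: r_def intro!: zero_less_power divide_pos_pos)
    have "r \<le> \<rho> s" if "0 \<le> s" for s
    proof -
      have "norm (Y (x s)) \<le> 1 + \<bar>f s\<bar> + \<bar>v s\<bar> + \<bar>B s\<bar>"
        unfolding Y_def f_def v_def B_def using norm_prod4_le[of 1] by simp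
      also have "\<dots> \<le> 1 + 3 * K" using K'[OF that] by simp
      finally have "norm (Y (x s)) \<le> 1 + 3 * K" .
      then show ?thesis unfolding r_def \<rho>_def using nY[of "x s"]
        by (intro power_mono divide_left_mono) (auto intro!: mult_pos_pos)
    qed
    then have lin: "r * s \<le> C s" if "0 \<le> s" for s
      using DERIV_nonneg_imp_nondecreasing[OF that, of "\<lambda>s. C s - r * s"] C0 dC
      by (force intro!: derivative_eq_intros)
    show "T = \<infinity>"
    proof (rule ccontr)
      assume "T \<noteq> \<infinity>"
      then obtain t where t: "T = ereal t" using \<open>0 < T\<close> by (cases T) auto
      have "0 < t" using \<open>0 < T\<close> t by simp
      then have "t \<le> C (t / r)" using lin[of "t / r"] r by simp
      moreover have "C (t / r) < t" using CT[of "t / r"] t \<open>0 < t\<close> r by simp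
      ultimately show False by simp
    qed
  qed (use chain CS d in auto)
qed

section \<open>The Lyapunov series\<close>

text \<open>In the variable \<open>exp (a * t)\<close>, differentiation in \<open>t\<close>
  multiplies the \<open>n\<close>-th coefficient by \<open>a * n\<close>, so every derivative of the
  Lyapunov series is a series of the same kind on the same range.\<close>

lemma powser_exp:
  fixes c :: "nat \<Rightarrow> real"
  assumes c: "\<And>x. \<bar>x\<bar> < r \<Longrightarrow> summable (\<lambda>n. c n * x ^ n)"
  shows "\<And>x. \<bar>x\<bar> < r \<Longrightarrow> summable (\<lambda>n. real n * c n * x ^ n)"
    and "\<And>x. \<bar>x\<bar> < r \<Longrightarrow> summable (\<lambda>n. norm (c n * x ^ n))"
    and "exp (a * t) < r \<Longrightarrow> ((\<lambda>t. \<Sum>n. c n * exp (a * t) ^ n) has_real_derivative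
      a * (\<Sum>n. real n * c n * exp (a * t) ^ n)) (at t)"
proof -
  have D: "((\<lambda>x. \<Sum>n. c n * x ^ n) has_real_derivative (\<Sum>n. diffs c n * x ^ n)) (at x)"
    and s: "summable (\<lambda>n. diffs c n * x ^ n)" if "\<bar>x\<bar> < r" for x
    using termdiffs_strong'[of r c x] c termdiff_converges[of x r c] that by auto
  have "(\<lambda>n. real n * c n * x ^ n) sums (x * (\<Sum>n. diffs c n * x ^ n))" if "\<bar>x\<bar> < r" for x
  proof -
    have "(\<lambda>n. x * (diffs c n * x ^ n)) sums (x * (\<Sum>n. diffs c n * x ^ n))"
      using s[OF that] by (intro sums_mult summable_sums)
    then have "(\<lambda>n. real (Suc n) * c (Suc n) * x ^ Suc n) sums (x * (\<Sum>n. diffs c n * x ^ n))"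
      by (simp add: diffs_def algebra_simps)
    then show ?thesis by (subst (asm) sums_Suc_iff) simp
  qed
  note e = this
  show "summable (\<lambda>n. real n * c n * x ^ n)" if "\<bar>x\<bar> < r" for x
    using e[OF that] by (rule sums_summable)
  show "summable (\<lambda>n. norm (c n * x ^ n))" if "\<bar>x\<bar> < r" for x
    using powser_insidea[of c "(\<bar>x\<bar> + r) / 2" x] c[of "(\<bar>x\<bar> + r) / 2"] that by simp
  assume "exp (a * t) < r"
  then have r: "\<bar>exp (a * t)\<bar> < r" by simp
  have "((\<lambda>t. \<Sum>n. c n * exp (a * t) ^ n) has_real_derivative
      (\<Sum>n. diffs c n * exp (a * t) ^ n) * (exp (a * t) * a)) (at t)"
    by (rule DERIV_chain2[where g = "\<lambda>t. exp (a * t)", OF D[OF r]]) (auto intro!: derivative_eq_intros)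
  then show "((\<lambda>t. \<Sum>n. c n * exp (a * t) ^ n) has_real_derivative
      a * (\<Sum>n. real n * c n * exp (a * t) ^ n)) (at t)"
    using sums_unique[OF e[OF r]] by (simp add: algebra_simps)
qed

lemma powser_over_exp_tendsto:
  fixes c :: "nat \<Rightarrow> real"
  assumes c: "\<And>x. \<bar>x\<bar> < r \<Longrightarrow> summable (\<lambda>n. c n * x ^ n)" and "0 < r" "c 0 = 0" "0 < a"
  shows "((\<lambda>t. (\<Sum>n. c n * exp (a * t) ^ n) / exp (a * t)) \<longlongrightarrow> c 1) at_bot"
proof -
  have "((\<lambda>x. \<Sum>n. c n * x ^ n) has_real_derivative (\<Sum>n. diffs c n * 0 ^ n)) (at 0)"
    using termdiffs_strong'[of r c 0] assms by auto
  then have "((\<lambda>x. (\<Sum>n. c n * x ^ n) / x) \<longlongrightarrow> c 1) (at 0)"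
    using assms(3) by (simp add: has_field_derivative_iff diffs_def)
  moreover have "filterlim (\<lambda>t. exp (a * t)) (at 0) at_bot"
  proof (rule filterlim_atI)
    show "((\<lambda>t. exp (a * t)) \<longlongrightarrow> 0) at_bot"
      by (rule filterlim_compose[OF exp_at_bot])
        (rule filterlim_tendsto_pos_mult_at_bot[OF tendsto_const assms(4) filterlim_ident])
  qed simp
  ultimately show ?thesis by (rule filterlim_compose)
qed

context
  fixes m a \<beta> :: real
  assumes a: "0 < a" and m: "m \<noteq> 0" and \<beta>: "\<beta> = (1 - 2 * m) / m" "0 \<le> \<beta>"
begin

lemma lyapunov_coeff_0 [simp]: "lyapunov_coeff m a 0 = 0"
  and lyapunov_coeff_1 [simp]: "lyapunov_coeff m a (Suc 0) = 1"
  by (simp_all add: lyapunov_coeff.simps)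

text \<open>Since \<open>(m - 1) / m = - (1 + \<beta>)\<close>, the recursion takes weights of one
  sign, which can be estimated term by term.\<close>

lemma lyapunov_coeff_rec:
  assumes "2 \<le> l"
  shows "a * (real l)\<^sup>2 * (real l - 1) * lyapunov_coeff m a l =
    - (\<Sum>k\<in>{1..<l}. real k * ((1 + \<beta>) * (real l - real k) + real k)
        * (lyapunov_coeff m a k * lyapunov_coeff m a (l - k)))"
proof -
  have "(m - 1) * x / m = - (1 + \<beta>) * x" for x
    using m by (simp add: \<beta> field_simps)
  then have "lyapunov_coeff m a l = 1 / (a * (real l)\<^sup>2 * (real l - 1)) *
       (\<Sum>k\<in>{1..<l}. real k * (- (1 + \<beta>) * (real l - real k) - real k)
          * lyapunov_coeff m a k * lyapunov_coeff m a (l - k))"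
    using assms by (subst lyapunov_coeff.simps) simp
  also have "(\<Sum>k\<in>{1..<l}. real k * (- (1 + \<beta>) * (real l - real k) - real k)
          * lyapunov_coeff m a k * lyapunov_coeff m a (l - k))
      = - (\<Sum>k\<in>{1..<l}. real k * ((1 + \<beta>) * (real l - real k) + real k)
        * (lyapunov_coeff m a k * lyapunov_coeff m a (l - k)))"
    unfolding sum_negf[symmetric] by (rule sum.cong) (auto simp: algebra_simps)
  finally show ?thesis using a assms by (simp del: of_nat_le_iff)
qed

text \<open>Because \<open>\<beta> \<ge> 0\<close>, the weight of the \<open>k\<close>-th term is at
  most \<open>(1 + \<beta>) * l * k\<close>, and the \<open>k\<close> add up to
  \<open>l * (l - 1) / 2\<close>. Division by \<open>a * l\<^sup>2 * (l - 1)\<close> leaves exactly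
  one factor \<open>(1 + \<beta>) / (2 * a)\<close>, which closes the induction.\<close>

lemma lyapunov_coeff_bound:
  "1 \<le> l \<Longrightarrow> \<bar>lyapunov_coeff m a l\<bar> \<le> ((1 + \<beta>) / (2 * a)) ^ (l - 1)"
proof (induction l rule: less_induct)
  case (less l)
  define C where "C = (1 + \<beta>) / (2 * a)"
  have C: "0 \<le> C" using a \<beta> by (simp add: C_def)
  show ?case
  proof (cases "l = 1")
    case False
    with less.prems have l: "2 \<le> l" by simp
    let ?h = "lyapunov_coeff m a"
    have tm: "\<bar>real k * ((1 + \<beta>) * (real l - real k) + real k) * (?h k * ?h (l - k))\<bar>
        \<le> (1 + \<beta>) * real l * C ^ (l - 2) * real k" if k: "k \<in> {1..<l}" for k
    proof -
      have "\<bar>?h k\<bar> * \<bar>?h (l - k)\<bar> \<le> C ^ (k - 1) * C ^ (l - k - 1)"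
        using k less.IH[of k] less.IH[of "l - k"] C by (intro mult_mono) (auto simp: C_def)
      also have "\<dots> = C ^ (l - 2)"
        using k by (simp add: power_add[symmetric])
      finally have 1: "\<bar>?h k * ?h (l - k)\<bar> \<le> C ^ (l - 2)" by (simp add: abs_mult)
      have "0 \<le> (1 + \<beta>) * (real l - real k) + real k" "0 \<le> \<beta> * real k"
        using k \<beta>(2) by (auto intro!: add_nonneg_nonneg mult_nonneg_nonneg)
      moreover from this have "(1 + \<beta>) * (real l - real k) + real k \<le> (1 + \<beta>) * real l"
        by (simp add: algebra_simps)
      ultimately have "real k * ((1 + \<beta>) * (real l - real k) + real k) * \<bar>?h k * ?h (l - k)\<bar>
          \<le> real k * ((1 + \<beta>) * real l) * C ^ (l - 2)"
        using 1 by (intro mult_mono) auto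
      also have "\<dots> = (1 + \<beta>) * real l * C ^ (l - 2) * real k"
        by (simp only: mult_ac)
      finally show ?thesis
        using \<open>0 \<le> (1 + \<beta>) * (real l - real k) + real k\<close>
        by (simp only: abs_mult[of "real k * _"] abs_mult[of "real k"] abs_of_nonneg of_nat_0_le_iff)
    qed
    have "a * (real l)\<^sup>2 * (real l - 1) * \<bar>?h l\<bar> = \<bar>a * (real l)\<^sup>2 * (real l - 1) * ?h l\<bar>"
      using a l by (simp add: abs_mult)
    also have "\<dots> \<le> (\<Sum>k\<in>{1..<l}. (1 + \<beta>) * real l * C ^ (l - 2) * real k)"
      unfolding lyapunov_coeff_rec[OF l] abs_minus_cancel
      by (rule order_trans[OF sum_abs sum_mono]) (rule tm)
    also have "\<dots> = (1 + \<beta>) * real l * C ^ (l - 2) * (\<Sum>k\<in>{1..<l}. real k)"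
      by (simp add: sum_distrib_left)
    also have "(\<Sum>k\<in>{1..<l}. real k) = real l * (real l - 1) / 2"
      using l by (induction l rule: dec_induct) (auto simp: field_simps numeral_2_eq_2)
    also have "(1 + \<beta>) * real l * C ^ (l - 2) * (real l * (real l - 1) / 2)
        = a * (real l)\<^sup>2 * (real l - 1) * (C * C ^ (l - 2))"
      using a by (simp add: C_def power2_eq_square)
    also have "C * C ^ (l - 2) = C ^ (l - 1)"
      using l by (simp add: power_Suc[symmetric] del: power_Suc) (metis Suc_diff_le numeral_2_eq_2 diff_Suc_Suc)
    finally show ?thesis
      using a l by (simp add: C_def)
  qed simp
qed

text \<open>With \<open>S j\<close> the series of coefficients
  \<open>n ^ j * lyapunov_coeff m a n\<close>, this is the \<open>n\<close>-th coefficient of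
  \<open>a * S 3 - a * S 2 + S 0 * S 2 + (1 + \<beta>) * (S 1)\<^sup>2\<close>, the equation for
  \<open>f = - a + S 0\<close> divided by \<open>a\<^sup>2\<close>. The linear factor vanishes for
  \<open>n = 1\<close>, which leaves the first coefficient free: the origin of the parameter
  \<open>d\<close>.\<close>

lemma lyapunov_coeff_conv:
  "a * (real n ^ 3 - real n ^ 2) * lyapunov_coeff m a n
    + (\<Sum>i\<le>n. lyapunov_coeff m a i * (real (n - i) ^ 2 * lyapunov_coeff m a (n - i)))
    + (1 + \<beta>) * (\<Sum>i\<le>n. real i * lyapunov_coeff m a i * (real (n - i) * lyapunov_coeff m a (n - i))) = 0"
proof (cases "2 \<le> n")
  case False
  then have "n = 0 \<or> n = 1" by auto
  then show ?thesis by auto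
next
  case True
  let ?h = "lyapunov_coeff m a"
  have red: "(\<Sum>i\<le>n. g i) = (\<Sum>i\<in>{1..<n}. g i)" if "g 0 = 0" "g n = 0" for g :: "nat \<Rightarrow> real"
  proof (rule sum.mono_neutral_right)
    have "i = 0 \<or> i = n" if "i \<in> {..n} - {1..<n}" for i using that by auto
    then show "\<forall>i\<in>{..n} - {1..<n}. g i = 0" using that by metis
  qed auto
  have "(\<Sum>i\<le>n. ?h i * (real (n - i) ^ 2 * ?h (n - i))) = (\<Sum>i\<in>{1..<n}. ?h i * (real (n - i) ^ 2 * ?h (n - i)))"
    by (rule red) auto
  also have "\<dots> = (\<Sum>i\<in>{1..<n}. real i ^ 2 * (?h i * ?h (n - i)))"
    by (rule sum.reindex_bij_witness[of _ "\<lambda>i. n - i" "\<lambda>i. n - i"]) (auto simp: algebra_simps)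
  finally have 1: "(\<Sum>i\<le>n. ?h i * (real (n - i) ^ 2 * ?h (n - i))) = \<dots>" .
  have 2: "(\<Sum>i\<le>n. real i * ?h i * (real (n - i) * ?h (n - i)))
      = (\<Sum>i\<in>{1..<n}. real i * (real n - real i) * (?h i * ?h (n - i)))"
    by (subst red) (auto intro!: sum.cong simp: of_nat_diff)
  have "a * (real n ^ 3 - real n ^ 2) * ?h n = a * (real n)\<^sup>2 * (real n - 1) * ?h n"
    by (simp add: power3_eq_cube power2_eq_square algebra_simps)
  then show ?thesis
    unfolding 1 2 lyapunov_coeff_rec[OF True]
    by (simp add: sum_distrib_left sum.distrib[symmetric] sum_negf[symmetric])
      (rule sum.neutral, simp add: power2_eq_square algebra_simps)
qed

text \<open>This is the member with \<open>d = 1\<close>; translation in time turns it into the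
  members with other positive parameters.\<close>

lemma lyapunov_series:
  obtains T :: real and f v B :: "real \<Rightarrow> real" where
    "\<And>t. t < T \<Longrightarrow> (f has_real_derivative v t) (at t)"
    "\<And>t. t < T \<Longrightarrow> (v has_real_derivative - f t * v t - B t) (at t)"
    "\<And>t. t < T \<Longrightarrow> (B has_real_derivative \<beta> * (v t)\<^sup>2) (at t)"
    "\<And>t. t < T \<Longrightarrow> (\<lambda>l. lyapunov_coeff m a l * exp (real l * a * t)) sums (f t + a)"
    "\<And>t. t < T \<Longrightarrow> 0 < v t"
    "\<And>\<epsilon>. \<epsilon> < a \<Longrightarrow> ((\<lambda>t. exp (- \<epsilon> * t) * (f t + a)) \<longlongrightarrow> 0) at_bot"
    "\<And>\<epsilon>. \<epsilon> < a \<Longrightarrow> ((\<lambda>t. exp (- \<epsilon> * t) * v t) \<longlongrightarrow> 0) at_bot"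
    "\<And>\<epsilon>. \<epsilon> < a \<Longrightarrow> ((\<lambda>t. exp (- \<epsilon> * t) * (- f t * v t - B t)) \<longlongrightarrow> 0) at_bot"
proof -
  let ?h = "lyapunov_coeff m a"
  define C where "C = (1 + \<beta>) / (2 * a)"
  have C: "0 < C" using a \<beta> by (auto simp: C_def intro!: divide_pos_pos)
  define r where "r = 1 / C"
  have r: "0 < r" using C by (simp add: r_def)
  define c where "c = (\<lambda>j n. real n ^ j * ?h n)"
  have c_Suc: "real n * c j n = c (Suc j) n" for j n by (simp add: c_def)
  have sumc: "summable (\<lambda>n. c j n * x ^ n)" if "\<bar>x\<bar> < r" for j x
    using that
  proof (induction j arbitrary: x)
    case 0
    have "summable (\<lambda>n. \<bar>x\<bar> * (C * \<bar>x\<bar>) ^ n)"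
      using 0 C by (intro summable_mult summable_geometric) (simp add: r_def field_simps abs_mult)
    then have "summable (\<lambda>n. ?h (Suc n) * x ^ Suc n)"
    proof (rule summable_comparison_test[rotated], intro exI allI impI)
      fix n
      have "norm (?h (Suc n) * x ^ Suc n) = \<bar>?h (Suc n)\<bar> * \<bar>x\<bar> ^ Suc n"
        by (simp add: abs_mult power_abs)
      also have "\<dots> \<le> C ^ n * \<bar>x\<bar> ^ Suc n"
        using lyapunov_coeff_bound[of "Suc n"] by (intro mult_right_mono) (auto simp: C_def)
      finally show "norm (?h (Suc n) * x ^ Suc n) \<le> \<bar>x\<bar> * (C * \<bar>x\<bar>) ^ n"
        by (simp add: power_mult_distrib algebra_simps)
    qed
    then show ?case by (subst (asm) summable_Suc_iff) (simp add: c_def)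
  next
    case (Suc j)
    show ?case using powser_exp(1)[of r "c j" x, OF Suc.IH Suc.prems] by (simp add: c_Suc)
  qed
  define S where "S = (\<lambda>j t. \<Sum>n. c j n * exp (a * t) ^ n)"
  have dS: "(S j has_real_derivative a * S (Suc j) t) (at t)" if "exp (a * t) < r" for j t
    using powser_exp(3)[of r "c j" a t, OF sumc that] by (simp add: S_def c_Suc)
  have ode: "a * S 3 t - a * S 2 t + S 0 t * S 2 t + (1 + \<beta>) * (S 1 t)\<^sup>2 = 0"
    if t: "exp (a * t) < r" for t
  proof -
    let ?x = "exp (a * t)"
    have x: "\<bar>?x\<bar> < r" using t by simp
    have n: "summable (\<lambda>n. norm (c j n * ?x ^ n))" for j
      by (rule powser_exp(2)[OF sumc x])
    have s: "(\<lambda>n. c j n * ?x ^ n) sums S j t" for j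
      unfolding S_def using sumc[OF x] by (rule summable_sums)
    have P: "(\<lambda>n. \<Sum>i\<le>n. c j i * ?x ^ i * (c k (n - i) * ?x ^ (n - i))) sums (S j t * S k t)" for j k
      unfolding S_def by (rule Cauchy_product_sums[OF n n])
    have "(\<lambda>n. \<Sum>i\<le>n. c j i * ?x ^ i * (c k (n - i) * ?x ^ (n - i)))
        = (\<lambda>n. (\<Sum>i\<le>n. c j i * c k (n - i)) * ?x ^ n)" for j k
    proof (rule ext, subst sum_distrib_right, rule sum.cong)
      fix n i :: nat assume "i \<in> {..n}"
      then have "?x ^ n = ?x ^ i * ?x ^ (n - i)" by (simp add: power_add[symmetric])
      then show "c j i * ?x ^ i * (c k (n - i) * ?x ^ (n - i)) = c j i * c k (n - i) * ?x ^ n"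
        by (simp only: mult.assoc mult.left_commute)
    qed simp
    note P' = P[unfolded this]
    have "(\<lambda>n. a * (c 3 n * ?x ^ n) - a * (c 2 n * ?x ^ n) + (\<Sum>i\<le>n. c 0 i * c 2 (n - i)) * ?x ^ n
          + (1 + \<beta>) * ((\<Sum>i\<le>n. c 1 i * c 1 (n - i)) * ?x ^ n))
        sums (a * S 3 t - a * S 2 t + S 0 t * S 2 t + (1 + \<beta>) * (S 1 t * S 1 t))"
      by (intro sums_add sums_diff sums_mult s P')
    moreover have "a * (c 3 n * ?x ^ n) - a * (c 2 n * ?x ^ n) + (\<Sum>i\<le>n. c 0 i * c 2 (n - i)) * ?x ^ n
          + (1 + \<beta>) * ((\<Sum>i\<le>n. c 1 i * c 1 (n - i)) * ?x ^ n) = 0" for n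
    proof -
      have "a * (c 3 n * ?x ^ n) - a * (c 2 n * ?x ^ n) + (\<Sum>i\<le>n. c 0 i * c 2 (n - i)) * ?x ^ n
          + (1 + \<beta>) * ((\<Sum>i\<le>n. c 1 i * c 1 (n - i)) * ?x ^ n)
        = (a * (real n ^ 3 - real n ^ 2) * ?h n
          + (\<Sum>i\<le>n. ?h i * (real (n - i) ^ 2 * ?h (n - i)))
          + (1 + \<beta>) * (\<Sum>i\<le>n. real i * ?h i * (real (n - i) * ?h (n - i)))) * ?x ^ n"
        by (simp add: c_def algebra_simps)
      then show ?thesis unfolding lyapunov_coeff_conv by simp
    qed
    ultimately have "(\<lambda>n. 0) sums (a * S 3 t - a * S 2 t + S 0 t * S 2 t + (1 + \<beta>) * (S 1 t * S 1 t))"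
      by simp
    then show ?thesis using sums_unique2 sums_zero by (metis power2_eq_square)
  qed
  have ratio: "((\<lambda>t. S j t / exp (a * t)) \<longlongrightarrow> 1) at_bot" for j
    using powser_over_exp_tendsto[of r "c j" a, OF sumc r _ a] by (simp add: S_def c_def)
  have decay: "((\<lambda>t. exp (- \<epsilon> * t) * S j t) \<longlongrightarrow> 0) at_bot" if "\<epsilon> < a" for \<epsilon> j
  proof -
    have "((\<lambda>t. exp ((a - \<epsilon>) * t)) \<longlongrightarrow> 0) at_bot"
      by (rule filterlim_compose[OF exp_at_bot])
        (rule filterlim_tendsto_pos_mult_at_bot[OF tendsto_const _ filterlim_ident], use that in simp)
    from tendsto_mult[OF this ratio[of j]]
    have "((\<lambda>t. exp ((a - \<epsilon>) * t) * (S j t / exp (a * t))) \<longlongrightarrow> 0) at_bot" by simp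
    then show ?thesis
      by (rule Lim_transform_eventually) (simp add: exp_minus exp_diff left_diff_distrib field_simps)
  qed
  define f where "f = (\<lambda>t. - a + S 0 t)"
  define v where "v = (\<lambda>t. a * S 1 t)"
  define B where "B = (\<lambda>t. - (a\<^sup>2 * S 2 t + f t * v t))"
  have "\<forall>\<^sub>F t in at_bot. 0 < S 1 t / exp (a * t)"
    using ratio[of 1] by (rule order_tendstoD) simp
  moreover have "((\<lambda>t. exp (a * t)) \<longlongrightarrow> 0) at_bot"
      by (rule filterlim_compose[OF exp_at_bot])
        (rule filterlim_tendsto_pos_mult_at_bot[OF tendsto_const a filterlim_ident])
  then have "\<forall>\<^sub>F t in at_bot. exp (a * t) < r"
    using r by (rule order_tendstoD)
  ultimately have "\<forall>\<^sub>F t in at_bot. 0 < S 1 t / exp (a * t) \<and> exp (a * t) < r"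
    by (rule eventually_conj)
  then obtain T where T: "\<And>t. t < T \<Longrightarrow> 0 < S 1 t" "\<And>t. t < T \<Longrightarrow> exp (a * t) < r"
    unfolding eventually_at_bot_dense by (auto simp: zero_less_divide_iff)
  show ?thesis
  proof (rule that[of T f v B])
    fix t assume "t < T"
    note r' = T(2)[OF this]
    show f': "(f has_real_derivative v t) (at t)"
      using dS[OF r', of 0] by (auto simp: f_def v_def intro!: derivative_eq_intros)
    have "(v has_real_derivative a\<^sup>2 * S 2 t) (at t)"
      using dS[OF r', of 1] by (auto simp: v_def power2_eq_square numeral_2_eq_2 intro!: derivative_eq_intros)
    moreover have "- f t * v t - B t = a\<^sup>2 * S 2 t" by (simp add: B_def)
    ultimately show v': "(v has_real_derivative - f t * v t - B t) (at t)" by simp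
    have "(B has_real_derivative - (a ^ 3 * S 3 t + (v t * v t + f t * (a\<^sup>2 * S 2 t)))) (at t)"
      using dS[OF r', of 2] f' v' \<open>- f t * v t - B t = a\<^sup>2 * S 2 t\<close>
      unfolding B_def
      by (auto simp: power2_eq_square power3_eq_cube numeral_3_eq_3 numeral_2_eq_2 intro!: derivative_eq_intros)
    moreover have "- (a ^ 3 * S 3 t + (v t * v t + f t * (a\<^sup>2 * S 2 t))) = \<beta> * (v t)\<^sup>2"
    proof -
      have "- (a ^ 3 * S 3 t + (v t * v t + f t * (a\<^sup>2 * S 2 t))) - \<beta> * (v t)\<^sup>2
          = - a\<^sup>2 * (a * S 3 t - a * S 2 t + S 0 t * S 2 t + (1 + \<beta>) * (S 1 t)\<^sup>2)"
        by (simp add: f_def v_def power2_eq_square power3_eq_cube algebra_simps)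
      then show ?thesis using ode[OF r'] by simp
    qed
    ultimately show "(B has_real_derivative \<beta> * (v t)\<^sup>2) (at t)" by simp
    have "(\<lambda>n. c 0 n * exp (a * t) ^ n) sums S 0 t"
      unfolding S_def using sumc[of "exp (a * t)"] r' by (intro summable_sums) auto
    then show "(\<lambda>l. ?h l * exp (real l * a * t)) sums (f t + a)"
      by (simp add: c_def f_def exp_of_nat_mult[symmetric] mult.assoc)
    show "0 < v t" using T(1)[OF \<open>t < T\<close>] a by (simp add: v_def)
  next
    fix \<epsilon> assume \<epsilon>: "\<epsilon> < a"
    show "((\<lambda>t. exp (- \<epsilon> * t) * (f t + a)) \<longlongrightarrow> 0) at_bot"
      using decay[OF \<epsilon>, of 0] by (simp add: f_def)
    show "((\<lambda>t. exp (- \<epsilon> * t) * v t) \<longlongrightarrow> 0) at_bot"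
      using tendsto_mult_left[OF decay[OF \<epsilon>, of 1], of a] by (simp add: v_def algebra_simps)
    show "((\<lambda>t. exp (- \<epsilon> * t) * (- f t * v t - B t)) \<longlongrightarrow> 0) at_bot"
      using tendsto_mult_left[OF decay[OF \<epsilon>, of 2], of "a\<^sup>2"] by (simp add: B_def algebra_simps)
  qed
qed

end

section \<open>Solutions emanating from minus infinity\<close>

lemma root_quotient_derivative:
  fixes x y :: "real \<Rightarrow> real"
  assumes x: "(x has_real_derivative x') (at s)" and y: "(y has_real_derivative y') (at s)" and "y s \<noteq> 0"
  shows "((\<lambda>t. - x t / (2 * y t) - y t ^ 3 / 3) has_real_derivative
        - (x' * y s - x s * y') / (2 * (y s)\<^sup>2) - (y s)\<^sup>2 * y') (at s)"
  apply (rule DERIV_cong)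
   apply (rule x y assms derivative_eq_intros refl | simp add: assms)+
  using assms(3) by (simp add: divide_simps power2_eq_square)

text \<open>The left side is the derivative of \<open>w' - w ^ 3 / 3\<close> along the flow with
  \<open>f = - w\<^sup>2\<close> and \<open>w' = - v / (2 * w)\<close>; the numerator on the right
  is \<open>J\<close>.\<close>

lemma root_quotient_identity:
  fixes v b w :: real
  assumes "0 < w"
  shows "- ((w\<^sup>2 * v - b) * w - v * (- v / (2 * w))) / (2 * w\<^sup>2) - w\<^sup>2 * (- v / (2 * w))
    = (w\<^sup>2 * b - v\<^sup>2 / 2) / (2 * w ^ 3)"
  using assms
  by (simp add: divide_simps power2_eq_square power3_eq_cube) (simp add: algebra_simps)

text \<open>No sign or monotonicity of \<open>f\<close> is assumed, so that the locale serves
  arbitrary solutions of the boundary value problem as well as the solution continued beyond its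
  zero.\<close>

locale front =
  fixes a \<beta> S :: real and f v B :: "real \<Rightarrow> real"
  assumes a: "0 < a" and \<beta>: "0 \<le> \<beta>"
    and f': "\<And>t. t < S \<Longrightarrow> (f has_real_derivative v t) (at t)"
    and v': "\<And>t. t < S \<Longrightarrow> (v has_real_derivative - f t * v t - B t) (at t)"
    and B': "\<And>t. t < S \<Longrightarrow> (B has_real_derivative \<beta> * (v t)\<^sup>2) (at t)"
    and lim_f: "(f \<longlongrightarrow> - a) at_bot"
    and lim_v: "(v \<longlongrightarrow> 0) at_bot"
    and lim_B: "(B \<longlongrightarrow> 0) at_bot"
begin

definition J where "J = (\<lambda>t. - f t * B t - (v t)\<^sup>2 / 2)"
text \<open>Where \<open>f = - w\<^sup>2 < 0\<close>, one has
  \<open>G = 2 * W\<^sup>2 + J / w\<^sup>2\<close> with \<open>W = w' - w ^ 3 / 3\<close>. So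
  \<open>G\<close> is the square of the natural first integral, made polynomial with the help of
  \<open>J\<close>, and it survives the zero of \<open>f\<close>.\<close>

definition G where "G = (\<lambda>t. B t - 2 / 3 * f t * v t - 2 / 9 * f t ^ 3)"

lemma J': "t < S \<Longrightarrow> (J has_real_derivative (1 - \<beta>) * f t * (v t)\<^sup>2) (at t)"
  unfolding J_def
  by (auto intro!: derivative_eq_intros f' v' B' simp: power2_eq_square field_simps)

lemma G': "t < S \<Longrightarrow> (G has_real_derivative - (1 - \<beta>) * (v t)\<^sup>2 - 2 / 3 * J t) (at t)"
  unfolding G_def J_def
  by (auto intro!: derivative_eq_intros f' v' B' simp: power2_eq_square field_simps)

lemma lim_J: "(J \<longlongrightarrow> 0) at_bot"
proof -
  have "(J \<longlongrightarrow> - (- a) * 0 - 0\<^sup>2 / 2) at_bot"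
    unfolding J_def by (intro tendsto_intros lim_f lim_v lim_B) auto
  then show ?thesis by simp
qed

lemma lim_G: "(G \<longlongrightarrow> 2 / 9 * a ^ 3) at_bot"
proof -
  have "(G \<longlongrightarrow> 0 - 2 / 3 * (- a) * 0 - 2 / 9 * (- a) ^ 3) at_bot"
    unfolding G_def by (intro tendsto_intros lim_f lim_v lim_B) auto
  then show ?thesis by simp
qed

lemma isCont_fvB: "t < S \<Longrightarrow> isCont f t" "t < S \<Longrightarrow> isCont v t" "t < S \<Longrightarrow> isCont B t"
  using f' v' B' DERIV_isCont by blast+

lemma cont_f: "t < S \<Longrightarrow> continuous_on {s..t} f"
  by (intro continuous_at_imp_continuous_on ballI isCont_fvB) auto

lemma B_mono: "s \<le> t \<Longrightarrow> t < S \<Longrightarrow> B s \<le> B t"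
  by (rule nondecreasing_of_derivative[OF B']) (use \<beta> in auto)

lemma B_nonneg: "t < S \<Longrightarrow> 0 \<le> B t"
  by (rule ge_limit_at_bot[OF B' _ lim_B]) (use \<beta> in auto)

lemma v_le: "t < S \<Longrightarrow> v t \<le> (a\<^sup>2 - (f t)\<^sup>2) / 2"
proof -
  assume t: "t < S"
  have "((\<lambda>t. v t + (f t)\<^sup>2 / 2) \<longlongrightarrow> 0 + (- a)\<^sup>2 / 2) at_bot"
    by (intro tendsto_intros lim_f lim_v) auto
  then have "v t + (f t)\<^sup>2 / 2 \<le> a\<^sup>2 / 2"
    using t B_nonneg
    by (intro le_limit_at_bot[of t "\<lambda>t. v t + (f t)\<^sup>2 / 2" "\<lambda>t. - B t"])
      (auto intro!: derivative_eq_intros f' v')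
  then show ?thesis by simp
qed

lemma const_of_zero:
  assumes "t < S" "\<And>u. u \<le> t \<Longrightarrow> v u = 0"
  shows "f t = - a"
proof (rule antisym)
  have d: "(f has_real_derivative 0) (at u)" if "u \<le> t" for u
    using f'[of u] assms that by auto
  show "f t \<le> - a" by (rule le_limit_at_bot[OF d _ lim_f]) auto
  show "- a \<le> f t" by (rule ge_limit_at_bot[OF d _ lim_f]) auto
qed

lemma B_zero_below: "t < S \<Longrightarrow> B t = 0 \<Longrightarrow> s \<le> t \<Longrightarrow> B s = 0"
  using B_mono[of s t] B_nonneg[of s] by auto

text \<open>\<open>B\<close> is nonnegative and nondecreasing, so a zero at \<open>t\<close> spreads
  to all earlier times; there \<open>v' = - f * v\<close> is homogeneous and preserves the sign of
  \<open>v\<close>.\<close>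

lemma v_sign_of_B_zero:
  assumes "t < S" "B t = 0" "s \<le> t"
  shows "sgn (v s) = sgn (v t)"
proof (cases "s = t")
  case False
  then have st: "s < t" using assms by simp
  have v0: "(v has_real_derivative - f u * v u - (\<lambda>_. 0) u) (at u)" if "u \<in> {s..t}" for u
    using v'[of u] B_zero_below[OF assms(1,2), of u] that assms(1) by auto
  obtain E where E: "\<And>u. u \<in> {s..t} \<Longrightarrow> E u > 0" "continuous_on {s..t} (\<lambda>u. v u * E u)"
    "\<And>u. s < u \<Longrightarrow> u < t \<Longrightarrow> ((\<lambda>u. v u * E u) has_real_derivative - 0 * E u) (at u)"
    using integrating_factor[OF assms(3) cont_f[OF assms(1)] v0] by blast
  have "v t * E t = v s * E s"
    by (rule DERIV_isconst_end[OF st E(2)]) (use E(3) in simp)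
  then have "sgn (v t) * sgn (E t) = sgn (v s) * sgn (E s)"
    by (metis sgn_mult)
  then show ?thesis using E(1)[of s] E(1)[of t] assms(3) by simp
qed simp

lemma const_of_vanishing:
  assumes "t < S" "B t = 0" "v t = 0"
  shows "f t = - a"
  using const_of_zero[OF assms(1)] v_sign_of_B_zero[OF assms(1,2)] assms(3)
  by (auto simp: sgn_eq_0_iff)

lemma v_nonpos_after:
  assumes "v s \<le> 0" "s \<le> t" "t < S"
  shows "v t \<le> 0"
  using assms
  by (intro linear_ode_nonpos[of s t f v B] cont_f v') (auto intro: B_nonneg)

text \<open>A zero of \<open>B\<close> spreads backwards, \<open>B' = \<beta> * v\<^sup>2\<close>
  then annihilates \<open>v\<close>, and \<open>f\<close> has never left \<open>- a\<close>.\<close>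

lemma B_pos:
  assumes "0 < \<beta>" "t < S" "s < t" "f s \<noteq> - a"
  shows "0 < B t"
proof (rule ccontr)
  assume "\<not> 0 < B t"
  then have z: "B t = 0" using B_nonneg[OF assms(2)] by simp
  have "v u = 0" if "u \<le> s" for u
  proof -
    have "\<forall>\<^sub>F x in nhds u. x < t"
      using that assms by (intro eventually_nhds_in_open[of "{..<t}", simplified]) auto
    then have "\<forall>\<^sub>F x in nhds u. B x = 0"
      by (rule eventually_mono) (use B_zero_below[OF assms(2) z] in auto)
    then have "(B has_real_derivative 0) (at u)"
      by (simp add: DERIV_cong_ev)
    then have "\<beta> * (v u)\<^sup>2 = 0"
      using B'[of u] DERIV_unique that assms by force
    then show ?thesis using assms(1) by simp
  qed
  then have "f s = - a" using const_of_zero[of s] assms by auto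
  then show False using assms by simp
qed

lemma J_nonpos:
  assumes "\<beta> \<le> 1" "t < S" "\<And>s. s \<le> t \<Longrightarrow> f s \<le> 0"
  shows "J t \<le> 0"
proof (rule le_limit_at_bot[OF J' _ lim_J])
  show "(1 - \<beta>) * f s * (v s)\<^sup>2 \<le> 0" if "s \<le> t" for s
    using assms(1) assms(3)[OF that] by (intro mult_nonpos_nonneg mult_nonneg_nonpos) auto
qed (use assms(2) in auto)

text \<open>With \<open>w = sqrt (- f)\<close> the quantity \<open>w' - w ^ 3 / 3\<close> has derivative \<open>J / (2 * w ^ 3)\<close>.\<close>

lemma v_ge:
  assumes "\<beta> \<le> 1" "t < S" "\<And>s. s \<le> t \<Longrightarrow> f s < 0"
  shows "2 / 3 * (sqrt a ^ 3 * sqrt (- f t) - sqrt (- f t) ^ 4) \<le> v t"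
proof -
  define w where "w = (\<lambda>t. sqrt (- f t))"
  define W where "W = (\<lambda>t. - v t / (2 * w t) - w t ^ 3 / 3)"
  have w: "0 < w s" "f s = - (w s)\<^sup>2" if "s \<le> t" for s
    using assms(3)[OF that] by (auto simp: w_def)
  have w': "(w has_real_derivative - v s / (2 * w s)) (at s)" if "s \<le> t" for s
  proof -
    have "((\<lambda>t. sqrt (- f t)) has_real_derivative (inverse (sqrt (- f s)) / 2) * (- v s)) (at s)"
      using assms(2) assms(3)[OF that] that
      by (intro DERIV_chain2[OF DERIV_real_sqrt] DERIV_minus f') auto
    then show ?thesis unfolding w_def by (rule DERIV_cong) (simp add: field_simps)
  qed
  have W': "(W has_real_derivative J s / (2 * w s ^ 3)) (at s)" if "s \<le> t" for s
  proof -
    have "(W has_real_derivative - ((- f s * v s - B s) * w s - v s * (- v s / (2 * w s))) / (2 * (w s)\<^sup>2)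
        - (w s)\<^sup>2 * (- v s / (2 * w s))) (at s)"
      unfolding W_def using w(1)[OF that] assms(2) that
      by (intro root_quotient_derivative v' w') auto
    also have "- ((- f s * v s - B s) * w s - v s * (- v s / (2 * w s))) / (2 * (w s)\<^sup>2)
        - (w s)\<^sup>2 * (- v s / (2 * w s)) = J s / (2 * w s ^ 3)"
      using root_quotient_identity[OF w(1)[OF that]] by (simp add: J_def w(2)[OF that])
    finally show ?thesis .
  qed
  have "(w \<longlongrightarrow> sqrt (- (- a))) at_bot"
    unfolding w_def by (intro tendsto_intros lim_f)
  then have lw: "(w \<longlongrightarrow> sqrt a) at_bot" by simp
  have "(W \<longlongrightarrow> - 0 / (2 * sqrt a) - sqrt a ^ 3 / 3) at_bot"
    unfolding W_def using a by (intro tendsto_intros lw lim_v) auto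
  then have "W t \<le> - 0 / (2 * sqrt a) - sqrt a ^ 3 / 3"
    using w W' J_nonpos assms
    by (intro le_limit_at_bot[of t W "\<lambda>s. J s / (2 * w s ^ 3)"])
      (auto intro!: divide_nonpos_pos simp: less_imp_le)
  then have "(sqrt a ^ 3 - w t ^ 3) / 3 * (2 * w t) \<le> v t / (2 * w t) * (2 * w t)"
    using w(1)[of t] by (intro mult_right_mono) (auto simp: W_def)
  also have "v t / (2 * w t) * (2 * w t) = v t" using w(1)[of t] by simp
  finally have "2 / 3 * (sqrt a ^ 3 * w t - w t ^ 4) \<le> v t"
    by (simp add: power4_eq_xxxx power3_eq_cube algebra_simps)
  then show ?thesis by (simp only: w_def)
qed

text \<open>\<open>J\<close> starts from the limit 0, does not decrease and ends at
  \<open>- v\<^sub>0\<^sup>2 / 2 \<le> 0\<close>, so it is identically zero. Its vanishing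
  derivative forces \<open>v = 0\<close>, and the constant \<open>f = - a\<close> cannot tend to
  0.\<close>

lemma nonexistence:
  assumes "1 < \<beta>" "\<And>t. t < S \<Longrightarrow> f t < 0"
    and "(f \<longlongrightarrow> 0) (at_left S)" "(v \<longlongrightarrow> v\<^sub>0) (at_left S)" "(B \<longlongrightarrow> b\<^sub>0) (at_left S)"
  shows False
proof -
  have J'_nonneg: "0 \<le> (1 - \<beta>) * f t * (v t)\<^sup>2" if "t < S" for t
    using assms(1) assms(2)[OF that] by (intro mult_nonneg_nonneg mult_nonpos_nonpos) auto
  have J_ge: "0 \<le> J t" if "t < S" for t
    by (rule ge_limit_at_bot[OF J' _ lim_J]) (use that J'_nonneg in auto)
  have J_le: "J t \<le> 0" if "t < S" for t
  proof -
    have mono: "J t \<le> J u" if "t \<le> u" "u < S" for u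
      by (rule nondecreasing_of_derivative[OF J' J'_nonneg]) (use that in auto)
    have "(J \<longlongrightarrow> - 0 * b\<^sub>0 - v\<^sub>0\<^sup>2 / 2) (at_left S)"
      unfolding J_def by (intro tendsto_intros assms) auto
    then have "J t \<le> - 0 * b\<^sub>0 - v\<^sub>0\<^sup>2 / 2"
    proof (rule tendsto_lowerbound)
      show "\<forall>\<^sub>F u in at_left S. J t \<le> J u"
        using eventually_at_left_real[OF that] by (rule eventually_mono) (use mono in auto)
    qed simp
    then show ?thesis using zero_le_power2[of v\<^sub>0] by linarith
  qed
  have "v t = 0" if "t < S" for t
  proof -
    have "\<forall>\<^sub>F x in nhds t. x < S"
      using that by (intro eventually_nhds_in_open[of "{..<S}", simplified]) auto
    then have "\<forall>\<^sub>F x in nhds t. J x = 0"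
      by (rule eventually_mono) (use J_le J_ge in \<open>auto intro: antisym\<close>)
    then have "(J has_real_derivative 0) (at t)"
      by (simp add: DERIV_cong_ev)
    then have "(1 - \<beta>) * f t * (v t)\<^sup>2 = 0"
      using J'[OF that] DERIV_unique by blast
    then show ?thesis using assms(1) assms(2)[OF that] by simp
  qed
  then have "f t = - a" if "t < S" for t
    using const_of_zero[OF that] that by simp
  then have "\<forall>\<^sub>F t in at_left S. f t = - a"
    using eventually_at_left_real[of "S - 1" S] by (auto elim!: eventually_mono)
  then have "(f \<longlongrightarrow> - a) (at_left S)"
    by (rule tendsto_eventually)
  then have "- a = 0" using tendsto_unique[OF trivial_limit_at_left_real _ assms(3)] by blast
  then show False using a by simp
qed

text \<open>Once \<open>v \<le> 0\<close>, it stays so. Then \<open>f\<close> is nonpositive,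
  nonincreasing and tends to 0, hence it is zero on a final interval, where \<open>v\<close> and
  \<open>B\<close> vanish as well; but such a state belongs to the constant solution
  \<open>- a\<close> only.\<close>

lemma rising_of_nonpos:
  assumes "\<And>t. t < S \<Longrightarrow> f t \<le> 0" "(f \<longlongrightarrow> 0) (at_left S)" "t < S"
  shows "0 < v t"
proof (rule ccontr)
  assume "\<not> 0 < v t"
  then have neg: "v u \<le> 0" if "t \<le> u" "u < S" for u
    using v_nonpos_after[of t u] that by simp
  have zero: "f u = 0" if u: "t \<le> u" "u < S" for u
  proof -
    have "f r \<le> f u" if "u \<le> r" "r < S" for r
      by (rule nonincreasing_of_derivative[OF f' neg]) (use that u in auto)
    then have "\<forall>\<^sub>F r in at_left S. f r \<le> f u"
      using eventually_at_left_real[OF u(2)] by (auto elim!: eventually_mono)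
    then have "0 \<le> f u"
      using tendsto_upperbound[OF assms(2)] by simp
    then show ?thesis using assms(1)[OF u(2)] by simp
  qed
  define u where "u = (t + S) / 2"
  have u: "t < u" "u < S" using assms(3) by (auto simp: u_def)
  have near: "(g has_real_derivative 0) (at r)" if "\<And>x. t < x \<Longrightarrow> x < S \<Longrightarrow> g x = 0" "t < r" "r < S" for g r
  proof -
    have "\<forall>\<^sub>F x in nhds r. x \<in> {t<..<S}"
      using that by (intro eventually_nhds_in_open) auto
    then have "\<forall>\<^sub>F x in nhds r. g x = 0"
      by (rule eventually_mono) (use that in auto)
    then show ?thesis by (simp add: DERIV_cong_ev)
  qed
  have v0: "v x = 0" if "t < x" "x < S" for x
    using near[of f x] zero f'[OF that(2)] DERIV_unique that by force
  have "(v has_real_derivative 0) (at u)"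
    using near[of v u] v0 u by blast
  then have "- f u * v u - B u = 0" using v'[OF u(2)] DERIV_unique by blast
  then have "B u = 0" using v0 u by simp
  then have "f u = - a" using const_of_vanishing u v0 by blast
  then show False using zero[of u] u a by simp
qed

text \<open>\<open>J\<close> vanishes identically, so \<open>f * B = - v\<^sup>2 / 2\<close>; a
  positive value of \<open>f\<close> would make \<open>v\<close> and \<open>B\<close> vanish
  together. This is why uniqueness for \<open>m = 1/3\<close> comes without a sign
  condition.\<close>

lemma nonpos_of_beta_1:
  assumes "\<beta> = 1" "t < S"
  shows "f t \<le> 0"
proof (rule ccontr)
  assume pos: "\<not> f t \<le> 0"
  have "J t = 0"
    using le_limit_at_bot[OF J' _ lim_J, of t] ge_limit_at_bot[OF J' _ lim_J, of t] assms by force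
  then have "f t * B t = - (v t)\<^sup>2 / 2" by (simp add: J_def)
  moreover have "0 \<le> f t * B t" using pos B_nonneg[OF assms(2)] by simp
  ultimately have "(v t)\<^sup>2 = 0" "f t * B t = 0" using zero_le_power2[of "v t"] by linarith+
  then have "f t = - a" using const_of_vanishing[OF assms(2)] pos by auto
  then show False using pos a by simp
qed

text \<open>\<open>B\<close> vanishes identically, so \<open>v\<close> keeps one sign throughout,
  and a nonpositive one would hold \<open>f\<close> below \<open>- a\<close>. This removes the sign
  condition for \<open>m = 1/2\<close>.\<close>

lemma rising_of_beta_0:
  assumes "\<beta> = 0" "(f \<longlongrightarrow> 0) (at_left S)" "t < S"
  shows "0 < v t"
proof (rule ccontr)
  assume neg: "\<not> 0 < v t"
  have B0: "B u = 0" if "u < S" for u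
    using le_limit_at_bot[OF B' _ lim_B, of u] B_nonneg[OF that] assms(1) that by force
  have "v u \<le> 0" if "u < S" for u
  proof (cases "u \<le> t")
    case True
    then show ?thesis using v_sign_of_B_zero[of t u] B0 assms(3) neg
      by (metis not_le sgn_1_pos)
  qed (use v_nonpos_after[of t u] neg that in auto)
  then have "f u \<le> - a" if "u < S" for u
    by (intro le_limit_at_bot[OF f' _ lim_f]) (use that in auto)
  then have "\<forall>\<^sub>F r in at_left S. f r \<le> - a"
    using eventually_at_left_real[OF assms(3)] by (auto elim!: eventually_mono)
  then have "0 \<le> - a" by (rule tendsto_upperbound[OF assms(2)]) simp
  then show False using a by simp
qed

end

section \<open>Rising solutions, their phase curves and uniqueness\<close>

locale rising_front = front +
  assumes \<beta>_le_1: "\<beta> \<le> 1"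
    and v_pos: "\<And>t. t < S \<Longrightarrow> 0 < v t"
    and f_left: "(f \<longlongrightarrow> 0) (at_left S)"
begin

lemma f_less: "s < t \<Longrightarrow> t < S \<Longrightarrow> f s < f t"
  by (rule DERIV_pos_imp_increasing) (auto intro!: exI f' v_pos)

lemma f_neg: "t < S \<Longrightarrow> f t < 0"
proof -
  assume t: "t < S"
  define u where "u = (t + S) / 2"
  have u: "t < u" "u < S" using t by (auto simp: u_def)
  have "f u \<le> 0"
  proof (rule tendsto_lowerbound[OF f_left])
    show "\<forall>\<^sub>F r in at_left S. f u \<le> f r"
      using eventually_at_left_real[OF u(2)] by (rule eventually_mono) (auto intro: less_imp_le f_less)
  qed simp
  then show ?thesis using f_less[OF u] by simp
qed

lemma f_gt: "t < S \<Longrightarrow> - a < f t"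
proof -
  assume t: "t < S"
  have "- a \<le> f (t - 1)"
    by (rule ge_limit_at_bot[OF f' _ lim_f]) (use t v_pos in \<open>auto intro: less_imp_le\<close>)
  then show ?thesis using f_less[of "t - 1" t] t by simp
qed

lemma J_le_0: "t < S \<Longrightarrow> J t \<le> 0"
  by (rule J_nonpos[OF \<beta>_le_1]) (use f_neg less_imp_le order_le_less_trans in \<open>blast+\<close>)

lemma v_third: "t < S \<Longrightarrow> 2 / 3 * (sqrt a ^ 3 * sqrt (- f t) - sqrt (- f t) ^ 4) \<le> v t"
  by (rule v_ge[OF \<beta>_le_1]) (use f_neg order_le_less_trans in \<open>blast+\<close>)

text \<open>A weakening of \<open>v_third\<close> without roots. It shows that the velocity vanishes
  no faster than linearly at \<open>f = - a\<close>, the lower bound on \<open>p\<close> on which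
  uniqueness rests.\<close>

lemma v_ge_quadratic: "t < S \<Longrightarrow> - f t * (f t + a) / 3 \<le> v t"
proof -
  assume t: "t < S"
  define w where "w = sqrt (- f t)"
  define b where "b = sqrt a"
  have w: "0 < w" "f t = - w\<^sup>2" using f_neg[OF t] by (auto simp: w_def)
  have b: "0 < b" "a = b\<^sup>2" using a by (auto simp: b_def)
  have "w \<le> b" using f_gt[OF t] by (auto simp: w_def b_def)
  have "w\<^sup>2 * (b\<^sup>2 - w\<^sup>2) / 3 \<le> 2 / 3 * (b ^ 3 * w - w ^ 4)"
  proof -
    have "2 * (b ^ 3 * w - w ^ 4) - w\<^sup>2 * (b\<^sup>2 - w\<^sup>2) = w * (b - w) * (2 * (b\<^sup>2 + b * w + w\<^sup>2) - w * (b + w))"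
      by (simp add: power2_eq_square power3_eq_cube power4_eq_xxxx algebra_simps)
    also have "2 * (b\<^sup>2 + b * w + w\<^sup>2) - w * (b + w) = 2 * b\<^sup>2 + b * w + w\<^sup>2"
      by (simp add: power2_eq_square algebra_simps)
    also have "0 \<le> w * (b - w) * (2 * b\<^sup>2 + b * w + w\<^sup>2)"
      using w b \<open>w \<le> b\<close> by (intro mult_nonneg_nonneg) auto
    finally show ?thesis by simp
  qed
  also have "\<dots> \<le> v t" using v_third[OF t] by (simp add: w_def b_def)
  finally show ?thesis using w b by (simp add: algebra_simps)
qed

lemma B_le: "t < S \<Longrightarrow> B t \<le> (v t)\<^sup>2 / (2 * - f t)"
  using J_le_0[of t] f_neg[of t] by (subst pos_le_divide_eq) (auto simp: J_def algebra_simps)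

end

text \<open>The derivative is bounded by the supremum of \<open>q\<close> over the past, since
  \<open>q'\<close> will contain the difference of two \<open>b\<close>-components, which is an
  integral of \<open>q\<close> from the singular point. Nothing is asked of the derivative at
  \<open>0\<close> itself.\<close>

lemma singular_gronwall:
  fixes q q' :: "real \<Rightarrow> real"
  assumes cont: "continuous_on {0..c} q" and "q 0 = 0" and K: "0 \<le> K"
    and q': "\<And>s. 0 < s \<Longrightarrow> s < c \<Longrightarrow> (q has_real_derivative q' s) (at s)"
    and bound: "\<And>s M. 0 < s \<Longrightarrow> s < c \<Longrightarrow> (\<And>r. 0 < r \<Longrightarrow> r \<le> s \<Longrightarrow> \<bar>q r\<bar> \<le> M) \<Longrightarrow> \<bar>q' s\<bar> \<le> K * M"
    and s: "s \<in> {0..c}"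
  shows "q s = 0"
proof -
  \<comment> \<open>The rate \<open>2 * K\<close> is twice the one in the bound, so that integrating
    up to the maximum point \<open>x\<close> gives
    \<open>\<bar>q x\<bar> \<le> M * (exp (2 * K * x) - 1) / 2\<close>, which is less than the value
    \<open>M * exp (2 * K * x)\<close> attained there.\<close>
  define \<phi> where "\<phi> = (\<lambda>s. \<bar>q s\<bar> * exp (- (2 * K * s)))"
  have "continuous_on {0..c} \<phi>" unfolding \<phi>_def by (intro continuous_intros cont)
  then obtain x where x: "x \<in> {0..c}" and max: "\<And>y. y \<in> {0..c} \<Longrightarrow> \<phi> y \<le> \<phi> x"
    using continuous_attains_sup[of "{0..c}" \<phi>] s by auto
  define M where "M = \<phi> x"
  have le: "\<bar>q r\<bar> \<le> M * exp (2 * K * r)" if "r \<in> {0..c}" for r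
    using max[OF that] by (simp add: \<phi>_def M_def exp_minus field_simps)
  have M0: "0 \<le> M" by (simp add: M_def \<phi>_def)
  have "M = 0"
  proof (rule ccontr)
    assume "M \<noteq> 0"
    then have M: "0 < M" using M0 by simp
    then have x0: "0 < x" using x assms(2) by (cases "x = 0") (auto simp: M_def \<phi>_def)
    have q'_le: "\<bar>q' r\<bar> \<le> K * (M * exp (2 * K * r))" if r: "0 < r" "r < x" for r
    proof (rule bound)
      fix u assume u: "0 < u" "u \<le> r"
      then have "\<bar>q u\<bar> \<le> M * exp (2 * K * u)" using le[of u] r x by auto
      also have "\<dots> \<le> M * exp (2 * K * r)" using u M K by (auto intro!: mult_left_mono)
      finally show "\<bar>q u\<bar> \<le> M * exp (2 * K * r)" .
    qed (use r x in auto)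
    have *: "\<sigma> * q x \<le> M * (exp (2 * K * x) - 1) / 2" if \<sigma>: "\<sigma> = 1 \<or> \<sigma> = -1" for \<sigma>
    proof -
      have "M * exp (2 * K * 0) / 2 - \<sigma> * q 0 \<le> M * exp (2 * K * x) / 2 - \<sigma> * q x"
      proof (rule DERIV_nonneg_imp_increasing_open[of 0 x "\<lambda>r. M * exp (2 * K * r) / 2 - \<sigma> * q r"])
        show "continuous_on {0..x} (\<lambda>r. M * exp (2 * K * r) / 2 - \<sigma> * q r)"
          using x by (intro continuous_intros continuous_on_subset[OF cont]) auto
        fix r assume r: "0 < r" "r < x"
        have "((\<lambda>r. M * exp (2 * K * r) / 2 - \<sigma> * q r) has_real_derivative
            K * (M * exp (2 * K * r)) - \<sigma> * q' r) (at r)"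
          using r x by (auto intro!: derivative_eq_intros q')
        moreover have "0 \<le> K * (M * exp (2 * K * r)) - \<sigma> * q' r"
          using q'_le[OF r] \<sigma> by auto
        ultimately show "\<exists>y. ((\<lambda>r. M * exp (2 * K * r) / 2 - \<sigma> * q r) has_real_derivative y) (at r) \<and> 0 \<le> y"
          by blast
      qed (use x0 in auto)
      then show ?thesis using assms(2) by (simp add: algebra_simps)
    qed
    have "\<bar>q x\<bar> \<le> M * (exp (2 * K * x) - 1) / 2" using *[of 1] *[of "-1"] by auto
    moreover have "\<bar>q x\<bar> = M * exp (2 * K * x)" by (simp add: M_def \<phi>_def exp_minus)
    moreover have "0 < M * exp (2 * K * x)" using M by simp
    ultimately show False using M by (simp add: algebra_simps)
  qed
  then show ?thesis using le[OF s] by simp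
qed


text \<open>The curve \<open>p = f'\<close>, \<open>b = B\<close> as functions of \<open>y = f\<close>, with \<open>g\<close> the inverse of \<open>f\<close>.\<close>

locale phase_curve =
  fixes a \<beta> S :: real and f g p b :: "real \<Rightarrow> real"
  assumes g_f: "\<And>t. t < S \<Longrightarrow> g (f t) = t"
    and g_less: "\<And>y. - a < y \<Longrightarrow> y < 0 \<Longrightarrow> g y < S"
    and f_g: "\<And>y. - a < y \<Longrightarrow> y < 0 \<Longrightarrow> f (g y) = y"
    and g': "\<And>y. - a < y \<Longrightarrow> y < 0 \<Longrightarrow> (g has_real_derivative 1 / p y) (at y)"
    and p': "\<And>y. - a < y \<Longrightarrow> y < 0 \<Longrightarrow> (p has_real_derivative - y - b y / p y) (at y)"
    and b': "\<And>y. - a < y \<Longrightarrow> y < 0 \<Longrightarrow> (b has_real_derivative \<beta> * p y) (at y)"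
    and p: "\<And>y. - a < y \<Longrightarrow> y < 0 \<Longrightarrow> 0 < p y"
      "\<And>y. - a < y \<Longrightarrow> y < 0 \<Longrightarrow> p y \<le> (a\<^sup>2 - y\<^sup>2) / 2"
      "\<And>y. - a < y \<Longrightarrow> y < 0 \<Longrightarrow> - y * (y + a) / 3 \<le> p y"
    and b: "\<And>y. - a < y \<Longrightarrow> y < 0 \<Longrightarrow> 0 \<le> b y"
      "\<And>y. - a < y \<Longrightarrow> y < 0 \<Longrightarrow> b y \<le> (p y)\<^sup>2 / (2 * - y)"

lemma (in rising_front) phase_curve:
  obtains g p b where "phase_curve a \<beta> S f g p b"
proof -
  have inj: "inj_on f {..<S}"
    by (rule linorder_inj_onI) (use f_less in force)+
  define g where "g = the_inv_into {..<S} f"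
  have gf: "g (f t) = t" if "t < S" for t
    unfolding g_def using inj that by (simp add: the_inv_into_f_f)
  have g: "g y < S" "f (g y) = y" if y: "- a < y" "y < 0" for y
  proof -
    have "\<forall>\<^sub>F t in at_bot. f t < y \<and> t < S"
      using order_tendstoD(2)[OF lim_f y(1)] eventually_gt_at_bot by (rule eventually_conj)
    then obtain s where s: "f s < y" "s < S"
      using eventually_happens'[OF trivial_limit_at_bot_linorder] by blast
    have "\<forall>\<^sub>F t in at_left S. y < f t \<and> t \<in> {s<..<S}"
      using order_tendstoD(1)[OF f_left y(2)] eventually_at_left_real[OF s(2)] by (rule eventually_conj)
    then have "\<exists>t. y < f t \<and> t \<in> {s<..<S}"
      by (rule eventually_happens'[OF trivial_limit_at_left_real])
    then obtain t where t: "y < f t" "s < t" "t < S" by auto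
    obtain r where "s \<le> r" "r \<le> t" "f r = y"
      using IVT'[of f s y t] s t cont_f[of t s] by auto
    then show "g y < S" "f (g y) = y" using gf[of r] t by auto
  qed
  have dg: "(g has_real_derivative 1 / v (g y)) (at y)" if y: "- a < y" "y < 0" for y
  proof -
    have "(g has_real_derivative inverse (v (g y))) (at y)"
    proof (rule real_inverse_derivative[of "{..<S}" _ _ f])
      show "continuous_on {..<S} f"
        by (intro continuous_at_imp_continuous_on ballI isCont_fvB) auto
      show "v (g y) \<noteq> 0" using v_pos[OF g(1)[OF y]] by simp
    qed (use g[OF y] gf f' in auto)
    then show ?thesis by (simp add: divide_inverse)
  qed
  have "phase_curve a \<beta> S f g (\<lambda>y. v (g y)) (\<lambda>y. B (g y))"
  proof
    fix y assume y: "- a < y" "y < 0"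
    note gy = g[OF y]
    note vp = v_pos[OF gy(1)]
    show "((\<lambda>y. v (g y)) has_real_derivative - y - B (g y) / v (g y)) (at y)"
      by (rule DERIV_cong[OF DERIV_chain2[OF v'[OF gy(1)] dg[OF y]]])
        (use vp gy in \<open>simp add: field_simps\<close>)
    show "((\<lambda>y. B (g y)) has_real_derivative \<beta> * v (g y)) (at y)"
      by (rule DERIV_cong[OF DERIV_chain2[OF B'[OF gy(1)] dg[OF y]]])
        (use vp in \<open>simp add: power2_eq_square\<close>)
    show "- y * (y + a) / 3 \<le> v (g y)" using v_ge_quadratic[OF gy(1)] gy(2) by simp
    show "v (g y) \<le> (a\<^sup>2 - y\<^sup>2) / 2" using v_le[OF gy(1)] gy(2) by simp
    show "0 \<le> B (g y)" using B_nonneg[OF gy(1)] .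
    show "B (g y) \<le> (v (g y))\<^sup>2 / (2 * - y)" using B_le[OF gy(1)] gy(2) by simp
  qed (use gf g dg v_pos in auto)
  then show ?thesis by (rule that)
qed

lemma rising_front_unique:
  assumes "rising_front a \<beta> S f\<^sub>1 v\<^sub>1 B\<^sub>1" "rising_front a \<beta> S f\<^sub>2 v\<^sub>2 B\<^sub>2" "t < S"
  shows "f\<^sub>1 t = f\<^sub>2 t"
proof -
  interpret F1: rising_front a \<beta> S f\<^sub>1 v\<^sub>1 B\<^sub>1 by (rule assms)
  interpret F2: rising_front a \<beta> S f\<^sub>2 v\<^sub>2 B\<^sub>2 by (rule assms)
  note a = F1.a and \<beta> = F1.\<beta>
  obtain g\<^sub>1 p\<^sub>1 b\<^sub>1 where P1: "phase_curve a \<beta> S f\<^sub>1 g\<^sub>1 p\<^sub>1 b\<^sub>1" by (rule F1.phase_curve)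
  obtain g\<^sub>2 p\<^sub>2 b\<^sub>2 where P2: "phase_curve a \<beta> S f\<^sub>2 g\<^sub>2 p\<^sub>2 b\<^sub>2" by (rule F2.phase_curve)
  note g1 = phase_curve.g_f[OF P1] and g1S = phase_curve.g_less[OF P1] and fg1 = phase_curve.f_g[OF P1]
    and dg1 = phase_curve.g'[OF P1] and dp1 = phase_curve.p'[OF P1] and db1 = phase_curve.b'[OF P1]
    and p1 = phase_curve.p[OF P1] and b1 = phase_curve.b[OF P1]
  note g2 = phase_curve.g_f[OF P2] and g2S = phase_curve.g_less[OF P2]
    and dg2 = phase_curve.g'[OF P2] and dp2 = phase_curve.p'[OF P2] and db2 = phase_curve.b'[OF P2]
    and p2 = phase_curve.p[OF P2] and b2 = phase_curve.b[OF P2]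
  have p_le: "p\<^sub>1 (s - a) \<le> a * s" "p\<^sub>2 (s - a) \<le> a * s" if "0 < s" "s < a" for s
  proof -
    have "(a\<^sup>2 - (s - a)\<^sup>2) / 2 \<le> a * s"
      using zero_le_square[of s] by (simp add: power2_eq_square algebra_simps)
    then show "p\<^sub>1 (s - a) \<le> a * s" "p\<^sub>2 (s - a) \<le> a * s"
      using p1(2)[of "s - a"] p2(2)[of "s - a"] that by auto
  qed
  have p_eq: "p\<^sub>1 y = p\<^sub>2 y" if y: "- a < y" "y < 0" for y
  proof -
    \<comment> \<open>The variable \<open>s = y + a\<close> is the distance from the rest point. For
      \<open>s < c\<close> the coordinate \<open>s - a\<close> stays below \<open>y / 2\<close>,
      away from the other singular end \<open>0\<close>; this gives
      \<open>- (s - a) \<ge> 3 * k\<close> and \<open>p \<ge> k * s\<close> with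
      \<open>k = - y / 6\<close>.\<close>
    define c where "c = y / 2 + a"
    have c: "c = y / 2 + a" "0 < c" "c < a" "y + a < c" using y by (auto simp: c_def)
    define k where "k = - y / 6"
    have k: "0 < k" using y by (simp add: k_def)
    have p_ge: "k * s \<le> p\<^sub>1 (s - a)" "k * s \<le> p\<^sub>2 (s - a)" "3 * k \<le> - (s - a)" if "0 < s" "s < c" for s
    proof -
      show *: "3 * k \<le> - (s - a)" using that c by (simp add: k_def)
      have "k * s = 3 * k * s / 3" by simp
      also have "\<dots> \<le> - (s - a) * (s - a + a) / 3"
        using that * by (intro divide_right_mono mult_mono) (use k in auto)
      finally have **: "k * s \<le> - (s - a) * (s - a + a) / 3" .
      have s: "- a < s - a" "s - a < 0" using that c by auto
      show "k * s \<le> p\<^sub>1 (s - a)" "k * s \<le> p\<^sub>2 (s - a)"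
        using order_trans[OF ** p1(3)[OF s]] order_trans[OF ** p2(3)[OF s]] .
    qed
    \<comment> \<open>The two summands bound the two terms into which \<open>q'\<close> is split:
      the difference of the \<open>b\<close>-components over \<open>p\<^sub>1\<close>, and
      \<open>b\<^sub>2 / (p\<^sub>1 * p\<^sub>2)\<close> times \<open>q\<close>.\<close>
    define K where "K = \<beta> / k + a / (6 * k * k)"
    define q where "q = (\<lambda>s. if s \<le> 0 then 0 else p\<^sub>1 (s - a) - p\<^sub>2 (s - a))"
    define q' where "q' = (\<lambda>s. (- (s - a) - b\<^sub>1 (s - a) / p\<^sub>1 (s - a)) - (- (s - a) - b\<^sub>2 (s - a) / p\<^sub>2 (s - a)))"
    have dq: "(q has_real_derivative q' s) (at s)" if "0 < s" "s < a" for s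
    proof -
      have "\<forall>\<^sub>F x in nhds s. x \<in> {0<..}"
        using that by (intro eventually_nhds_in_open) auto
      then have ev: "\<forall>\<^sub>F x in nhds s. q x = p\<^sub>1 (x - a) - p\<^sub>2 (x - a)"
        by (rule eventually_mono) (auto simp: q_def)
      have y: "- a < s - a" "s - a < 0" using that by auto
      have d: "((\<lambda>x. x - a) has_real_derivative 1) (at s)"
        by (auto intro!: derivative_eq_intros)
      have "((\<lambda>x. p\<^sub>1 (x - a) - p\<^sub>2 (x - a)) has_real_derivative
          (- (s - a) - b\<^sub>1 (s - a) / p\<^sub>1 (s - a)) * 1 - (- (s - a) - b\<^sub>2 (s - a) / p\<^sub>2 (s - a)) * 1) (at s)"
        by (rule DERIV_diff[OF DERIV_chain2[OF dp1[OF y] d] DERIV_chain2[OF dp2[OF y] d]])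
      then have "((\<lambda>x. p\<^sub>1 (x - a) - p\<^sub>2 (x - a)) has_real_derivative q' s) (at s)"
        by (simp only: q'_def mult_1_right)
      then show ?thesis by (subst DERIV_cong_ev[OF refl ev refl])
    qed
    have q_le: "\<bar>q s\<bar> \<le> a * s" if "0 < s" "s < a" for s
      using p_le[OF that] p1(1)[of "s - a"] p2(1)[of "s - a"] that by (auto simp: q_def)
    have cont: "continuous_on {0..c} q"
      unfolding continuous_on_eq_continuous_within
    proof
      fix s assume s: "s \<in> {0..c}"
      show "continuous (at s within {0..c}) q"
      proof (cases "s = 0")
        case True
        have "(q \<longlongrightarrow> 0) (at 0 within {0..c})"
        proof (rule Lim_null_comparison)
          show "\<forall>\<^sub>F x in at 0 within {0..c}. norm (q x) \<le> a * x"
            using q_le c by (auto simp: eventually_at_filter intro!: always_eventually)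
          have "((\<lambda>x. a * x) \<longlongrightarrow> a * 0) (at 0 within {0..c})" by (intro tendsto_intros)
          then show "((\<lambda>x. a * x) \<longlongrightarrow> 0) (at 0 within {0..c})" by simp
        qed
        then show ?thesis using True by (simp add: continuous_within q_def)
      next
        case False
        then have "isCont q s" using dq[of s] s c DERIV_isCont by auto
        then show ?thesis by (rule continuous_at_imp_continuous_at_within)
      qed
    qed
    have "q (y + a) = 0"
    proof (rule singular_gronwall[OF cont])
      show "0 \<le> K" using \<beta> a k by (auto simp: K_def)
      fix s assume s: "0 < s" "s < c"
      show "(q has_real_derivative q' s) (at s)" using dq s c by auto
      fix M assume M: "\<And>r. 0 < r \<Longrightarrow> r \<le> s \<Longrightarrow> \<bar>q r\<bar> \<le> M"
      have M0: "0 \<le> M" using M[of s] s by auto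
      \<comment> \<open>Both \<open>b\<close>-components are of order \<open>s\<^sup>2\<close> at
        the singular point, so their difference starts from 0 and has derivative
        \<open>\<beta> * q\<close>. The sign \<open>\<sigma>\<close> covers both halves of an
        absolute value.\<close>
      have db: "0 \<le> \<beta> * M * s + \<sigma> * (b\<^sub>1 (s - a) - b\<^sub>2 (s - a))" if \<sigma>: "\<sigma> = 1 \<or> \<sigma> = -1" for \<sigma>
      proof (rule tendsto_upperbound)
        let ?D = "\<lambda>x. \<beta> * M * x + \<sigma> * (b\<^sub>1 (x - a) - b\<^sub>2 (x - a))"
        have b_le: "\<bar>b\<^sub>1 (x - a) - b\<^sub>2 (x - a)\<bar> \<le> (a * x)\<^sup>2 / (6 * k)" if x: "0 < x" "x < c" for x
        proof -
          have 1: "(p (x - a))\<^sup>2 / (2 * - (x - a)) \<le> (a * x)\<^sup>2 / (6 * k)"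
            if "0 < p (x - a)" "p (x - a) \<le> a * x" for p :: "real \<Rightarrow> real"
            using that p_ge(3)[OF x] k by (intro frac_le power_mono) auto
          show ?thesis
            using 1[of p\<^sub>1] 1[of p\<^sub>2] p1(1)[of "x - a"] p2(1)[of "x - a"] p_le[of x]
              b1[of "x - a"] b2[of "x - a"] x c by (auto simp: abs_le_iff)
        qed
        have b_le': "\<forall>\<^sub>F x in at_right 0. norm (b\<^sub>1 (x - a) - b\<^sub>2 (x - a)) \<le> (a * x)\<^sup>2 / (6 * k)"
          using eventually_at_right_real[OF c(2)] by (rule eventually_mono) (use b_le in auto)
        have "((\<lambda>x. (a * x)\<^sup>2 / (6 * k)) \<longlongrightarrow> (a * 0)\<^sup>2 / (6 * k)) (at_right 0)"
          by (intro tendsto_intros) (use k in auto)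
        then have "((\<lambda>x. b\<^sub>1 (x - a) - b\<^sub>2 (x - a)) \<longlongrightarrow> 0) (at_right 0)"
          by (intro Lim_null_comparison[OF b_le']) simp
        then have "(?D \<longlongrightarrow> \<beta> * M * 0 + \<sigma> * 0) (at_right 0)"
          by (intro tendsto_intros)
        then show "(?D \<longlongrightarrow> 0) (at_right 0)" by simp
        show "\<forall>\<^sub>F x in at_right 0. ?D x \<le> ?D s"
          using eventually_at_right_real[OF s(1)]
        proof (rule eventually_mono)
          fix x assume x: "x \<in> {0<..<s}"
          show "?D x \<le> ?D s"
          proof (rule DERIV_nonneg_imp_nondecreasing[of x s ?D])
            fix u assume u: "x \<le> u" "u \<le> s"
            have y: "- a < u - a" "u - a < 0" using u x s c by auto
            have d: "((\<lambda>x. x - a) has_real_derivative 1) (at u)"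
              by (auto intro!: derivative_eq_intros)
            have "(?D has_real_derivative \<beta> * M * 1 + \<sigma> * (\<beta> * p\<^sub>1 (u - a) * 1 - \<beta> * p\<^sub>2 (u - a) * 1)) (at u)"
              by (intro DERIV_add DERIV_cmult DERIV_diff DERIV_ident DERIV_chain2[OF db1[OF y] d] DERIV_chain2[OF db2[OF y] d])
            moreover have "0 \<le> \<beta> * (M + \<sigma> * q u)"
              using M[of u] u x \<beta> \<sigma> by (intro mult_nonneg_nonneg) auto
            moreover from this have "0 \<le> \<beta> * M * 1 + \<sigma> * (\<beta> * p\<^sub>1 (u - a) * 1 - \<beta> * p\<^sub>2 (u - a) * 1)"
              using u x by (simp add: q_def algebra_simps)
            ultimately show "\<exists>y. (?D has_real_derivative y) (at u) \<and> 0 \<le> y"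
              by (intro exI conjI)
          qed (use x in auto)
        qed
      qed simp
      let ?y = "s - a"
      have y': "- a < ?y" "?y < 0" using s c by auto
      note P = p1(1)[OF y'] p2(1)[OF y']
      have db': "\<bar>b\<^sub>1 ?y - b\<^sub>2 ?y\<bar> \<le> \<beta> * M * s" using db[of 1] db[of "-1"] by auto
      \<comment> \<open>Numerator and denominator of \<open>b / p\<close> are varied separately: a
        difference of order \<open>s\<close> meets a denominator of order \<open>s\<close>, so both
        coefficients stay bounded.\<close>
      have "q' s = - ((b\<^sub>1 ?y - b\<^sub>2 ?y) / p\<^sub>1 ?y) + b\<^sub>2 ?y / p\<^sub>2 ?y / p\<^sub>1 ?y * q s"
        using P s by (simp add: q'_def q_def field_simps)
      then have "\<bar>q' s\<bar> \<le> \<bar>b\<^sub>1 ?y - b\<^sub>2 ?y\<bar> / p\<^sub>1 ?y + b\<^sub>2 ?y / p\<^sub>2 ?y / p\<^sub>1 ?y * \<bar>q s\<bar>"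
        using P b2(1)[OF y'] by (simp only:) (rule order_trans[OF abs_triangle_ineq], simp add: abs_mult)
      also have "\<bar>b\<^sub>1 ?y - b\<^sub>2 ?y\<bar> / p\<^sub>1 ?y \<le> \<beta> * M * s / (k * s)"
        using db' p_ge(1)[OF s] k s \<beta> M0 by (intro frac_le) auto
      also have "\<beta> * M * s / (k * s) = \<beta> / k * M" using s by simp
      also have "b\<^sub>2 ?y / p\<^sub>2 ?y / p\<^sub>1 ?y * \<bar>q s\<bar> \<le> a / (6 * k * k) * M"
      proof (rule mult_mono)
        have "b\<^sub>2 ?y / p\<^sub>2 ?y \<le> (p\<^sub>2 ?y)\<^sup>2 / (2 * - ?y) / p\<^sub>2 ?y"
          using b2(2)[OF y'] P by (intro divide_right_mono) auto
        also have "\<dots> = p\<^sub>2 ?y / (2 * - ?y)" using P by (simp add: power2_eq_square)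
        also have "\<dots> \<le> a * s / (6 * k)"
          using p_le(2)[of s] p_ge(3)[OF s] P s c k a by (intro frac_le) auto
        finally have "b\<^sub>2 ?y / p\<^sub>2 ?y / p\<^sub>1 ?y \<le> a * s / (6 * k) / (k * s)"
          using p_ge(1)[OF s] k s a P by - (rule frac_le, auto)
        also have "\<dots> = a / (6 * k * k)" using s by simp
        finally show "b\<^sub>2 ?y / p\<^sub>2 ?y / p\<^sub>1 ?y \<le> a / (6 * k * k)" .
      qed (use M[of s] s a k in auto)
      finally show "\<bar>q' s\<bar> \<le> K * M" by (simp add: K_def algebra_simps)
    next
      show "y + a \<in> {0..c}" using y c by auto
    qed (simp add: q_def)
    then show ?thesis using y by (simp add: q_def)
  qed
  \<comment> \<open>Equal velocities make the inverse functions differ by a constant, so the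
    solutions are translates of each other; the shift \<open>\<kappa>\<close> is 0 because both
    reach the value 0 at the same time \<open>S\<close>.\<close>
  have "\<exists>\<kappa>. \<forall>y\<in>{- a<..<0}. g\<^sub>1 y - g\<^sub>2 y = \<kappa>"
  proof (rule has_field_derivative_zero_constant)
    fix y assume y: "y \<in> {- a<..<0}"
    have "((\<lambda>y. g\<^sub>1 y - g\<^sub>2 y) has_real_derivative 1 / p\<^sub>1 y - 1 / p\<^sub>2 y) (at y)"
      using y by (intro DERIV_diff dg1 dg2) auto
    then show "((\<lambda>y. g\<^sub>1 y - g\<^sub>2 y) has_real_derivative 0) (at y within {- a<..<0})"
      using p_eq[of y] y by (auto intro: has_field_derivative_at_within)
  qed auto
  then obtain \<kappa> where \<kappa>: "\<And>y. - a < y \<Longrightarrow> y < 0 \<Longrightarrow> g\<^sub>1 y - g\<^sub>2 y = \<kappa>" by auto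
  have near: "\<exists>y. - a < y \<and> y < 0 \<and> s < g y"
    if "rising_front a \<beta> S f v B" "\<And>t. t < S \<Longrightarrow> g (f t) = t" "s < S" for f v B g s
  proof -
    interpret F: rising_front a \<beta> S f v B by (rule that)
    show ?thesis
      using F.f_neg[of "(s + S) / 2"] F.f_gt[of "(s + S) / 2"] that(2)[of "(s + S) / 2"] that(3)
      by (intro exI[of _ "f ((s + S) / 2)"]) auto
  qed
  have "\<not> \<kappa> < 0"
  proof
    assume "\<kappa> < 0"
    then obtain y where "- a < y" "y < 0" "S + \<kappa> < g\<^sub>1 y" using near[OF assms(1) g1, of "S + \<kappa>"] by auto
    then show False using \<kappa>[of y] g2S[of y] by auto
  qed
  moreover have "\<not> 0 < \<kappa>"
  proof
    assume "0 < \<kappa>"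
    then obtain y where "- a < y" "y < 0" "S - \<kappa> < g\<^sub>2 y" using near[OF assms(2) g2, of "S - \<kappa>"] by auto
    then show False using \<kappa>[of y] g1S[of y] by auto
  qed
  ultimately have "g\<^sub>1 y = g\<^sub>2 y" if "- a < y" "y < 0" for y using \<kappa>[OF that] by auto
  then have "g\<^sub>1 (f\<^sub>2 t) = t" using g2[OF assms(3)] F2.f_neg[OF assms(3)] F2.f_gt[OF assms(3)] by simp
  then show ?thesis using fg1[of "f\<^sub>2 t"] F2.f_neg[OF assms(3)] F2.f_gt[OF assms(3)] by simp
qed

section \<open>Comparison with the explicit solutions\<close>

text \<open>The right side of the implicit equation of \<open>phi_third\<close> for
  \<open>b = sqrt a\<close> and \<open>w = sqrt (- y)\<close>. It is the time at which the solution
  of \<open>w' = - (b ^ 3 - w ^ 3) / 3\<close> that vanishes at time 0 has the value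
  \<open>w\<close>. The formula makes sense for all \<open>w < b\<close>; negative \<open>w\<close>
  describe the continuation beyond the zero when \<open>\<beta> = 1\<close>.\<close>

definition third_time :: "real \<Rightarrow> real \<Rightarrow> real"
  where "third_time b w = sqrt 3 * pi / (6 * b\<^sup>2) - (ln (b\<^sup>2 + b * w + w\<^sup>2) - 2 * ln (b - w)) / (2 * b\<^sup>2)
    - sqrt 3 / b\<^sup>2 * arctan ((b + 2 * w) / (sqrt 3 * b))"

lemma quadratic_form_pos:
  fixes b w :: real
  assumes "0 < b"
  shows "0 < b\<^sup>2 + b * w + w\<^sup>2"
proof -
  have "b\<^sup>2 + b * w + w\<^sup>2 = 3 / 4 * b\<^sup>2 + (b / 2 + w)\<^sup>2"
    by (simp add: power2_eq_square algebra_simps)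
  moreover have "0 < b\<^sup>2" using assms by simp
  ultimately show ?thesis using zero_le_power2[of "b / 2 + w"] by linarith
qed

lemma third_time':
  assumes b: "0 < b" and w: "w < b"
  shows "(third_time b has_real_derivative - 3 / (b ^ 3 - w ^ 3)) (at w)"
proof -
  define D where "D = b\<^sup>2 + b * w + w\<^sup>2"
  have D: "0 < D" unfolding D_def using b by (rule quadratic_form_pos)
  have d1: "((\<lambda>w. ln (b\<^sup>2 + b * w + w\<^sup>2)) has_real_derivative (b + 2 * w) / D) (at w)"
    using D by (auto simp: D_def intro!: derivative_eq_intros)
  have d2: "((\<lambda>w. ln (b - w)) has_real_derivative - 1 / (b - w)) (at w)"
    using w by (auto intro!: derivative_eq_intros)
  have d3: "((\<lambda>w. arctan ((b + 2 * w) / (sqrt 3 * b))) has_real_derivative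
      inverse (1 + ((b + 2 * w) / (sqrt 3 * b))\<^sup>2) * (2 / (sqrt 3 * b))) (at w)"
    by (intro DERIV_chain2[OF DERIV_arctan] DERIV_cdivide) (auto intro!: derivative_eq_intros)
  have "1 + ((b + 2 * w) / (sqrt 3 * b))\<^sup>2 = 4 * D / (3 * b\<^sup>2)"
    using b by (simp add: D_def power_divide power_mult_distrib field_simps) (simp add: power2_eq_square algebra_simps)
  then have e3: "sqrt 3 / b\<^sup>2 * (inverse (1 + ((b + 2 * w) / (sqrt 3 * b))\<^sup>2) * (2 / (sqrt 3 * b))) = 3 / (2 * b * D)"
    using b D by (simp add: field_simps power2_eq_square)
  have "(third_time b has_real_derivative
      0 - ((b + 2 * w) / D - 2 * (- 1 / (b - w))) / (2 * b\<^sup>2)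
      - sqrt 3 / b\<^sup>2 * (inverse (1 + ((b + 2 * w) / (sqrt 3 * b))\<^sup>2) * (2 / (sqrt 3 * b)))) (at w)"
    unfolding third_time_def
    by (intro DERIV_diff DERIV_cdivide DERIV_cmult DERIV_const d1 d2 d3)
  also have "0 - ((b + 2 * w) / D - 2 * (- 1 / (b - w))) / (2 * b\<^sup>2)
      - sqrt 3 / b\<^sup>2 * (inverse (1 + ((b + 2 * w) / (sqrt 3 * b))\<^sup>2) * (2 / (sqrt 3 * b)))
      = - (((b + 2 * w) / D + 2 / (b - w)) / (2 * b\<^sup>2) + 3 / (2 * b * D))"
    unfolding e3 by simp
  also have "((b + 2 * w) / D + 2 / (b - w)) / (2 * b\<^sup>2) + 3 / (2 * b * D)
      = ((b + 2 * w) * (b - w) + 2 * D + 3 * b * (b - w)) / (2 * b\<^sup>2 * (D * (b - w)))"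
    using b D w by (simp add: divide_simps power2_eq_square)
  also have "(b + 2 * w) * (b - w) + 2 * D + 3 * b * (b - w) = 2 * b\<^sup>2 * 3"
    by (simp add: D_def power2_eq_square algebra_simps)
  also have "D * (b - w) = b ^ 3 - w ^ 3"
    by (simp add: D_def power2_eq_square power3_eq_cube algebra_simps)
  also have "- (2 * b\<^sup>2 * 3 / (2 * b\<^sup>2 * (b ^ 3 - w ^ 3))) = - 3 / (b ^ 3 - w ^ 3)"
    by (subst mult_divide_mult_cancel_left) (use b in auto)
  finally show ?thesis .
qed

lemma third_time_0 [simp]: "0 < b \<Longrightarrow> third_time b 0 = 0"
proof -
  assume b: "0 < b"
  have "arctan (1 / sqrt 3) = pi / 6"
    using arctan_unique[of "pi / 6" "1 / sqrt 3"] tan_30 pi_gt_zero by auto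
  then show ?thesis using b
    by (simp add: third_time_def ln_realpow field_simps)
qed

lemma third_time_less:
  assumes "0 < b" "w < u" "u < b"
  shows "third_time b u < third_time b w"
proof (rule DERIV_neg_imp_decreasing[OF assms(2)])
  fix x assume x: "w \<le> x" "x \<le> u"
  then have "0 < (b - x) * (b\<^sup>2 + b * x + x\<^sup>2)"
    using assms quadratic_form_pos[of b x] by (intro mult_pos_pos) auto
  then have "x ^ 3 < b ^ 3"
    by (simp add: power2_eq_square power3_eq_cube algebra_simps)
  then show "\<exists>y. (third_time b has_real_derivative y) (at x) \<and> y < 0"
    using third_time'[of b x] assms x by (intro exI[of _ "- 3 / (b ^ 3 - x ^ 3)"]) auto
qed

lemma filterlim_shift_at_bot: "filterlim (\<lambda>t. t + s :: real) at_bot at_bot"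
  unfolding filterlim_at_bot
proof
  fix Z
  show "\<forall>\<^sub>F t in at_bot. t + s \<le> Z"
    using eventually_le_at_bot[of "Z - s"] by (rule eventually_mono) simp
qed

text \<open>The logarithms cancel in the limit and the arctangent tends to
  \<open>- (pi / 2)\<close>. With \<open>b\<^sup>2 = a\<close> this is the blow-up time for
  \<open>\<beta> = 1\<close>.\<close>

lemma third_time_at_bot:
  assumes b: "0 < b"
  shows "(third_time b \<longlongrightarrow> 2 * pi * sqrt 3 / (3 * b\<^sup>2)) at_bot"
proof -
  have inv: "((\<lambda>w. inverse (b - w)) \<longlongrightarrow> 0) at_bot"
  proof (rule tendsto_inverse_0_at_top)
    show "filterlim (\<lambda>w. b - w) at_top at_bot"
      using filterlim_tendsto_add_at_top[OF tendsto_const[of b] filterlim_uminus_at_top_at_bot]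
      by simp
  qed
  have "((\<lambda>w. 1 - 3 * b * inverse (b - w) + 3 * b\<^sup>2 * (inverse (b - w))\<^sup>2) \<longlongrightarrow> 1 - 3 * b * 0 + 3 * b\<^sup>2 * 0\<^sup>2) at_bot"
    by (intro tendsto_intros inv)
  then have "((\<lambda>w. ln (1 - 3 * b * inverse (b - w) + 3 * b\<^sup>2 * (inverse (b - w))\<^sup>2)) \<longlongrightarrow> ln 1) at_bot"
    by (intro tendsto_ln) auto
  then have l: "((\<lambda>w. ln (b\<^sup>2 + b * w + w\<^sup>2) - 2 * ln (b - w)) \<longlongrightarrow> ln 1) at_bot"
  proof (rule Lim_transform_eventually)
    show "\<forall>\<^sub>F w in at_bot. ln (1 - 3 * b * inverse (b - w) + 3 * b\<^sup>2 * (inverse (b - w))\<^sup>2)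
        = ln (b\<^sup>2 + b * w + w\<^sup>2) - 2 * ln (b - w)"
      using eventually_gt_at_bot[of 0]
    proof (rule eventually_mono)
      fix w :: real assume "w < 0"
      then have w: "0 < b - w" using b by simp
      have "1 - 3 * b * inverse (b - w) + 3 * b\<^sup>2 * (inverse (b - w))\<^sup>2 = (b\<^sup>2 + b * w + w\<^sup>2) / (b - w)\<^sup>2"
      proof -
        have "b\<^sup>2 + b * w + w\<^sup>2 = (b - w)\<^sup>2 - 3 * b * (b - w) + 3 * b\<^sup>2"
          by (simp add: power2_eq_square algebra_simps)
        then have "(b\<^sup>2 + b * w + w\<^sup>2) / (b - w)\<^sup>2 = ((b - w)\<^sup>2 - 3 * b * (b - w) + 3 * b\<^sup>2) / (b - w)\<^sup>2" by simp
        also have "\<dots> = 1 - 3 * b * inverse (b - w) + 3 * b\<^sup>2 * (inverse (b - w))\<^sup>2"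
        proof -
          have "(u\<^sup>2 - 3 * b * u + 3 * b\<^sup>2) / u\<^sup>2 = 1 - 3 * b * inverse u + 3 * b\<^sup>2 * (inverse u)\<^sup>2"
            if "u \<noteq> 0" for u :: real
            using that by (simp add: field_simps power2_eq_square)
          then show ?thesis using w by simp
        qed
        finally show ?thesis by simp
      qed
      then show "ln (1 - 3 * b * inverse (b - w) + 3 * b\<^sup>2 * (inverse (b - w))\<^sup>2)
          = ln (b\<^sup>2 + b * w + w\<^sup>2) - 2 * ln (b - w)"
        using w quadratic_form_pos[OF b, of w] by (simp add: ln_div ln_realpow)
    qed
  qed
  have "filterlim (\<lambda>w. (b + 2 * w) / (sqrt 3 * b)) at_bot at_bot"
  proof -
    have "filterlim (\<lambda>w. 2 / (sqrt 3 * b) * w) at_bot at_bot"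
      by (rule filterlim_tendsto_pos_mult_at_bot[OF tendsto_const _ filterlim_ident]) (use b in simp)
    from filterlim_compose[OF filterlim_shift_at_bot[of "b / (sqrt 3 * b)"] this]
    show ?thesis by (simp add: add_divide_distrib add.commute)
  qed
  then have t: "((\<lambda>w. arctan ((b + 2 * w) / (sqrt 3 * b))) \<longlongrightarrow> - (pi / 2)) at_bot"
    by (rule filterlim_compose[OF tendsto_arctan_at_bot])
  have "(third_time b \<longlongrightarrow> sqrt 3 * pi / (6 * b\<^sup>2) - ln 1 / (2 * b\<^sup>2) - sqrt 3 / b\<^sup>2 * - (pi / 2)) at_bot"
    unfolding third_time_def by (intro tendsto_intros l t) (use b in auto)
  moreover have "sqrt 3 * pi / (6 * b\<^sup>2) - ln 1 / (2 * b\<^sup>2) - sqrt 3 / b\<^sup>2 * - (pi / 2) = 2 * pi * sqrt 3 / (3 * b\<^sup>2)"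
    using b by (simp add: field_simps)
  ultimately show ?thesis by (simp only:)
qed

lemma phi_third_eqI:
  assumes a: "0 < a" and y: "- a < y" "y \<le> 0" and t: "third_time (sqrt a) (sqrt (- y)) = t"
  shows "phi_third a t = y"
proof -
  have eq: "sqrt 3 * pi / (6 * a)
      - 1 / (2 * a) * ln ((a + sqrt (- a * x) - x) / (sqrt a - sqrt (- x))\<^sup>2)
      - sqrt 3 / a * arctan ((sqrt a + 2 * sqrt (- x)) / sqrt (3 * a)) = third_time (sqrt a) (sqrt (- x))"
    if x: "- a < x" "x \<le> 0" for x
  proof -
    define w where "w = sqrt (- x)"
    have w: "0 \<le> w" "w < sqrt a" "x = - w\<^sup>2" using x by (auto simp: w_def)
    have s: "sqrt (- a * x) = sqrt a * w"
      using real_sqrt_mult[of a "- x"] by (simp add: w_def)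
    have p: "0 < a + sqrt a * w - x"
    proof -
      have "0 \<le> sqrt a * w" using w(1) a by (intro mult_nonneg_nonneg) auto
      then show ?thesis using a x by linarith
    qed
    have "ln ((a + sqrt a * w - x) / (sqrt a - w)\<^sup>2) = ln (a + sqrt a * w - x) - 2 * ln (sqrt a - w)"
      using p w by (simp add: ln_div ln_realpow)
    then show ?thesis
      unfolding third_time_def s w_def[symmetric] using a w
      by (simp add: real_sqrt_mult diff_divide_distrib)
  qed
  show ?thesis unfolding phi_third_def
  proof (rule the_equality)
    show "- a < y \<and> y \<le> 0 \<and> t = sqrt 3 * pi / (6 * a)
      - 1 / (2 * a) * ln ((a + sqrt (- a * y) - y) / (sqrt a - sqrt (- y))\<^sup>2)
      - sqrt 3 / a * arctan ((sqrt a + 2 * sqrt (- y)) / sqrt (3 * a))"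
      using eq[OF y] y t by simp
  next
    fix x assume "- a < x \<and> x \<le> 0 \<and> t = sqrt 3 * pi / (6 * a)
      - 1 / (2 * a) * ln ((a + sqrt (- a * x) - x) / (sqrt a - sqrt (- x))\<^sup>2)
      - sqrt 3 / a * arctan ((sqrt a + 2 * sqrt (- x)) / sqrt (3 * a))"
    then have x: "- a < x" "x \<le> 0" "third_time (sqrt a) (sqrt (- x)) = third_time (sqrt a) (sqrt (- y))"
      using eq[of x] t by auto
    have lt: "sqrt (- x) < sqrt a" "sqrt (- y) < sqrt a" using x y by auto
    have "sqrt (- x) = sqrt (- y)"
      using third_time_less[of "sqrt a" "sqrt (- x)" "sqrt (- y)"] third_time_less[of "sqrt a" "sqrt (- y)" "sqrt (- x)"]
        x(3) lt a by (cases "sqrt (- x)" "sqrt (- y)" rule: linorder_cases) auto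
    then show "x = y" by simp
  qed
qed

context front
begin

text \<open>The bound \<open>v_ge\<close> says precisely that \<open>third_time\<close> advances at
  least at unit speed along the solution. This yields the upper bound by \<open>phi_third\<close>
  and also limits the time before the zero.\<close>

lemma third_time_ge:
  assumes "\<beta> \<le> 1" "s \<le> t" "t < S" "\<And>u. u \<le> t \<Longrightarrow> f u < 0" "\<And>u. s \<le> u \<Longrightarrow> u \<le> t \<Longrightarrow> - a < f u"
  shows "third_time (sqrt a) (sqrt (- f s)) + (t - s) \<le> third_time (sqrt a) (sqrt (- f t))"
proof -
  let ?b = "sqrt a"
  define w where "w = (\<lambda>t. sqrt (- f t))"
  have w: "0 < w u" "w u < ?b" if "s \<le> u" "u \<le> t" for u
    using assms(4)[OF that(2)] assms(5)[OF that] by (auto simp: w_def)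
  have d: "((\<lambda>t. third_time ?b (w t) - t) has_real_derivative
      (- 3 / (?b ^ 3 - w u ^ 3)) * ((inverse (w u) / 2) * (- v u)) - 1) (at u)" if u: "s \<le> u" "u \<le> t" for u
  proof (intro DERIV_diff DERIV_ident)
    have "(w has_real_derivative (inverse (w u) / 2) * (- v u)) (at u)"
      unfolding w_def using assms(3,4) u
      by (intro DERIV_chain2[OF DERIV_real_sqrt] DERIV_minus f') auto
    then show "((\<lambda>t. third_time ?b (w t)) has_real_derivative
      (- 3 / (?b ^ 3 - w u ^ 3)) * ((inverse (w u) / 2) * (- v u))) (at u)"
      using w[OF u] a by (intro DERIV_chain2[OF third_time']) auto
  qed
  have "third_time ?b (w s) - s \<le> third_time ?b (w t) - t"
  proof (rule nondecreasing_of_derivative[OF d])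
    fix u assume u: "s \<le> u" "u \<le> t"
    have *: "0 \<le> (- 3 / (c - x ^ 3)) * ((inverse x / 2) * (- y)) - 1"
      if "2 / 3 * (c * x - x ^ 4) \<le> y" "0 < x" "x ^ 3 < c" for c x y :: real
    proof -
      have "1 * (2 * x * (c - x ^ 3)) = 3 * (2 / 3 * (c * x - x ^ 4))"
        by (simp add: power3_eq_cube power4_eq_xxxx algebra_simps)
      also have "\<dots> \<le> 3 * y" using that(1) by (intro mult_left_mono) auto
      finally have "1 \<le> 3 * y / (2 * x * (c - x ^ 3))"
        using that(2,3) by (subst pos_le_divide_eq) auto
      moreover have "(- 3 / k) * ((inverse x / 2) * (- y)) = 3 * y / (2 * x * k)" for k :: real
        using that(2) by (simp add: field_simps)
      ultimately show ?thesis by (simp only: diff_ge_0_iff_ge)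
    qed
    show "0 \<le> (- 3 / (?b ^ 3 - w u ^ 3)) * ((inverse (w u) / 2) * (- v u)) - 1"
    proof (rule *)
      show "2 / 3 * (?b ^ 3 * w u - w u ^ 4) \<le> v u"
        unfolding w_def using assms u by (intro v_ge) auto
      show "w u ^ 3 < ?b ^ 3" using w[OF u] by (intro power_strict_mono) auto
    qed (use w[OF u] in auto)
  qed (use assms in auto)
  then show ?thesis by (simp add: w_def)
qed

end

context rising_front
begin

lemma phi_half_le:
  assumes S: "S = 0" and t: "t < 0"
  shows "phi_half a t \<le> f t"
proof -
  \<comment> \<open>For \<open>phi_half\<close> in place of \<open>f\<close> this expression is
    identically zero; in general it is nonincreasing by \<open>v_le\<close> and tends to 0 at time
    0.\<close>
  define L where "L = (\<lambda>t. ln (a + f t) - ln (a - f t) - a * t)"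
  have fb: "0 < a + f u" "0 < a - f u" if "u < 0" for u
    using f_gt[of u] f_neg[of u] a S that by auto
  have dL: "(L has_real_derivative (v u / (a + f u) + v u / (a - f u) - a)) (at u)" if "u < 0" for u
    unfolding L_def using fb[OF that] S that
    by (auto intro!: derivative_eq_intros f')
  have neg: "v u / (a + f u) + v u / (a - f u) - a \<le> 0" if "u < 0" for u
  proof -
    have "v u / (a + f u) + v u / (a - f u) = 2 * a * v u / (a\<^sup>2 - (f u)\<^sup>2)"
    proof -
      have "a\<^sup>2 - (f u)\<^sup>2 = (a + f u) * (a - f u)" by (simp add: power2_eq_square algebra_simps)
      then show ?thesis using fb[OF that] by (simp add: field_simps)
    qed
    also have "\<dots> \<le> a"
    proof (subst pos_divide_le_eq)
      show "0 < a\<^sup>2 - (f u)\<^sup>2" using fb[OF that] mult_pos_pos[of "a + f u" "a - f u"]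
        by (simp add: power2_eq_square algebra_simps)
      show "2 * a * v u \<le> a * (a\<^sup>2 - (f u)\<^sup>2)" using mult_left_mono[OF v_le[of u], of "2 * a"] a S that by simp
    qed
    finally show ?thesis by simp
  qed
  have "(L \<longlongrightarrow> ln (a + 0) - ln (a - 0) - a * 0) (at_left 0)"
    unfolding L_def using a f_left[unfolded S] by (intro tendsto_intros) auto
  moreover have "\<forall>\<^sub>F u in at_left 0. L u \<le> L t"
    using eventually_at_left_real[OF t]
    by (rule eventually_mono) (rule nonincreasing_of_derivative[OF dL neg], auto)
  ultimately have "ln (a + 0) - ln (a - 0) - a * 0 \<le> L t"
    by (rule tendsto_upperbound) simp
  then have "a * t + ln (a - f t) \<le> ln (a + f t)" by (simp add: L_def)
  then have "exp (a * t + ln (a - f t)) \<le> exp (ln (a + f t))" by simp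
  then have *: "exp (a * t) * (a - f t) \<le> a + f t" using fb[OF t] by (simp add: exp_add)
  have "phi_half a t = a * ((exp (a * t) - 1) / (exp (a * t) + 1))"
  proof -
    have "tanh (a * t / 2) = (1 - exp (- (a * t))) / (1 + exp (- (a * t)))"
      by (simp add: tanh_real_altdef)
    also have "\<dots> = (exp (a * t) - 1) / (exp (a * t) + 1)"
      by (simp add: exp_minus divide_simps) (simp add: algebra_simps)?
    finally show ?thesis by (simp add: phi_half_def)
  qed
  also have "\<dots> = a * (exp (a * t) - 1) / (exp (a * t) + 1)" by simp
  also have "\<dots> \<le> f t"
    using * by (subst pos_divide_le_eq) (auto simp: algebra_simps add_pos_pos)
  finally show ?thesis .
qed

lemma le_phi_third:
  assumes S: "S = 0" and t: "t < 0"
  shows "f t \<le> phi_third a t"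
proof -
  define w where "w = sqrt (- f t)"
  let ?b = "sqrt a"
  have b: "0 < ?b" using a by simp
  have w: "0 < w" "w < ?b" using f_neg[of t] f_gt[of t] S t by (auto simp: w_def)
  have tw: "third_time ?b w \<le> t"
  proof -
    have ev: "\<forall>\<^sub>F u in at_left 0. third_time ?b w + (u - t) \<le> third_time ?b (sqrt (- f u))"
      using eventually_at_left_real[OF t]
      by (rule eventually_mono) (unfold w_def, rule third_time_ge[OF \<beta>_le_1], use S f_neg f_gt in auto)
    have 1: "((\<lambda>u. third_time ?b w + (u - t)) \<longlongrightarrow> third_time ?b w + (0 - t)) (at_left 0)"
      by (intro tendsto_intros)
    have "isCont (third_time ?b) 0" using DERIV_isCont[OF third_time'[OF b b]] .
    moreover have "((\<lambda>u. sqrt (- f u)) \<longlongrightarrow> sqrt (- 0)) (at_left 0)"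
      using f_left[unfolded S] by (intro tendsto_intros)
    ultimately have 2: "((\<lambda>u. third_time ?b (sqrt (- f u))) \<longlongrightarrow> third_time ?b 0) (at_left 0)"
      by (intro isCont_tendsto_compose[of 0 "third_time ?b"]) auto
    have "third_time ?b w + (0 - t) \<le> third_time ?b 0"
      by (rule tendsto_le[OF _ 2 1 ev]) simp
    then show ?thesis using b by simp
  qed
  have "continuous_on {0..w} (third_time ?b)"
    using w b by (intro continuous_at_imp_continuous_on ballI DERIV_isCont[OF third_time']) auto
  \<comment> \<open>\<open>third_time\<close> decreases, and its values at \<open>w\<close> and
    \<open>0\<close> enclose \<open>t\<close>; the root \<open>u\<close> therefore lies below
    \<open>w\<close>, which is the desired order of \<open>f t\<close> and
    \<open>- u\<^sup>2\<close>.\<close>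
  then obtain u where u: "0 \<le> u" "u \<le> w" "third_time ?b u = t"
    using IVT2'[of "third_time ?b" w t 0] tw t b w by auto
  have "phi_third a t = - u\<^sup>2"
  proof (rule phi_third_eqI[OF a])
    have "u < ?b" using u w by simp
    then have "u\<^sup>2 < ?b\<^sup>2" using u by (intro power_strict_mono) auto
    then show "- a < - u\<^sup>2" using a by simp
    show "third_time ?b (sqrt (- (- u\<^sup>2))) = t" using u by simp
  qed auto
  moreover have "u\<^sup>2 \<le> w\<^sup>2" using u by (intro power_mono) auto
  moreover have "f t = - w\<^sup>2" using f_neg[of t] S t by (simp add: w_def)
  ultimately show ?thesis by simp
qed

end

lemma shift_derivative:
  fixes f :: "real \<Rightarrow> real"
  shows "(f has_real_derivative D) (at (t + s)) \<Longrightarrow> ((\<lambda>t. f (t + s)) has_real_derivative D) (at t)"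
  by (simp add: DERIV_shift)

text \<open>The series solution is restarted at a point \<open>t\<^sub>0\<close> of its domain by
  the maximal flow. The lifetime \<open>T\<close> may be infinite, so a \<open>front\<close> is
  provided for every real \<open>S \<le> T\<close>.\<close>

lemma lyapunov_front:
  fixes a \<beta> m :: real
  assumes a: "0 < a" and m: "m \<noteq> 0" and \<beta>: "\<beta> = (1 - 2 * m) / m" "0 \<le> \<beta>"
  obtains t\<^sub>0 :: real and T :: ereal and f v B :: "real \<Rightarrow> real" where
    "ereal t\<^sub>0 < T" "\<And>S. ereal S \<le> T \<Longrightarrow> front a \<beta> S f v B" "\<And>t. t \<le> t\<^sub>0 \<Longrightarrow> 0 < v t"
    "\<And>t. t < t\<^sub>0 \<Longrightarrow> (\<lambda>l. lyapunov_coeff m a l * exp (real l * a * t)) sums (f t + a)"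
    "\<And>\<epsilon>. \<epsilon> < a \<Longrightarrow> ((\<lambda>t. exp (- \<epsilon> * t) * (f t + a)) \<longlongrightarrow> 0) at_bot"
    "\<And>\<epsilon>. \<epsilon> < a \<Longrightarrow> ((\<lambda>t. exp (- \<epsilon> * t) * v t) \<longlongrightarrow> 0) at_bot"
    "\<And>\<epsilon>. \<epsilon> < a \<Longrightarrow> ((\<lambda>t. exp (- \<epsilon> * t) * (- f t * v t - B t)) \<longlongrightarrow> 0) at_bot"
    "\<And>K. (\<And>t. t\<^sub>0 \<le> t \<Longrightarrow> ereal t < T \<Longrightarrow> \<bar>f t\<bar> \<le> K \<and> \<bar>v t\<bar> \<le> K \<and> \<bar>B t\<bar> \<le> K) \<Longrightarrow> T = \<infinity>"
proof (rule lyapunov_series[OF a m \<beta>])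
  fix T\<^sub>0 :: real and f\<^sub>0 v\<^sub>0 B\<^sub>0 :: "real \<Rightarrow> real"
  assume d: "\<And>t. t < T\<^sub>0 \<Longrightarrow> (f\<^sub>0 has_real_derivative v\<^sub>0 t) (at t)"
    "\<And>t. t < T\<^sub>0 \<Longrightarrow> (v\<^sub>0 has_real_derivative - f\<^sub>0 t * v\<^sub>0 t - B\<^sub>0 t) (at t)"
    "\<And>t. t < T\<^sub>0 \<Longrightarrow> (B\<^sub>0 has_real_derivative \<beta> * (v\<^sub>0 t)\<^sup>2) (at t)"
    and series: "\<And>t. t < T\<^sub>0 \<Longrightarrow> (\<lambda>l. lyapunov_coeff m a l * exp (real l * a * t)) sums (f\<^sub>0 t + a)"
    and pos: "\<And>t. t < T\<^sub>0 \<Longrightarrow> 0 < v\<^sub>0 t"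
    and lims: "\<And>\<epsilon>. \<epsilon> < a \<Longrightarrow> ((\<lambda>t. exp (- \<epsilon> * t) * (f\<^sub>0 t + a)) \<longlongrightarrow> 0) at_bot"
    "\<And>\<epsilon>. \<epsilon> < a \<Longrightarrow> ((\<lambda>t. exp (- \<epsilon> * t) * v\<^sub>0 t) \<longlongrightarrow> 0) at_bot"
    "\<And>\<epsilon>. \<epsilon> < a \<Longrightarrow> ((\<lambda>t. exp (- \<epsilon> * t) * (- f\<^sub>0 t * v\<^sub>0 t - B\<^sub>0 t)) \<longlongrightarrow> 0) at_bot"
  define t\<^sub>0 where "t\<^sub>0 = T\<^sub>0 - 1"
  have t0: "t\<^sub>0 < T\<^sub>0" by (simp add: t\<^sub>0_def)
  show thesis
  proof (rule flow_maximal[of "f\<^sub>0 t\<^sub>0" "v\<^sub>0 t\<^sub>0" "B\<^sub>0 t\<^sub>0" \<beta>])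
    fix F V C :: "real \<Rightarrow> real" and T :: ereal
    assume T: "0 < T" and init: "F 0 = f\<^sub>0 t\<^sub>0" "V 0 = v\<^sub>0 t\<^sub>0" "C 0 = B\<^sub>0 t\<^sub>0"
      and D: "\<And>t. 0 \<le> t \<Longrightarrow> ereal t < T \<Longrightarrow> (F has_real_derivative V t) (at t)"
      "\<And>t. 0 \<le> t \<Longrightarrow> ereal t < T \<Longrightarrow> (V has_real_derivative - F t * V t - C t) (at t)"
      "\<And>t. 0 \<le> t \<Longrightarrow> ereal t < T \<Longrightarrow> (C has_real_derivative \<beta> * (V t)\<^sup>2) (at t)"
      and unb: "\<And>K. (\<And>t. 0 \<le> t \<Longrightarrow> ereal t < T \<Longrightarrow> \<bar>F t\<bar> \<le> K \<and> \<bar>V t\<bar> \<le> K \<and> \<bar>C t\<bar> \<le> K) \<Longrightarrow> T = \<infinity>"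
    define f where "f = (\<lambda>t. if t < t\<^sub>0 then f\<^sub>0 t else F (t + - t\<^sub>0))"
    define v where "v = (\<lambda>t. if t < t\<^sub>0 then v\<^sub>0 t else V (t + - t\<^sub>0))"
    define B where "B = (\<lambda>t. if t < t\<^sub>0 then B\<^sub>0 t else C (t + - t\<^sub>0))"
    have lt: "ereal (t + - t\<^sub>0) < T" if "ereal t < T + ereal t\<^sub>0" for t
      using that by (cases T) auto
    have df: "(f has_real_derivative v t) (at t)"
      and dv: "(v has_real_derivative - f t * v t - B t) (at t)"
      and dB: "(B has_real_derivative \<beta> * (v t)\<^sup>2) (at t)" if t: "ereal t < T + ereal t\<^sub>0" for t
    proof -
      show "(f has_real_derivative v t) (at t)" unfolding f_def
        by (rule glue_derivative)
          (use t0 lt[OF t] d(1)[of t] shift_derivative[OF D(1)[of "t + - t\<^sub>0"]] init in \<open>auto simp: v_def\<close>)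
      show "(v has_real_derivative - f t * v t - B t) (at t)" unfolding v_def
        by (rule glue_derivative)
          (use t0 lt[OF t] d(2)[of t] shift_derivative[OF D(2)[of "t + - t\<^sub>0"]] init in \<open>auto simp: f_def B_def\<close>)
      show "(B has_real_derivative \<beta> * (v t)\<^sup>2) (at t)" unfolding B_def
        by (rule glue_derivative)
          (use t0 lt[OF t] d(3)[of t] shift_derivative[OF D(3)[of "t + - t\<^sub>0"]] init in \<open>auto simp: v_def\<close>)
    qed
    have old: "\<forall>\<^sub>F t in at_bot. f\<^sub>0 t = f t \<and> v\<^sub>0 t = v t \<and> B\<^sub>0 t = B t"
      using eventually_gt_at_bot[of t\<^sub>0] by (rule eventually_mono) (simp add: f_def v_def B_def)
    have l1: "((\<lambda>t. exp (- \<epsilon> * t) * (f t + a)) \<longlongrightarrow> 0) at_bot" if "\<epsilon> < a" for \<epsilon>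
      by (rule Lim_transform_eventually[OF lims(1)[OF that]]) (use old in \<open>auto elim!: eventually_mono\<close>)
    have l2: "((\<lambda>t. exp (- \<epsilon> * t) * v t) \<longlongrightarrow> 0) at_bot" if "\<epsilon> < a" for \<epsilon>
      by (rule Lim_transform_eventually[OF lims(2)[OF that]]) (use old in \<open>auto elim!: eventually_mono\<close>)
    have l3: "((\<lambda>t. exp (- \<epsilon> * t) * (- f t * v t - B t)) \<longlongrightarrow> 0) at_bot" if "\<epsilon> < a" for \<epsilon>
      by (rule Lim_transform_eventually[OF lims(3)[OF that]]) (use old in \<open>auto elim!: eventually_mono\<close>)
    have lf: "(f \<longlongrightarrow> - a) at_bot"
      using tendsto_diff[OF l1[OF a] tendsto_const[of a]] by simp
    have lv: "(v \<longlongrightarrow> 0) at_bot" using l2[OF a] by simp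
    have "((\<lambda>t. - f t * v t - (- f t * v t - B t)) \<longlongrightarrow> - (- a) * 0 - 0) at_bot"
      using l3[OF a] by (intro tendsto_intros lf lv) simp
    then have lB: "(B \<longlongrightarrow> 0) at_bot" by simp
    show thesis
    proof (rule that[of t\<^sub>0 "T + ereal t\<^sub>0" f v B])
      show "ereal t\<^sub>0 < T + ereal t\<^sub>0" using T by (cases T) auto
      show "front a \<beta> S f v B" if "ereal S \<le> T + ereal t\<^sub>0" for S
      proof
        fix t assume "t < S"
        then have t: "ereal t < T + ereal t\<^sub>0" using that less_le_trans[of "ereal t" "ereal S"] by simp
        show "(f has_real_derivative v t) (at t)" by (rule df[OF t])
        show "(v has_real_derivative - f t * v t - B t) (at t)" by (rule dv[OF t])
        show "(B has_real_derivative \<beta> * (v t)\<^sup>2) (at t)" by (rule dB[OF t])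
      qed (rule a \<beta>(2) lf lv lB)+
      show "0 < v t" if "t \<le> t\<^sub>0" for t
        using pos[of t] t0 that init by (auto simp: v_def)
      show "(\<lambda>l. lyapunov_coeff m a l * exp (real l * a * t)) sums (f t + a)" if "t < t\<^sub>0" for t
        using series[of t] that t0 by (simp add: f_def)
      fix K assume K: "\<And>t. t\<^sub>0 \<le> t \<Longrightarrow> ereal t < T + ereal t\<^sub>0 \<Longrightarrow> \<bar>f t\<bar> \<le> K \<and> \<bar>v t\<bar> \<le> K \<and> \<bar>B t\<bar> \<le> K"
      have "T = \<infinity>"
      proof (rule unb)
        fix t assume "0 \<le> t" "ereal t < T"
        then show "\<bar>F t\<bar> \<le> K \<and> \<bar>V t\<bar> \<le> K \<and> \<bar>C t\<bar> \<le> K"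
          using K[of "t + t\<^sub>0"] by (cases T) (auto simp: f_def v_def B_def)
      qed
      then show "T + ereal t\<^sub>0 = \<infinity>" by simp
    qed (use l1 l2 l3 in auto)
  qed
qed

section \<open>The normalised maximal solution\<close>

lemma bounded_on_Icc:
  fixes g :: "real \<Rightarrow> real"
  assumes "continuous_on {s..t} g"
  obtains K where "0 \<le> K" "\<And>x. s \<le> x \<Longrightarrow> x \<le> t \<Longrightarrow> \<bar>g x\<bar> \<le> K"
proof (cases "s \<le> t")
  case True
  then have "\<exists>x\<in>{s..t}. \<forall>y\<in>{s..t}. \<bar>g y\<bar> \<le> \<bar>g x\<bar>"
    using assms by (intro continuous_attains_sup) (auto intro!: continuous_intros)
  then obtain x where x: "\<And>y. y \<in> {s..t} \<Longrightarrow> \<bar>g y\<bar> \<le> \<bar>g x\<bar>" by blast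
  show ?thesis by (rule that[of "\<bar>g x\<bar>"]) (use x in auto)
qed (auto intro: that[of 0])

text \<open>The lower bound \<open>v_ge\<close> is strictly positive for \<open>f\<close> strictly
  between \<open>- a\<close> and \<open>0\<close>, so a solution in that range cannot turn back
  before its zero.\<close>

lemma (in front) v_pos_of_between:
  assumes "\<beta> \<le> 1" "t < S" "\<And>u. u \<le> t \<Longrightarrow> f u < 0" "- a < f t"
  shows "0 < v t"
proof -
  have w: "0 < sqrt (- f t)" "sqrt (- f t) < sqrt a" using assms(3)[of t] assms(4) by auto
  then have "0 < sqrt (- f t) * (sqrt a ^ 3 - sqrt (- f t) ^ 3)"
    by (intro mult_pos_pos) (auto simp del: real_sqrt_power intro!: power_strict_mono)
  also have "\<dots> = sqrt a ^ 3 * sqrt (- f t) - sqrt (- f t) ^ 4"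
    by (simp only: power4_eq_xxxx power3_eq_cube right_diff_distrib mult_ac)
  finally have "0 < 2 / 3 * (sqrt a ^ 3 * sqrt (- f t) - sqrt (- f t) ^ 4)"
    by (intro mult_pos_pos) simp_all
  also have "\<dots> \<le> v t"
    by (rule v_ge) (use assms in auto)
  finally show ?thesis .
qed

lemma (in front) shift: "front a \<beta> (S - s) (\<lambda>t. f (t + s)) (\<lambda>t. v (t + s)) (\<lambda>t. B (t + s))"
proof
  fix t assume "t < S - s"
  then have t: "t + s < S" by simp
  show "((\<lambda>t. f (t + s)) has_real_derivative v (t + s)) (at t)" by (rule shift_derivative[OF f'[OF t]])
  show "((\<lambda>t. v (t + s)) has_real_derivative - f (t + s) * v (t + s) - B (t + s)) (at t)"
    by (rule shift_derivative[OF v'[OF t]])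
  show "((\<lambda>t. B (t + s)) has_real_derivative \<beta> * (v (t + s))\<^sup>2) (at t)"
    by (rule shift_derivative[OF B'[OF t]])
next
  show "((\<lambda>t. f (t + s)) \<longlongrightarrow> - a) at_bot" by (rule filterlim_compose[OF lim_f filterlim_shift_at_bot])
  show "((\<lambda>t. v (t + s)) \<longlongrightarrow> 0) at_bot" by (rule filterlim_compose[OF lim_v filterlim_shift_at_bot])
  show "((\<lambda>t. B (t + s)) \<longlongrightarrow> 0) at_bot" by (rule filterlim_compose[OF lim_B filterlim_shift_at_bot])
qed (rule a \<beta>)+

text \<open>The last assumption expresses maximality: a solution that stays bounded is defined for all time.\<close>

locale maximal_front =
  fixes a \<beta> :: real and T :: ereal and f v B :: "real \<Rightarrow> real"
  assumes T_pos: "0 < T"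
    and fronts: "\<And>S. ereal S \<le> T \<Longrightarrow> front a \<beta> S f v B"
    and rising: "rising_front a \<beta> 0 f v B"
    and f_0: "f 0 = 0"
    and unbounded: "\<And>K. (\<And>t. 0 \<le> t \<Longrightarrow> ereal t < T \<Longrightarrow> \<bar>f t\<bar> \<le> K \<and> \<bar>v t\<bar> \<le> K \<and> \<bar>B t\<bar> \<le> K) \<Longrightarrow> T = \<infinity>"

text \<open>As long as \<open>f\<close> is negative, it cannot fall below
  \<open>f t\<^sub>0\<close>. If it never reached 0, \<open>third_time\<close> would bound the
  remaining lifetime, the state would be bounded over that time, and maximality would give an
  infinite lifetime after all.\<close>

lemma first_zero:
  fixes a \<beta> t\<^sub>0 :: real and T :: ereal
  assumes a: "0 < a" and \<beta>: "0 \<le> \<beta>" "\<beta> \<le> 1" and t0: "ereal t\<^sub>0 < T"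
    and fronts: "\<And>S. ereal S \<le> T \<Longrightarrow> front a \<beta> S f v B" and pos: "\<And>t. t \<le> t\<^sub>0 \<Longrightarrow> 0 < v t"
    and unb: "\<And>K. (\<And>t. t\<^sub>0 \<le> t \<Longrightarrow> ereal t < T \<Longrightarrow> \<bar>f t\<bar> \<le> K \<and> \<bar>v t\<bar> \<le> K \<and> \<bar>B t\<bar> \<le> K) \<Longrightarrow> T = \<infinity>"
  obtains z where "ereal z < T" "f z = 0" "\<And>t. t < z \<Longrightarrow> f t < 0" "\<And>t. t < z \<Longrightarrow> 0 < v t"
proof -
  have fr: "\<exists>S. t < S \<and> front a \<beta> S f v B" if "ereal t < T" for t
    using ereal_dense2[OF that] fronts by (metis less_ereal.simps(1) less_imp_le)
  have df: "(f has_real_derivative v t) (at t)" and dB: "(B has_real_derivative \<beta> * (v t)\<^sup>2) (at t)"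
    and B0: "0 \<le> B t" and vle: "v t \<le> (a\<^sup>2 - (f t)\<^sup>2) / 2"
    if t: "ereal t < T" for t
  proof -
    obtain S where S: "t < S" "front a \<beta> S f v B" using fr[OF t] by blast
    note front = front.f'[OF S(2,1)] front.B'[OF S(2,1)] front.B_nonneg[OF S(2,1)] front.v_le[OF S(2,1)]
    show "(f has_real_derivative v t) (at t)" "(B has_real_derivative \<beta> * (v t)\<^sup>2) (at t)"
      "0 \<le> B t" "v t \<le> (a\<^sup>2 - (f t)\<^sup>2) / 2"
      by (fact front)+
  qed
  have lim: "(f \<longlongrightarrow> - a) at_bot" using fr[OF t0] front.lim_f by blast
  have lessT: "ereal s < T" if "s \<le> t" "ereal t < T" for s t
    using that by (meson ereal_less_eq(3) le_less_trans)
  have f_t0: "- a < f t\<^sub>0"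
  proof -
    have "- a \<le> f (t\<^sub>0 - 1)"
      by (rule ge_limit_at_bot[OF df _ lim]) (use pos lessT[OF _ t0] in \<open>auto intro!: less_imp_le\<close>)
    also have "\<dots> < f t\<^sub>0"
      by (rule DERIV_pos_imp_increasing[of "t\<^sub>0 - 1" t\<^sub>0 f])
        (use pos df lessT[OF _ t0] in \<open>auto intro!: exI[of _ "v _"]\<close>)
    finally show ?thesis .
  qed
  have stay: "f t\<^sub>0 \<le> f t" if t: "t\<^sub>0 \<le> t" "ereal t < T" and neg: "\<And>u. u \<le> t \<Longrightarrow> f u < 0" for t
  proof -
    have "0 \<le> f t - f t\<^sub>0"
    proof (rule barrier[of t\<^sub>0 t "\<lambda>t. f t - f t\<^sub>0" v])
      fix u assume u: "t\<^sub>0 \<le> u" "u \<le> t"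
      have uT: "ereal u < T" by (rule lessT[OF u(2) t(2)])
      show "((\<lambda>t. f t - f t\<^sub>0) has_real_derivative v u) (at u)"
        using df[OF uT] by (auto intro!: derivative_eq_intros)
      assume "\<And>r. t\<^sub>0 \<le> r \<Longrightarrow> r \<le> u \<Longrightarrow> 0 \<le> f r - f t\<^sub>0"
      then have "- a < f u" using f_t0 u by force
      moreover obtain S where "u < S" "front a \<beta> S f v B" using fr[OF uT] by blast
      ultimately show "0 < v u"
        using front.v_pos_of_between[of a \<beta> S f v B u] \<beta> neg u by auto
    qed (use t in auto)
    then show ?thesis by simp
  qed
  have "\<exists>z. ereal z < T \<and> 0 \<le> f z"
  proof (rule ccontr)
    assume "\<not> (\<exists>z. ereal z < T \<and> 0 \<le> f z)"
    then have neg: "f t < 0" if "ereal t < T" for t using that by force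
    define \<tau> where "\<tau> = third_time (sqrt a) (sqrt (- f t\<^sub>0))"
    have bd: "t < t\<^sub>0 - \<tau>" if t: "t\<^sub>0 \<le> t" "ereal t < T" for t
    proof -
      have between: "- a < f u" "f u < 0" if "t\<^sub>0 \<le> u" "u \<le> t" for u
      proof -
        have uT: "ereal u < T" by (rule lessT[OF that(2) t(2)])
        show "f u < 0" by (rule neg[OF uT])
        have "f t\<^sub>0 \<le> f u" by (rule stay[OF that(1) uT]) (rule neg[OF lessT[OF _ uT]])
        then show "- a < f u" using f_t0 by simp
      qed
      obtain S where S: "t < S" "front a \<beta> S f v B" using fr[OF t(2)] by blast
      have "\<tau> + (t - t\<^sub>0) \<le> third_time (sqrt a) (sqrt (- f t))"
        unfolding \<tau>_def
        by (rule front.third_time_ge[OF S(2) \<beta>(2) t(1) S(1)])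
          (use neg lessT[OF _ t(2)] between in auto)
      also have "\<dots> < third_time (sqrt a) 0"
        using between[of t] t(1) a by (intro third_time_less) auto
      finally show ?thesis using a by simp
    qed
    \<comment> \<open>The summands bound \<open>\<bar>f\<bar>\<close> by \<open>a\<close>,
      \<open>v\<close> by \<open>a\<^sup>2 / 2\<close>, and \<open>B\<close> by its initial value
      plus growth at rate \<open>a ^ 4 / 4\<close> during a time shorter than
      \<open>- \<tau>\<close>.\<close>
    define K where "K = a + a\<^sup>2 / 2 + B t\<^sub>0 + a ^ 4 / 4 * (- \<tau>)"
    have "T = \<infinity>"
    proof (rule unb)
      fix t assume t: "t\<^sub>0 \<le> t" "ereal t < T"
      have tT: "ereal u < T" if "u \<le> t" for u by (rule lessT[OF that t(2)])
      have f: "- a < f u" "f u < 0" if "t\<^sub>0 \<le> u" "u \<le> t" for u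
        using stay[OF that(1) tT[OF that(2)]] neg[OF tT] that f_t0 by force+
      have v: "0 < v u" "v u \<le> a\<^sup>2 / 2" if u: "t\<^sub>0 \<le> u" "u \<le> t" for u
      proof -
        obtain S where S: "u < S" "front a \<beta> S f v B" using fr[OF tT[OF u(2)]] by blast
        show "0 < v u"
          by (rule front.v_pos_of_between[OF S(2) \<beta>(2) S(1)]) (use f[OF u] neg tT u in auto)
        have "(a\<^sup>2 - (f u)\<^sup>2) / 2 \<le> a\<^sup>2 / 2" by simp
        then show "v u \<le> a\<^sup>2 / 2" using vle[OF tT[OF u(2)]] by (rule order_trans[rotated])
      qed
      have "B t - a ^ 4 / 4 * t \<le> B t\<^sub>0 - a ^ 4 / 4 * t\<^sub>0"
      proof (rule nonincreasing_of_derivative[of t\<^sub>0 t "\<lambda>t. B t - a ^ 4 / 4 * t" "\<lambda>t. \<beta> * (v t)\<^sup>2 - a ^ 4 / 4"])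
        fix u assume u: "t\<^sub>0 \<le> u" "u \<le> t"
        show "((\<lambda>t. B t - a ^ 4 / 4 * t) has_real_derivative \<beta> * (v u)\<^sup>2 - a ^ 4 / 4) (at u)"
          using dB[OF tT[OF u(2)]] by (auto intro!: derivative_eq_intros)
        have "\<beta> * (v u)\<^sup>2 \<le> 1 * (a\<^sup>2 / 2)\<^sup>2"
          using v[OF u] \<beta> by (intro mult_mono power_mono) auto
        then show "\<beta> * (v u)\<^sup>2 - a ^ 4 / 4 \<le> 0" by (simp add: power_divide)
      qed (use t in auto)
      then have "B t \<le> B t\<^sub>0 + a ^ 4 / 4 * (t - t\<^sub>0)" unfolding right_diff_distrib by linarith
      also have "\<dots> \<le> B t\<^sub>0 + a ^ 4 / 4 * (- \<tau>)"
        using bd[OF t] by (intro add_left_mono mult_left_mono) auto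
      finally have Bt: "B t \<le> B t\<^sub>0 + a ^ 4 / 4 * (- \<tau>)" .
      have "0 \<le> B t" "0 \<le> a\<^sup>2 / 2" using B0[OF t(2)] by auto
      then show "\<bar>f t\<bar> \<le> K \<and> \<bar>v t\<bar> \<le> K \<and> \<bar>B t\<bar> \<le> K"
        using Bt f[of t] v[of t] t(1) a unfolding K_def by auto
    qed
    then show False using bd[of "t\<^sub>0 + \<bar>\<tau>\<bar>"] by auto
  qed
  then obtain y where y: "ereal y < T" "0 \<le> f y" by blast
  have "\<forall>\<^sub>F t in at_bot. f t < 0" using lim a by (intro order_tendstoD(2)) auto
  then obtain s where s: "\<And>t. t \<le> s \<Longrightarrow> f t < 0" unfolding eventually_at_bot_linorder by blast
  have "continuous_on {s..y} f"
    using lessT[OF _ y(1)] by (auto intro!: continuous_at_imp_continuous_on DERIV_isCont[OF df])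
  then obtain z where z: "s < z" "z \<le> y" "f z = 0" and below: "\<And>t. t < z \<Longrightarrow> f t < 0"
    using first_nonneg[of s y f] s y(2) by blast
  have zT: "ereal z < T" by (rule lessT[OF z(2) y(1)])
  show ?thesis
  proof (rule that[OF zT z(3) below])
    fix t assume t: "t < z"
    show "0 < v t"
    proof (cases "t \<le> t\<^sub>0")
      case False
      have tT: "ereal t < T" using lessT[OF _ zT] t by auto
      have neg: "f u < 0" if "u \<le> t" for u using below that t by auto
      obtain S where S: "t < S" "front a \<beta> S f v B" using fr[OF tT] by blast
      show ?thesis
        by (rule front.v_pos_of_between[OF S(2) \<beta>(2) S(1) neg])
          (use stay[OF _ tT neg] False f_t0 in force)+
    qed (rule pos)
  qed
qed

lemma maximal_front_exists:
  fixes a \<beta> m :: real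
  assumes a: "0 < a" and m: "m \<noteq> 0" and \<beta>: "\<beta> = (1 - 2 * m) / m" "0 \<le> \<beta>" "\<beta> \<le> 1"
  obtains T f v B d where "maximal_front a \<beta> T f v B" "0 < d"
    "\<exists>\<delta>>0. \<forall>t. \<bar>d * exp (a * t)\<bar> < \<delta> \<longrightarrow> (\<lambda>l. lyapunov_coeff m a l * d ^ l * exp (real l * a * t)) sums (f t + a)"
    "\<And>\<epsilon>. \<epsilon> < a \<Longrightarrow> ((\<lambda>t. exp (- \<epsilon> * t) * (f t + a)) \<longlongrightarrow> 0) at_bot"
    "\<And>\<epsilon>. \<epsilon> < a \<Longrightarrow> ((\<lambda>t. exp (- \<epsilon> * t) * v t) \<longlongrightarrow> 0) at_bot"
    "\<And>\<epsilon>. \<epsilon> < a \<Longrightarrow> ((\<lambda>t. exp (- \<epsilon> * t) * (- f t * v t - B t)) \<longlongrightarrow> 0) at_bot"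
proof (rule lyapunov_front[OF a m \<beta>(1,2)])
  fix t\<^sub>0 :: real and T :: ereal and f v B :: "real \<Rightarrow> real"
  assume t0: "ereal t\<^sub>0 < T" and fronts: "\<And>S. ereal S \<le> T \<Longrightarrow> front a \<beta> S f v B"
    and pos: "\<And>t. t \<le> t\<^sub>0 \<Longrightarrow> 0 < v t"
    and series: "\<And>t. t < t\<^sub>0 \<Longrightarrow> (\<lambda>l. lyapunov_coeff m a l * exp (real l * a * t)) sums (f t + a)"
    and lims: "\<And>\<epsilon>. \<epsilon> < a \<Longrightarrow> ((\<lambda>t. exp (- \<epsilon> * t) * (f t + a)) \<longlongrightarrow> 0) at_bot"
    "\<And>\<epsilon>. \<epsilon> < a \<Longrightarrow> ((\<lambda>t. exp (- \<epsilon> * t) * v t) \<longlongrightarrow> 0) at_bot"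
    "\<And>\<epsilon>. \<epsilon> < a \<Longrightarrow> ((\<lambda>t. exp (- \<epsilon> * t) * (- f t * v t - B t)) \<longlongrightarrow> 0) at_bot"
    and unb: "\<And>K. (\<And>t. t\<^sub>0 \<le> t \<Longrightarrow> ereal t < T \<Longrightarrow> \<bar>f t\<bar> \<le> K \<and> \<bar>v t\<bar> \<le> K \<and> \<bar>B t\<bar> \<le> K) \<Longrightarrow> T = \<infinity>"
  show thesis
  proof (rule first_zero[OF a \<beta>(2,3) t0 fronts pos unb])
    fix z assume z: "ereal z < T" "f z = 0" and neg: "\<And>t. t < z \<Longrightarrow> f t < 0" and vpos: "\<And>t. t < z \<Longrightarrow> 0 < v t"
    let ?f = "\<lambda>t. f (t + z)" and ?v = "\<lambda>t. v (t + z)" and ?B = "\<lambda>t. B (t + z)"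
    let ?T = "T + ereal (- z)"
    have T: "ereal t < ?T \<longleftrightarrow> ereal (t + z) < T" "ereal t \<le> ?T \<longleftrightarrow> ereal (t + z) \<le> T" for t
      by (cases T; auto)+
    have shifted: "front a \<beta> S ?f ?v ?B" if "ereal S \<le> ?T" for S
      using front.shift[OF fronts[of "S + z"], of z] that T by simp
    have lim_shift: "((\<lambda>t. exp (- \<epsilon> * t) * g (t + z)) \<longlongrightarrow> 0) at_bot"
      if "((\<lambda>t. exp (- \<epsilon> * t) * g t) \<longlongrightarrow> 0) at_bot" for \<epsilon> and g :: "real \<Rightarrow> real"
    proof -
      have "((\<lambda>t. exp (\<epsilon> * z) * (exp (- \<epsilon> * (t + z)) * g (t + z))) \<longlongrightarrow> exp (\<epsilon> * z) * 0) at_bot"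
        by (intro tendsto_mult tendsto_const filterlim_compose[OF that filterlim_shift_at_bot])
      moreover have "exp (\<epsilon> * z) * (exp (- \<epsilon> * (t + z)) * y) = exp (- \<epsilon> * t) * y" for t y
      proof -
        have "\<epsilon> * z + - \<epsilon> * (t + z) = - \<epsilon> * t" by (simp add: algebra_simps)
        then show ?thesis by (simp only: mult.assoc[symmetric] exp_add[symmetric])
      qed
      ultimately show ?thesis by (simp only: mult_zero_right)
    qed
    have front0: "front a \<beta> 0 ?f ?v ?B" by (rule shifted) (use z T(2)[of 0] in auto)
    have "maximal_front a \<beta> ?T ?f ?v ?B"
    proof (rule maximal_front.intro)
      show "0 < ?T" using T(1)[of 0] z(1) by (simp add: zero_ereal_def)
      obtain S where S: "z < S" "ereal S < T" using ereal_dense2[OF z(1)] by auto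
      have "isCont f z"
        using front.isCont_fvB(1)[OF fronts[OF less_imp_le[OF S(2)]] S(1)] .
      then have "isCont ?f 0" by (intro isCont_o2[where g = f and f = "\<lambda>t. t + z" and a = 0]) auto
      then have "(?f \<longlongrightarrow> 0) (at_left 0)" using z(2) by (simp add: isCont_def filterlim_at_split)
      then show "rising_front a \<beta> 0 ?f ?v ?B"
        by (intro rising_front.intro rising_front_axioms.intro front0) (use \<beta>(3) vpos in auto)
      show "?f 0 = 0" using z by simp
      show "front a \<beta> S ?f ?v ?B" if "ereal S \<le> ?T" for S by (rule shifted[OF that])
      fix K assume K: "\<And>t. 0 \<le> t \<Longrightarrow> ereal t < ?T \<Longrightarrow> \<bar>?f t\<bar> \<le> K \<and> \<bar>?v t\<bar> \<le> K \<and> \<bar>?B t\<bar> \<le> K"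
      obtain S where S: "z < S" "ereal S < T" using ereal_dense2[OF z(1)] by auto
      note fS = front.isCont_fvB[OF fronts[OF less_imp_le[OF S(2)]]]
      have "continuous_on {t\<^sub>0..z} f" "continuous_on {t\<^sub>0..z} v" "continuous_on {t\<^sub>0..z} B"
        using S by (auto intro!: continuous_at_imp_continuous_on fS)
      then obtain K1 K2 K3 where K': "0 \<le> K1" "0 \<le> K2" "0 \<le> K3"
        "\<And>x. t\<^sub>0 \<le> x \<Longrightarrow> x \<le> z \<Longrightarrow> \<bar>f x\<bar> \<le> K1" "\<And>x. t\<^sub>0 \<le> x \<Longrightarrow> x \<le> z \<Longrightarrow> \<bar>v x\<bar> \<le> K2"
        "\<And>x. t\<^sub>0 \<le> x \<Longrightarrow> x \<le> z \<Longrightarrow> \<bar>B x\<bar> \<le> K3"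
        using bounded_on_Icc[of t\<^sub>0 z f] bounded_on_Icc[of t\<^sub>0 z v] bounded_on_Icc[of t\<^sub>0 z B] by metis
      have "0 \<le> K" using K[of 0] T(1)[of 0] z(1) by auto
      have "T = \<infinity>"
      proof (rule unb)
        fix t assume t: "t\<^sub>0 \<le> t" "ereal t < T"
        show "\<bar>f t\<bar> \<le> K + K1 + K2 + K3 \<and> \<bar>v t\<bar> \<le> K + K1 + K2 + K3 \<and> \<bar>B t\<bar> \<le> K + K1 + K2 + K3"
        proof (cases "t \<le> z")
          case True
          then show ?thesis using K'(1-3) K'(4-6)[OF t(1) True] \<open>0 \<le> K\<close> by auto
        next
          case False
          then show ?thesis using K[of "t - z"] T(1)[of "t - z"] t(2) K'(1-3) by auto
        qed
      qed
      then show "?T = \<infinity>" by simp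
    qed
    then show thesis
    \<comment> \<open>Moving the zero \<open>z\<close> to 0 changes the parameter of the family from
      1 to \<open>exp (a * z)\<close>.\<close>
    proof (rule that[of ?T ?f ?v ?B "exp (a * z)"])
      show "\<exists>\<delta>>0. \<forall>t. \<bar>exp (a * z) * exp (a * t)\<bar> < \<delta> \<longrightarrow>
          (\<lambda>l. lyapunov_coeff m a l * exp (a * z) ^ l * exp (real l * a * t)) sums (?f t + a)"
      proof (intro exI[of _ "exp (a * t\<^sub>0)"] conjI allI impI)
        fix t assume "\<bar>exp (a * z) * exp (a * t)\<bar> < exp (a * t\<^sub>0)"
        then have "exp (a * (t + z)) < exp (a * t\<^sub>0)" by (simp add: exp_add[symmetric] algebra_simps)
        then have "t + z < t\<^sub>0" using a by simp
        moreover have "exp (a * z) ^ l * exp (real l * a * t) = exp (real l * a * (t + z))" for l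
          by (simp add: exp_of_nat_mult[symmetric] exp_add[symmetric] algebra_simps)
        ultimately show "(\<lambda>l. lyapunov_coeff m a l * exp (a * z) ^ l * exp (real l * a * t)) sums (?f t + a)"
          using series[of "t + z"] by (simp add: mult.assoc)
      qed simp
      show "((\<lambda>t. exp (- \<epsilon> * t) * (?f t + a)) \<longlongrightarrow> 0) at_bot" if "\<epsilon> < a" for \<epsilon>
        by (rule lim_shift[OF lims(1)[OF that]])
      show "((\<lambda>t. exp (- \<epsilon> * t) * ?v t) \<longlongrightarrow> 0) at_bot" if "\<epsilon> < a" for \<epsilon>
        by (rule lim_shift[OF lims(2)[OF that]])
      show "((\<lambda>t. exp (- \<epsilon> * t) * (- ?f t * ?v t - ?B t)) \<longlongrightarrow> 0) at_bot" if "\<epsilon> < a" for \<epsilon>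
        by (rule lim_shift[OF lims(3)[OF that]])
    qed simp
  qed
qed

text \<open>\<open>v + f\<^sup>2 / 2\<close> falls at a rate of at least \<open>c\<close>, so
  eventually \<open>v \<le> - (1 + f\<^sup>2) / 2\<close>; then \<open>arctan f\<close> falls at a
  rate of at least \<open>1 / 2\<close>, although it is bounded.\<close>

lemma no_global_descent:
  fixes f v B :: "real \<Rightarrow> real"
  assumes f': "\<And>t. 0 \<le> t \<Longrightarrow> (f has_real_derivative v t) (at t)"
    and v': "\<And>t. 0 \<le> t \<Longrightarrow> (v has_real_derivative - f t * v t - B t) (at t)"
    and B: "\<And>t. 0 \<le> t \<Longrightarrow> c \<le> B t" and c: "0 < c"
  shows False
proof -
  define R where "R = (\<lambda>t. v t + (f t)\<^sup>2 / 2)"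
  \<comment> \<open>From this time on, \<open>R \<le> - 1 / 2\<close>.\<close>
  define s where "s = (\<bar>R 0\<bar> + 1 / 2) / c"
  have s: "0 \<le> s" using c by (simp add: s_def)
  have v_le: "v t \<le> - (1 + (f t)\<^sup>2) / 2" if t: "s \<le> t" for t
  proof -
    have "R t + c * t \<le> R 0 + c * 0"
    proof (rule nonincreasing_of_derivative[of 0 t "\<lambda>t. R t + c * t" "\<lambda>t. - B t + c"])
      fix u assume "0 \<le> u" "u \<le> t"
      then show "((\<lambda>t. R t + c * t) has_real_derivative - B u + c) (at u)"
        unfolding R_def by (auto intro!: derivative_eq_intros f' v')
    qed (use B s t in auto)
    moreover have "c * s = \<bar>R 0\<bar> + 1 / 2" using c by (simp add: s_def)
    moreover have "c * s \<le> c * t" using t c by simp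
    ultimately have "R t \<le> - 1 / 2" by simp
    then show ?thesis by (simp add: R_def field_simps)
  qed
  \<comment> \<open>During a time \<open>2 * pi\<close> the arctangent would drop by
    \<open>pi\<close>, the full length of its open range.\<close>
  define u where "u = s + 2 * pi"
  have "arctan (f u) + u / 2 \<le> arctan (f s) + s / 2"
  proof (rule nonincreasing_of_derivative[of s u "\<lambda>t. arctan (f t) + t / 2" "\<lambda>t. inverse (1 + (f t)\<^sup>2) * v t + 1 / 2"])
    fix t assume t: "s \<le> t" "t \<le> u"
    show "((\<lambda>t. arctan (f t) + t / 2) has_real_derivative inverse (1 + (f t)\<^sup>2) * v t + 1 / 2) (at t)"
      using t s by (intro DERIV_add DERIV_chain2[OF DERIV_arctan] f' DERIV_cdivide DERIV_ident) auto
    have p: "0 < 1 + (f t)\<^sup>2" by (simp add: add_pos_nonneg)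
    have "inverse (1 + (f t)\<^sup>2) * v t \<le> inverse (1 + (f t)\<^sup>2) * (- (1 + (f t)\<^sup>2) / 2)"
      using v_le[OF t(1)] p by (intro mult_left_mono) auto
    also have "\<dots> = - 1 / 2" using p by (simp add: field_simps)
    finally show "inverse (1 + (f t)\<^sup>2) * v t + 1 / 2 \<le> 0" by simp
  qed (simp add: u_def)
  then have "arctan (f u) + pi \<le> arctan (f s)" by (simp add: u_def add_divide_distrib)
  then show False using arctan_bounded[of "f u"] arctan_bounded[of "f s"] by linarith
qed

section \<open>Blow-up\<close>

lemma eventually_at_left_interval:
  fixes \<tau> :: real
  assumes "eventually P (at_left \<tau>)"
  obtains s where "s < \<tau>" "\<And>t. s \<le> t \<Longrightarrow> t < \<tau> \<Longrightarrow> P t"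
proof -
  obtain b where b: "b < \<tau>" "\<And>y. b < y \<Longrightarrow> y < \<tau> \<Longrightarrow> P y"
    using assms unfolding eventually_at_left_field by blast
  show ?thesis by (rule that[of "(b + \<tau>) / 2"]) (use b in auto)
qed

lemma eventually_at_left_from:
  fixes \<tau> :: real
  shows "s < \<tau> \<Longrightarrow> \<forall>\<^sub>F t in at_left \<tau>. s \<le> t \<and> t < \<tau>"
  using eventually_at_left_real[of s \<tau>] by (rule eventually_mono) auto

text \<open>The bound \<open>\<beta> < 3\<close> is what lets the improved upper and lower rates
  close up on each other in \<open>rate\<close>.\<close>

locale blowup =
  fixes \<beta> s \<tau> :: real and z \<nu> B :: "real \<Rightarrow> real"
  assumes \<beta>: "0 \<le> \<beta>" "\<beta> < 3" and s: "s < \<tau>"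
    and z': "\<And>t. s \<le> t \<Longrightarrow> t < \<tau> \<Longrightarrow> (z has_real_derivative \<nu> t) (at t)"
    and \<nu>': "\<And>t. s \<le> t \<Longrightarrow> t < \<tau> \<Longrightarrow> (\<nu> has_real_derivative B t + z t * \<nu> t) (at t)"
    and B': "\<And>t. s \<le> t \<Longrightarrow> t < \<tau> \<Longrightarrow> (B has_real_derivative \<beta> * (\<nu> t)\<^sup>2) (at t)"
    and z_pos: "\<And>t. s \<le> t \<Longrightarrow> t < \<tau> \<Longrightarrow> 0 < z t"
    and \<nu>_pos: "\<And>t. s \<le> t \<Longrightarrow> t < \<tau> \<Longrightarrow> 0 < \<nu> t"
    and B_nonneg: "\<And>t. s \<le> t \<Longrightarrow> t < \<tau> \<Longrightarrow> 0 \<le> B t"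
    and z_top: "filterlim z at_top (at_left \<tau>)"
begin

lemma quadratic_dominates:
  assumes "0 < \<epsilon>"
  shows "\<forall>\<^sub>F t in at_left \<tau>. K * z t + L \<le> \<epsilon> * (z t)\<^sup>2"
proof -
  have "\<forall>\<^sub>F t in at_left \<tau>. max 1 ((\<bar>K\<bar> + \<bar>L\<bar>) / \<epsilon>) \<le> z t"
    using z_top unfolding filterlim_at_top by blast
  then show ?thesis
  proof (rule eventually_mono)
    fix t assume t: "max 1 ((\<bar>K\<bar> + \<bar>L\<bar>) / \<epsilon>) \<le> z t"
    have "L \<le> \<bar>L\<bar> * z t" using mult_left_mono[of 1 "z t" "\<bar>L\<bar>"] t by simp
    moreover have "K * z t \<le> \<bar>K\<bar> * z t" using t by (intro mult_right_mono) auto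
    ultimately have "K * z t + L \<le> \<bar>K\<bar> * z t + \<bar>L\<bar> * z t" by simp
    also have "\<dots> = (\<bar>K\<bar> + \<bar>L\<bar>) * z t" by (simp add: algebra_simps)
    also have "\<bar>K\<bar> + \<bar>L\<bar> \<le> \<epsilon> * z t" using t assms by (simp add: field_simps)
    finally show "K * z t + L \<le> \<epsilon> * (z t)\<^sup>2"
      using t by (simp add: power2_eq_square mult.assoc mult_right_mono)
  qed
qed

text \<open>\<open>B / \<nu> - \<beta> * z\<close> is nonincreasing, so
  \<open>B \<le> (\<beta> * z + C) * \<nu>\<close>; then \<open>\<nu>'\<close> is at most the
  derivative of a quadratic polynomial in \<open>z\<close>. Any finite constant serves to start the
  improvement.\<close>

lemma upper_rate: "\<exists>c>0. \<forall>\<^sub>F t in at_left \<tau>. \<nu> t \<le> c * (z t)\<^sup>2"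
proof -
  define C where "C = B s / \<nu> s - \<beta> * z s"
  have q: "B t \<le> (\<beta> * z t + C) * \<nu> t" if t: "s \<le> t" "t < \<tau>" for t
  proof -
    have "B t / \<nu> t - \<beta> * z t \<le> C" unfolding C_def
    proof (rule nonincreasing_of_derivative[of s t "\<lambda>t. B t / \<nu> t - \<beta> * z t"
          "\<lambda>t. (\<beta> * (\<nu> t)\<^sup>2 * \<nu> t - B t * (B t + z t * \<nu> t)) / (\<nu> t * \<nu> t) - \<beta> * \<nu> t"])
      fix u assume u: "s \<le> u" "u \<le> t"
      then have u': "u < \<tau>" using t by simp
      have n: "0 < \<nu> u" by (rule \<nu>_pos[OF u(1) u'])
      show "((\<lambda>t. B t / \<nu> t - \<beta> * z t) has_real_derivative
          (\<beta> * (\<nu> u)\<^sup>2 * \<nu> u - B u * (B u + z u * \<nu> u)) / (\<nu> u * \<nu> u) - \<beta> * \<nu> u) (at u)"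
        by (intro DERIV_diff DERIV_divide DERIV_cmult B' \<nu>' z' u u') (use n in simp)
      have "0 \<le> B u * (B u + z u * \<nu> u)"
        using B_nonneg[OF u(1) u'] z_pos[OF u(1) u'] n by (intro mult_nonneg_nonneg add_nonneg_nonneg) auto
      then have "(\<beta> * (\<nu> u)\<^sup>2 * \<nu> u - B u * (B u + z u * \<nu> u)) / (\<nu> u * \<nu> u) \<le> (\<beta> * (\<nu> u)\<^sup>2 * \<nu> u) / (\<nu> u * \<nu> u)"
        using n by (intro divide_right_mono) auto
      also have "\<dots> = \<beta> * \<nu> u" using n by (simp add: power2_eq_square)
      finally show "(\<beta> * (\<nu> u)\<^sup>2 * \<nu> u - B u * (B u + z u * \<nu> u)) / (\<nu> u * \<nu> u) - \<beta> * \<nu> u \<le> 0" by simp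
    qed (use t in auto)
    then have "B t / \<nu> t \<le> \<beta> * z t + C" by simp
    then show ?thesis using \<nu>_pos[OF t] by (simp add: pos_divide_le_eq)
  qed
  define L where "L = \<nu> s - ((\<beta> + 1) / 2 * (z s)\<^sup>2 + C * z s)"
  have le: "\<nu> t \<le> (\<beta> + 1) / 2 * (z t)\<^sup>2 + (C * z t + L)" if t: "s \<le> t" "t < \<tau>" for t
  proof -
    have "\<nu> t - ((\<beta> + 1) / 2 * (z t)\<^sup>2 + C * z t) \<le> L" unfolding L_def
    proof (rule nonincreasing_of_derivative[of s t "\<lambda>t. \<nu> t - ((\<beta> + 1) / 2 * (z t)\<^sup>2 + C * z t)"
          "\<lambda>t. B t + z t * \<nu> t - ((\<beta> + 1) * z t * \<nu> t + C * \<nu> t)"])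
      fix u assume u: "s \<le> u" "u \<le> t"
      then have u': "u < \<tau>" using t by simp
      show "((\<lambda>t. \<nu> t - ((\<beta> + 1) / 2 * (z t)\<^sup>2 + C * z t)) has_real_derivative
          B u + z u * \<nu> u - ((\<beta> + 1) * z u * \<nu> u + C * \<nu> u)) (at u)"
        by (auto intro!: derivative_eq_intros \<nu>'[OF u(1) u'] z'[OF u(1) u'])
      show "B u + z u * \<nu> u - ((\<beta> + 1) * z u * \<nu> u + C * \<nu> u) \<le> 0"
        using q[OF u(1) u'] by (simp add: algebra_simps)
    qed (use t in auto)
    then show ?thesis by simp
  qed
  show ?thesis
  proof (intro exI conjI)
    show "0 < (\<beta> + 1) / 2 + 1" using \<beta> by (intro add_nonneg_pos) auto
    show "\<forall>\<^sub>F t in at_left \<tau>. \<nu> t \<le> ((\<beta> + 1) / 2 + 1) * (z t)\<^sup>2"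
      using quadratic_dominates[of 1 C L, OF zero_less_one] eventually_at_left_from[OF s]
    proof eventually_elim
      case (elim t)
      have "\<nu> t \<le> (\<beta> + 1) / 2 * (z t)\<^sup>2 + 1 * (z t)\<^sup>2"
        using le[of t] elim by linarith
      then show ?case by (simp only: distrib_right)
    qed
  qed
qed

text \<open>\<open>\<nu> - z\<^sup>2 / 2\<close> has derivative \<open>B \<ge> 0\<close>; lowering
  the factor to \<open>1 / 4\<close> absorbs the constant of integration.\<close>

lemma lower_rate: "\<forall>\<^sub>F t in at_left \<tau>. 1 / 4 * (z t)\<^sup>2 \<le> \<nu> t"
proof -
  define L where "L = (z s)\<^sup>2 / 2 - \<nu> s"
  have le: "(z t)\<^sup>2 / 2 - L \<le> \<nu> t" if t: "s \<le> t" "t < \<tau>" for t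
  proof -
    have "\<nu> s - (z s)\<^sup>2 / 2 \<le> \<nu> t - (z t)\<^sup>2 / 2"
    proof (rule nondecreasing_of_derivative[of s t "\<lambda>t. \<nu> t - (z t)\<^sup>2 / 2" B])
      fix u assume u: "s \<le> u" "u \<le> t"
      then have u': "u < \<tau>" using t by simp
      show "((\<lambda>t. \<nu> t - (z t)\<^sup>2 / 2) has_real_derivative B u) (at u)"
        by (auto intro!: derivative_eq_intros \<nu>'[OF u(1) u'] z'[OF u(1) u'])
      show "0 \<le> B u" by (rule B_nonneg[OF u(1) u'])
    qed (use t in auto)
    then show ?thesis by (simp add: L_def)
  qed
  have "\<forall>\<^sub>F t in at_left \<tau>. 0 * z t + L \<le> 1 / 4 * (z t)\<^sup>2"
    by (rule quadratic_dominates) simp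
  then show ?thesis
    using eventually_at_left_from[OF s]
  proof eventually_elim
    case (elim t)
    then show ?case using le[of t] by simp
  qed
qed

text \<open>\<open>B' = \<beta> * \<nu>\<^sup>2 \<le> \<beta> * c * z\<^sup>2 * \<nu>\<close>
  integrates to \<open>B \<le> \<beta> * c / 3 * z ^ 3 + C\<close>. The lower rate trades
  \<open>z ^ 3\<close> for \<open>z * \<nu> / b\<close>, after which
  \<open>\<nu>' = B + z * \<nu>\<close> integrates to a multiple of \<open>z\<^sup>2\<close>;
  \<open>\<epsilon>\<close> absorbs the lower order terms.\<close>

lemma improve_upper:
  assumes b: "0 < b" and c: "0 < c" and ev: "\<forall>\<^sub>F t in at_left \<tau>. b * (z t)\<^sup>2 \<le> \<nu> t" "\<forall>\<^sub>F t in at_left \<tau>. \<nu> t \<le> c * (z t)\<^sup>2"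
    and \<epsilon>: "0 < \<epsilon>"
  shows "\<forall>\<^sub>F t in at_left \<tau>. \<nu> t \<le> (1 / 2 + \<beta> * c / (6 * b) + \<epsilon>) * (z t)\<^sup>2"
proof -
  have "\<forall>\<^sub>F t in at_left \<tau>. 1 \<le> z t" using z_top unfolding filterlim_at_top by blast
  with ev have "\<forall>\<^sub>F t in at_left \<tau>. b * (z t)\<^sup>2 \<le> \<nu> t \<and> \<nu> t \<le> c * (z t)\<^sup>2 \<and> 1 \<le> z t \<and> s \<le> t"
    using eventually_at_left_from[OF s] by eventually_elim auto
  then obtain r where r: "r < \<tau>" and R: "\<And>t. r \<le> t \<Longrightarrow> t < \<tau> \<Longrightarrow> b * (z t)\<^sup>2 \<le> \<nu> t \<and> \<nu> t \<le> c * (z t)\<^sup>2 \<and> 1 \<le> z t \<and> s \<le> t"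
    by (rule eventually_at_left_interval) blast
  define C where "C = B r"
  have C: "0 \<le> C" unfolding C_def using R[of r] r by (intro B_nonneg) auto
  have B_le: "B t \<le> \<beta> * c / 3 * z t ^ 3 + C" if t: "r \<le> t" "t < \<tau>" for t
  proof -
    have "B t - \<beta> * c / 3 * z t ^ 3 \<le> B r - \<beta> * c / 3 * z r ^ 3"
    proof (rule nonincreasing_of_derivative[of r t "\<lambda>t. B t - \<beta> * c / 3 * z t ^ 3" "\<lambda>t. \<beta> * (\<nu> t)\<^sup>2 - \<beta> * c * (z t)\<^sup>2 * \<nu> t"])
      fix u assume u: "r \<le> u" "u \<le> t"
      then have u': "u < \<tau>" "s \<le> u" using t R[of u] by auto
      show "((\<lambda>t. B t - \<beta> * c / 3 * z t ^ 3) has_real_derivative \<beta> * (\<nu> u)\<^sup>2 - \<beta> * c * (z u)\<^sup>2 * \<nu> u) (at u)"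
        by (auto intro!: derivative_eq_intros B'[OF u'(2,1)] z'[OF u'(2,1)])
      have "\<beta> * \<nu> u * \<nu> u \<le> \<beta> * \<nu> u * (c * (z u)\<^sup>2)"
        using R[OF u(1) u'(1)] \<beta> \<nu>_pos[OF u'(2,1)] by (intro mult_left_mono) auto
      then show "\<beta> * (\<nu> u)\<^sup>2 - \<beta> * c * (z u)\<^sup>2 * \<nu> u \<le> 0" by (simp add: power2_eq_square mult_ac)
    qed (use t in auto)
    moreover have "0 \<le> \<beta> * c / 3 * z r ^ 3" using \<beta> c R[of r] r by (intro mult_nonneg_nonneg) auto
    ultimately show ?thesis by (simp add: C_def)
  qed
  define k where "k = 1 / 2 + \<beta> * c / (6 * b)"
  define L where "L = \<nu> r - (k * (z r)\<^sup>2 + C / b * z r)"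
  have le: "\<nu> t \<le> k * (z t)\<^sup>2 + (C / b * z t + L)" if t: "r \<le> t" "t < \<tau>" for t
  proof -
    have "\<nu> t - (k * (z t)\<^sup>2 + C / b * z t) \<le> L" unfolding L_def
    proof (rule nonincreasing_of_derivative[of r t "\<lambda>t. \<nu> t - (k * (z t)\<^sup>2 + C / b * z t)"
          "\<lambda>t. B t + z t * \<nu> t - (2 * k * z t * \<nu> t + C / b * \<nu> t)"])
      fix u assume u: "r \<le> u" "u \<le> t"
      then have u': "u < \<tau>" "s \<le> u" using t R[of u] by auto
      note Ru = R[OF u(1) u'(1)]
      show "((\<lambda>t. \<nu> t - (k * (z t)\<^sup>2 + C / b * z t)) has_real_derivative
          B u + z u * \<nu> u - (2 * k * z u * \<nu> u + C / b * \<nu> u)) (at u)"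
        using b by (auto intro!: derivative_eq_intros \<nu>'[OF u'(2,1)] z'[OF u'(2,1)])
      have "\<beta> * c / 3 * z u ^ 3 = \<beta> * c / (3 * b) * z u * (b * (z u)\<^sup>2)"
        using b by (simp add: power2_eq_square power3_eq_cube)
      also have "\<dots> \<le> \<beta> * c / (3 * b) * z u * \<nu> u"
        using Ru \<beta> c b by (intro mult_left_mono) auto
      finally have 1: "\<beta> * c / 3 * z u ^ 3 \<le> \<beta> * c / (3 * b) * z u * \<nu> u" .
      have "1 \<le> (z u)\<^sup>2" using Ru by (simp add: one_le_power)
      then have "b * 1 \<le> \<nu> u" using Ru mult_left_mono[of 1 "(z u)\<^sup>2" b] b by linarith
      then have "C / b * b \<le> C / b * \<nu> u" using C b by (intro mult_left_mono) auto
      then have 2: "C \<le> C / b * \<nu> u" using b by simp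
      have "2 * k * z u * \<nu> u = z u * \<nu> u + \<beta> * c / (3 * b) * z u * \<nu> u"
        by (simp add: k_def algebra_simps)
      then show "B u + z u * \<nu> u - (2 * k * z u * \<nu> u + C / b * \<nu> u) \<le> 0"
        using 1 2 B_le[OF u(1) u'(1)] by linarith
    qed (use t in auto)
    then show ?thesis by simp
  qed
  show ?thesis
    using quadratic_dominates[OF \<epsilon>, of "C / b" L] eventually_at_left_from[OF r]
  proof eventually_elim
    case (elim t)
    have "\<nu> t \<le> k * (z t)\<^sup>2 + \<epsilon> * (z t)\<^sup>2" using le[of t] elim by linarith
    then show ?case by (simp only: k_def distrib_right)
  qed
qed

text \<open>The mirror image of \<open>improve_upper\<close>: here \<open>b\<close> bounds
  \<open>B\<close> from below by a cubic in \<open>z\<close>, and \<open>c\<close> trades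
  \<open>z ^ 3\<close> for \<open>z * \<nu> / c\<close>.\<close>

lemma improve_lower:
  assumes b: "0 < b" and c: "0 < c" and ev: "\<forall>\<^sub>F t in at_left \<tau>. b * (z t)\<^sup>2 \<le> \<nu> t" "\<forall>\<^sub>F t in at_left \<tau>. \<nu> t \<le> c * (z t)\<^sup>2"
    and \<epsilon>: "0 < \<epsilon>"
  shows "\<forall>\<^sub>F t in at_left \<tau>. (1 / 2 + \<beta> * b / (6 * c) - \<epsilon>) * (z t)\<^sup>2 \<le> \<nu> t"
proof -
  have "\<forall>\<^sub>F t in at_left \<tau>. 1 \<le> z t" using z_top unfolding filterlim_at_top by blast
  with ev have "\<forall>\<^sub>F t in at_left \<tau>. b * (z t)\<^sup>2 \<le> \<nu> t \<and> \<nu> t \<le> c * (z t)\<^sup>2 \<and> 1 \<le> z t \<and> s \<le> t"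
    using eventually_at_left_from[OF s] by eventually_elim auto
  then obtain r where r: "r < \<tau>" and R: "\<And>t. r \<le> t \<Longrightarrow> t < \<tau> \<Longrightarrow> b * (z t)\<^sup>2 \<le> \<nu> t \<and> \<nu> t \<le> c * (z t)\<^sup>2 \<and> 1 \<le> z t \<and> s \<le> t"
    by (rule eventually_at_left_interval) blast
  define C where "C = \<beta> * b / 3 * z r ^ 3"
  have C: "0 \<le> C" unfolding C_def using R[of r] r \<beta> b by (intro mult_nonneg_nonneg) auto
  have B_ge: "\<beta> * b / 3 * z t ^ 3 - C \<le> B t" if t: "r \<le> t" "t < \<tau>" for t
  proof -
    have "B r - \<beta> * b / 3 * z r ^ 3 \<le> B t - \<beta> * b / 3 * z t ^ 3"
    proof (rule nondecreasing_of_derivative[of r t "\<lambda>t. B t - \<beta> * b / 3 * z t ^ 3" "\<lambda>t. \<beta> * (\<nu> t)\<^sup>2 - \<beta> * b * (z t)\<^sup>2 * \<nu> t"])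
      fix u assume u: "r \<le> u" "u \<le> t"
      then have u': "u < \<tau>" "s \<le> u" using t R[of u] by auto
      show "((\<lambda>t. B t - \<beta> * b / 3 * z t ^ 3) has_real_derivative \<beta> * (\<nu> u)\<^sup>2 - \<beta> * b * (z u)\<^sup>2 * \<nu> u) (at u)"
        by (auto intro!: derivative_eq_intros B'[OF u'(2,1)] z'[OF u'(2,1)])
      have "\<beta> * \<nu> u * (b * (z u)\<^sup>2) \<le> \<beta> * \<nu> u * \<nu> u"
        using R[OF u(1) u'(1)] \<beta> \<nu>_pos[OF u'(2,1)] by (intro mult_left_mono) auto
      then show "0 \<le> \<beta> * (\<nu> u)\<^sup>2 - \<beta> * b * (z u)\<^sup>2 * \<nu> u" by (simp add: power2_eq_square mult_ac)
    qed (use t in auto)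
    moreover have "0 \<le> B r" using R[of r] r by (intro B_nonneg) auto
    ultimately show ?thesis by (simp add: C_def)
  qed
  define k where "k = 1 / 2 + \<beta> * b / (6 * c)"
  define L where "L = k * (z r)\<^sup>2 - C / b * z r - \<nu> r"
  have le: "k * (z t)\<^sup>2 - (C / b * z t + L) \<le> \<nu> t" if t: "r \<le> t" "t < \<tau>" for t
  proof -
    have "- L \<le> \<nu> t - (k * (z t)\<^sup>2 - C / b * z t)"
    proof -
      have "\<nu> r - (k * (z r)\<^sup>2 - C / b * z r) \<le> \<nu> t - (k * (z t)\<^sup>2 - C / b * z t)"
      proof (rule nondecreasing_of_derivative[of r t "\<lambda>t. \<nu> t - (k * (z t)\<^sup>2 - C / b * z t)"
            "\<lambda>t. B t + z t * \<nu> t - (2 * k * z t * \<nu> t - C / b * \<nu> t)"])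
        fix u assume u: "r \<le> u" "u \<le> t"
        then have u': "u < \<tau>" "s \<le> u" using t R[of u] by auto
        note Ru = R[OF u(1) u'(1)]
        show "((\<lambda>t. \<nu> t - (k * (z t)\<^sup>2 - C / b * z t)) has_real_derivative
            B u + z u * \<nu> u - (2 * k * z u * \<nu> u - C / b * \<nu> u)) (at u)"
          using b by (auto intro!: derivative_eq_intros \<nu>'[OF u'(2,1)] z'[OF u'(2,1)])
        have "\<beta> * b / (3 * c) * z u * \<nu> u \<le> \<beta> * b / (3 * c) * z u * (c * (z u)\<^sup>2)"
          using Ru \<beta> c b by (intro mult_left_mono) auto
        also have "\<dots> = \<beta> * b / 3 * z u ^ 3"
          using c by (simp add: power2_eq_square power3_eq_cube)
        finally have 1: "\<beta> * b / (3 * c) * z u * \<nu> u \<le> \<beta> * b / 3 * z u ^ 3" .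
        have "1 \<le> (z u)\<^sup>2" using Ru by (simp add: one_le_power)
        then have "b * 1 \<le> \<nu> u" using Ru mult_left_mono[of 1 "(z u)\<^sup>2" b] b by linarith
        then have "C / b * b \<le> C / b * \<nu> u" using C b by (intro mult_left_mono) auto
        then have 2: "C \<le> C / b * \<nu> u" using b by simp
        have "2 * k * z u * \<nu> u = z u * \<nu> u + \<beta> * b / (3 * c) * z u * \<nu> u"
          by (simp add: k_def algebra_simps)
        then show "0 \<le> B u + z u * \<nu> u - (2 * k * z u * \<nu> u - C / b * \<nu> u)"
          using 1 2 B_ge[OF u(1) u'(1)] by linarith
      qed (use t in auto)
      then show ?thesis by (simp add: L_def)
    qed
    then show ?thesis by simp
  qed
  show ?thesis
    using quadratic_dominates[OF \<epsilon>, of "C / b" L] eventually_at_left_from[OF r]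
  proof eventually_elim
    case (elim t)
    have "k * (z t)\<^sup>2 - \<epsilon> * (z t)\<^sup>2 \<le> \<nu> t" using le[of t] elim by linarith
    then show ?case by (simp only: k_def left_diff_distrib)
  qed
qed

lemma rate: "((\<lambda>t. \<nu> t / (z t)\<^sup>2) \<longlongrightarrow> (3 + \<beta>) / 6) (at_left \<tau>)"
proof -
  define Up where "Up = {c. \<forall>\<^sub>F t in at_left \<tau>. \<nu> t \<le> c * (z t)\<^sup>2}"
  define Lo where "Lo = {b. \<forall>\<^sub>F t in at_left \<tau>. b * (z t)\<^sup>2 \<le> \<nu> t}"
  have LoUp: "b \<le> c" if "b \<in> Lo" "c \<in> Up" for b c
  proof -
    have "\<forall>\<^sub>F t in at_left \<tau>. b * (z t)\<^sup>2 \<le> c * (z t)\<^sup>2 \<and> 0 < z t"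
      using that eventually_at_left_from[OF s] unfolding Lo_def Up_def mem_Collect_eq
      by eventually_elim (use z_pos in force)
    then have "\<exists>t. b * (z t)\<^sup>2 \<le> c * (z t)\<^sup>2 \<and> 0 < z t"
      by (rule eventually_happens'[OF trivial_limit_at_left_real])
    then show ?thesis by (auto simp: mult_le_cancel_right)
  qed
  obtain c0 where c0: "c0 \<in> Up" using upper_rate by (auto simp: Up_def)
  have b0: "1 / 4 \<in> Lo" using lower_rate by (simp add: Lo_def)
  \<comment> \<open>\<open>hi\<close> and \<open>lo\<close> are the upper and lower limits of
    \<open>\<nu> / z\<^sup>2\<close>, expressed through eventual bounds.\<close>
  define hi where "hi = Inf Up"
  define lo where "lo = Sup Lo"
  have bddU: "bdd_below Up" using LoUp[OF b0] by (rule bdd_belowI)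
  have bddL: "bdd_above Lo" using LoUp[OF _ c0] by (auto simp: bdd_above_def)
  have lo4: "1 / 4 \<le> lo" unfolding lo_def using b0 bddL by (rule cSup_upper)
  have lohi: "lo \<le> hi" unfolding lo_def hi_def using LoUp b0 c0
    by (intro cSup_least cInf_greatest) auto
  have upI: "hi + \<delta> \<in> Up" if \<delta>: "0 < \<delta>" for \<delta>
  proof -
    obtain c where c: "c \<in> Up" "c < hi + \<delta>"
      using cInf_lessD[of Up "hi + \<delta>"] c0 \<delta> unfolding hi_def by auto
    then have "\<forall>\<^sub>F t in at_left \<tau>. \<nu> t \<le> c * (z t)\<^sup>2" by (simp add: Up_def)
    then have "\<forall>\<^sub>F t in at_left \<tau>. \<nu> t \<le> (hi + \<delta>) * (z t)\<^sup>2"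
      by (rule eventually_mono) (use c(2) in \<open>auto elim!: order_trans intro!: mult_right_mono\<close>)
    then show ?thesis by (simp add: Up_def)
  qed
  have loI: "lo - \<delta> \<in> Lo" if \<delta>: "0 < \<delta>" for \<delta>
  proof -
    obtain b where b: "b \<in> Lo" "lo - \<delta> < b"
      using less_cSupD[of Lo "lo - \<delta>"] b0 \<delta> unfolding lo_def by auto
    then have "\<forall>\<^sub>F t in at_left \<tau>. b * (z t)\<^sup>2 \<le> \<nu> t" by (simp add: Lo_def)
    then have "\<forall>\<^sub>F t in at_left \<tau>. (lo - \<delta>) * (z t)\<^sup>2 \<le> \<nu> t"
      by (rule eventually_mono) (use b(2) in \<open>auto intro: order_trans[rotated] intro!: mult_right_mono\<close>)
    then show ?thesis by (simp add: Lo_def)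
  qed
  \<comment> \<open>As \<open>lo \<ge> 1 / 4\<close>, a \<open>\<delta>\<close> below
    \<open>1 / 8\<close> keeps \<open>lo - \<delta>\<close> positive.\<close>
  have small: "\<forall>\<^sub>F \<delta> in at_right 0. 0 < \<delta> \<and> \<delta> < (1 / 8 :: real)"
    using eventually_at_right_real[of 0 "1 / 8 :: real"] by (auto elim!: eventually_mono)
  have 1: "hi \<le> 1 / 2 + \<beta> * hi / (6 * lo)"
  proof -
    have "((\<lambda>\<delta>. 1 / 2 + \<beta> * (hi + \<delta>) / (6 * (lo - \<delta>)) + \<delta>) \<longlongrightarrow> 1 / 2 + \<beta> * (hi + 0) / (6 * (lo - 0)) + 0) (at_right 0)"
      using lo4 by (intro tendsto_intros) auto
    moreover have "\<forall>\<^sub>F \<delta> in at_right 0. hi \<le> 1 / 2 + \<beta> * (hi + \<delta>) / (6 * (lo - \<delta>)) + \<delta>"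
      using small
    proof (rule eventually_mono)
      fix \<delta> :: real assume \<delta>: "0 < \<delta> \<and> \<delta> < 1 / 8"
      have "1 / 2 + \<beta> * (hi + \<delta>) / (6 * (lo - \<delta>)) + \<delta> \<in> Up"
        unfolding Up_def mem_Collect_eq
        using upI[of \<delta>] loI[of \<delta>] \<delta> lo4 lohi by (intro improve_upper) (auto simp: Up_def Lo_def)
      then show "hi \<le> 1 / 2 + \<beta> * (hi + \<delta>) / (6 * (lo - \<delta>)) + \<delta>"
        unfolding hi_def using bddU by (rule cInf_lower)
    qed
    ultimately have "hi \<le> 1 / 2 + \<beta> * (hi + 0) / (6 * (lo - 0)) + 0"
      by (rule tendsto_lowerbound) simp
    then show ?thesis by simp
  qed
  have 2: "1 / 2 + \<beta> * lo / (6 * hi) \<le> lo"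
  proof -
    have "((\<lambda>\<delta>. 1 / 2 + \<beta> * (lo - \<delta>) / (6 * (hi + \<delta>)) - \<delta>) \<longlongrightarrow> 1 / 2 + \<beta> * (lo - 0) / (6 * (hi + 0)) - 0) (at_right 0)"
      using lo4 lohi by (intro tendsto_intros) auto
    moreover have "\<forall>\<^sub>F \<delta> in at_right 0. 1 / 2 + \<beta> * (lo - \<delta>) / (6 * (hi + \<delta>)) - \<delta> \<le> lo"
      using small
    proof (rule eventually_mono)
      fix \<delta> :: real assume \<delta>: "0 < \<delta> \<and> \<delta> < 1 / 8"
      have "1 / 2 + \<beta> * (lo - \<delta>) / (6 * (hi + \<delta>)) - \<delta> \<in> Lo"
        unfolding Lo_def mem_Collect_eq
        using upI[of \<delta>] loI[of \<delta>] \<delta> lo4 lohi by (intro improve_lower) (auto simp: Up_def Lo_def)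
      then show "1 / 2 + \<beta> * (lo - \<delta>) / (6 * (hi + \<delta>)) - \<delta> \<le> lo"
        unfolding lo_def using bddL by (rule cSup_upper)
    qed
    ultimately have "1 / 2 + \<beta> * (lo - 0) / (6 * (hi + 0)) - 0 \<le> lo"
      by (rule tendsto_upperbound) simp
    then show ?thesis by simp
  qed
  have lop: "0 < lo" "0 < hi" using lo4 lohi by auto
  have hi_le: "6 * lo * hi \<le> 3 * lo + \<beta> * hi"
    using mult_left_mono[OF 1, of "6 * lo"] lop by (simp add: algebra_simps)
  have lo_ge: "3 * hi + \<beta> * lo \<le> 6 * lo * hi"
    using mult_left_mono[OF 2, of "6 * hi"] lop by (simp add: algebra_simps)
  \<comment> \<open>Subtraction cancels the product \<open>6 * lo * hi\<close> and leaves a linear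
    inequality that forces \<open>hi = lo\<close>; the product equation then determines the common
    value.\<close>
  have "(3 - \<beta>) * (hi - lo) \<le> 0" using hi_le lo_ge by (simp add: algebra_simps)
  then have eq: "hi = lo" using \<beta> lohi by (simp add: mult_le_0_iff)
  have "lo * (6 * lo) = lo * (3 + \<beta>)" using hi_le lo_ge unfolding eq by (simp add: algebra_simps)
  then have lo_eq: "lo = (3 + \<beta>) / 6" using lop by simp
  have "((\<lambda>t. \<nu> t / (z t)\<^sup>2) \<longlongrightarrow> lo) (at_left \<tau>)"
  proof (rule tendstoI)
    fix e :: real assume e: "0 < e"
    have "\<forall>\<^sub>F t in at_left \<tau>. \<nu> t \<le> (lo + e / 2) * (z t)\<^sup>2" "\<forall>\<^sub>F t in at_left \<tau>. (lo - e / 2) * (z t)\<^sup>2 \<le> \<nu> t"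
      using upI[of "e / 2"] loI[of "e / 2"] e eq by (auto simp: Up_def Lo_def)
    then show "\<forall>\<^sub>F t in at_left \<tau>. dist (\<nu> t / (z t)\<^sup>2) lo < e"
      using eventually_at_left_from[OF s]
    proof eventually_elim
      case (elim t)
      then have zp: "0 < (z t)\<^sup>2" using z_pos[of t] by simp
      have "\<nu> t / (z t)\<^sup>2 \<le> lo + e / 2" "lo - e / 2 \<le> \<nu> t / (z t)\<^sup>2"
        using elim(1,2) zp by (simp_all add: pos_divide_le_eq pos_le_divide_eq)
      then show ?case using e by (simp add: dist_real_def abs_less_iff)
    qed
  qed
  then show ?thesis by (simp add: lo_eq)
qed

text \<open>The derivative of \<open>1 / z\<close> is \<open>- \<nu> / z\<^sup>2\<close>, so the
  limit \<open>rate\<close> turns into the slope of \<open>1 / z\<close> at \<open>\<tau>\<close> by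
  de l'Hopital's rule.\<close>

lemma pole: "((\<lambda>t. z t * (\<tau> - t)) \<longlongrightarrow> 6 / (3 + \<beta>)) (at_left \<tau>)"
proof -
  have "((\<lambda>t. inverse (z t) / (\<tau> - t)) \<longlongrightarrow> (3 + \<beta>) / 6) (at_left \<tau>)"
  proof (rule lhopital_left[where f' = "\<lambda>t. - (\<nu> t / (z t)\<^sup>2)" and g' = "\<lambda>t. - 1"])
    show "((\<lambda>t. inverse (z t)) \<longlongrightarrow> 0) (at_left \<tau>)"
      by (rule tendsto_inverse_0_at_top[OF z_top])
    have "((\<lambda>t. \<tau> - t) \<longlongrightarrow> \<tau> - \<tau>) (at_left \<tau>)" by (intro tendsto_intros)
    then show "((\<lambda>t. \<tau> - t) \<longlongrightarrow> 0) (at_left \<tau>)" by simp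
    show "\<forall>\<^sub>F t in at_left \<tau>. \<tau> - t \<noteq> 0"
      using eventually_at_left_from[OF s] by (rule eventually_mono) auto
    show "\<forall>\<^sub>F t in at_left \<tau>. ((\<lambda>t. inverse (z t)) has_real_derivative - (\<nu> t / (z t)\<^sup>2)) (at t)"
      using eventually_at_left_from[OF s]
    proof (rule eventually_mono)
      fix t assume t: "s \<le> t \<and> t < \<tau>"
      then have "z t \<noteq> 0" using z_pos[of t] by auto
      then show "((\<lambda>t. inverse (z t)) has_real_derivative - (\<nu> t / (z t)\<^sup>2)) (at t)"
        using DERIV_inverse_fun[OF z'[of t]] t by (simp add: divide_inverse power2_eq_square mult_ac)
    qed
    show "\<forall>\<^sub>F t in at_left \<tau>. ((\<lambda>t. \<tau> - t) has_real_derivative - 1) (at t)"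
      by (auto intro!: always_eventually derivative_eq_intros)
    show "((\<lambda>t. - (\<nu> t / (z t)\<^sup>2) / - 1) \<longlongrightarrow> (3 + \<beta>) / 6) (at_left \<tau>)"
      using rate by simp
  qed auto
  then have "((\<lambda>t. inverse (inverse (z t) / (\<tau> - t))) \<longlongrightarrow> inverse ((3 + \<beta>) / 6)) (at_left \<tau>)"
    using \<beta> by (intro tendsto_inverse) auto
  moreover have "inverse (inverse x / y) = x * y" for x y :: real by (simp add: divide_inverse)
  moreover have "inverse ((3 + \<beta>) / 6) = 6 / (3 + \<beta>)" by simp
  ultimately show ?thesis by (simp only:)
qed

end

section \<open>Lifetime and pole of the continued solution\<close>

context maximal_front
begin

sublocale left: rising_front a \<beta> 0 f v B by (rule rising)

lemma front_beyond:
  assumes "ereal t < T"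
  obtains S where "t < S" "front a \<beta> S f v B"
  using ereal_dense2[OF assms] fronts by (metis less_ereal.simps(1) less_imp_le)

lemma fT': "ereal t < T \<Longrightarrow> (f has_real_derivative v t) (at t)"
  and vT': "ereal t < T \<Longrightarrow> (v has_real_derivative - f t * v t - B t) (at t)"
  and BT': "ereal t < T \<Longrightarrow> (B has_real_derivative \<beta> * (v t)\<^sup>2) (at t)"
  by (erule front_beyond; erule front.f' front.v' front.B'; assumption)+

lemma less_T: "s \<le> t \<Longrightarrow> ereal t < T \<Longrightarrow> ereal s < T"
  by (meson ereal_less_eq(3) le_less_trans)

lemma BT_nonneg: "ereal t < T \<Longrightarrow> 0 \<le> B t"
  by (erule front_beyond, erule front.B_nonneg, assumption)

lemma BT_mono: "s \<le> t \<Longrightarrow> ereal t < T \<Longrightarrow> B s \<le> B t"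
  by (erule front_beyond, erule front.B_mono, assumption+)

lemma contT: "ereal t < T \<Longrightarrow> continuous_on {s..t} f" "ereal t < T \<Longrightarrow> continuous_on {s..t} v"
    "ereal t < T \<Longrightarrow> continuous_on {s..t} B"
  by (auto intro!: continuous_at_imp_continuous_on DERIV_isCont[OF fT'] DERIV_isCont[OF vT'] DERIV_isCont[OF BT']
      intro: less_T)

lemma B_0_pos: "0 < \<beta> \<Longrightarrow> 0 < B 0"
proof -
  assume b: "0 < \<beta>"
  have "ereal 0 < T" using T_pos by (simp add: zero_ereal_def)
  then obtain S where "0 < S" "front a \<beta> S f v B" by (rule front_beyond)
  then show ?thesis using front.B_pos[of a \<beta> S f v B 0 "-1"] b left.f_gt[of "-1"] by auto
qed

lemma T_finite:
  assumes "0 < \<beta>"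
  obtains \<tau> where "T = ereal \<tau>" "0 < \<tau>"
proof -
  have "T \<noteq> \<infinity>"
  proof
    assume "T = \<infinity>"
    then have t: "ereal t < T" for t by simp
    show False
      by (rule no_global_descent[of f v B "B 0"]) (use fT' vT' BT_mono B_0_pos[OF assms] t in auto)
  qed
  then show ?thesis using T_pos that by (cases T) auto
qed

lemma v_neg_after:
  assumes "0 < \<beta>" "v s \<le> 0" "0 \<le> s" "s < t" "ereal t < T"
  shows "v t < 0"
proof (rule linear_ode_neg[OF assms(4) contT(1)[OF assms(5)], where x = v and b = B])
  fix u assume "s < u" "u < t"
  then show "0 < B u"
    using BT_mono[of 0 u] B_0_pos[OF assms(1)] less_T[of u t] assms by auto
qed (use assms vT' less_T in auto)

context
  fixes \<tau> assumes \<beta>_pos: "0 < \<beta>" and T: "T = ereal \<tau>"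
begin

lemma \<tau>_pos: "0 < \<tau>" using T_pos T by simp

lemma bounded_imp_False:
  assumes "0 \<le> s" "s < \<tau>" "\<And>t. s \<le> t \<Longrightarrow> t < \<tau> \<Longrightarrow> \<bar>f t\<bar> \<le> K \<and> \<bar>v t\<bar> \<le> K \<and> \<bar>B t\<bar> \<le> K"
  shows False
proof -
  have sT: "ereal s < T" using assms T by simp
  obtain K1 where K1: "0 \<le> K1" "\<And>x. 0 \<le> x \<Longrightarrow> x \<le> s \<Longrightarrow> \<bar>f x\<bar> \<le> K1" using bounded_on_Icc[OF contT(1)[OF sT]] by blast
  obtain K2 where K2: "0 \<le> K2" "\<And>x. 0 \<le> x \<Longrightarrow> x \<le> s \<Longrightarrow> \<bar>v x\<bar> \<le> K2" using bounded_on_Icc[OF contT(2)[OF sT]] by blast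
  obtain K3 where K3: "0 \<le> K3" "\<And>x. 0 \<le> x \<Longrightarrow> x \<le> s \<Longrightarrow> \<bar>B x\<bar> \<le> K3" using bounded_on_Icc[OF contT(3)[OF sT]] by blast
  have K: "0 \<le> K" using assms(3)[of s] assms(2) by auto
  have "T = \<infinity>"
  proof (rule unbounded)
    fix t assume t: "0 \<le> t" "ereal t < T"
    show "\<bar>f t\<bar> \<le> K + K1 + K2 + K3 \<and> \<bar>v t\<bar> \<le> K + K1 + K2 + K3 \<and> \<bar>B t\<bar> \<le> K + K1 + K2 + K3"
    proof (cases "t \<le> s")
      case True
      then show ?thesis using K K1(1) K2(1) K3(1) K1(2)[OF t(1) True] K2(2)[OF t(1) True] K3(2)[OF t(1) True] by auto
    next
      case False
      then show ?thesis using K1(1) K2(1) K3(1) assms(3)[of t] t T by auto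
    qed
  qed
  then show False using T by simp
qed

text \<open>If \<open>v\<close> stayed positive, \<open>f\<close> would be nonnegative and
  \<open>v\<close> nonincreasing, so all components would remain bounded on the finite interval,
  against maximality.\<close>

lemma ex_v_nonpos: "\<exists>s. 0 \<le> s \<and> s < \<tau> \<and> v s \<le> 0"
proof (rule ccontr)
  assume "\<not> (\<exists>s. 0 \<le> s \<and> s < \<tau> \<and> v s \<le> 0)"
  then have vp: "0 < v t" if "0 \<le> t" "t < \<tau>" for t using that by force
  have tT: "ereal t < T" if "t < \<tau>" for t using that T by simp
  have fp: "0 \<le> f t" if t: "0 \<le> t" "t < \<tau>" for t
    using nondecreasing_of_derivative[of 0 t f v] fT' vp t tT f_0 by (force intro: less_imp_le)
  have vle: "v t \<le> v 0" if t: "0 \<le> t" "t < \<tau>" for t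
  proof (rule nonincreasing_of_derivative[of 0 t v "\<lambda>t. - f t * v t - B t"])
    fix u assume u: "0 \<le> u" "u \<le> t"
    then have u': "u < \<tau>" using t by simp
    show "(v has_real_derivative - f u * v u - B u) (at u)" using vT' tT u' by simp
    have "0 \<le> f u * v u" using fp[OF u(1) u'] vp[OF u(1) u'] by simp
    then show "- f u * v u - B u \<le> 0" using BT_nonneg[OF tT[OF u']] by simp
  qed (use t in auto)
  have fle: "f t \<le> v 0 * \<tau>" if t: "0 \<le> t" "t < \<tau>" for t
  proof -
    have "f t - v 0 * t \<le> f 0 - v 0 * 0"
      by (rule nonincreasing_of_derivative[of 0 t "\<lambda>t. f t - v 0 * t" "\<lambda>t. v t - v 0"])
        (use t vle tT fT' in \<open>auto intro!: derivative_eq_intros\<close>)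
    moreover have "v 0 * t \<le> v 0 * \<tau>" using vp[of 0] t by (intro mult_left_mono) auto
    ultimately show ?thesis using f_0 by simp
  qed
  have Ble: "B t \<le> B 0 + \<beta> * (v 0)\<^sup>2 * \<tau>" if t: "0 \<le> t" "t < \<tau>" for t
  proof -
    have "B t - \<beta> * (v 0)\<^sup>2 * t \<le> B 0 - \<beta> * (v 0)\<^sup>2 * 0"
    proof (rule nonincreasing_of_derivative[of 0 t "\<lambda>t. B t - \<beta> * (v 0)\<^sup>2 * t" "\<lambda>t. \<beta> * (v t)\<^sup>2 - \<beta> * (v 0)\<^sup>2"])
      fix u assume u: "0 \<le> u" "u \<le> t"
      then have u': "u < \<tau>" using t by simp
      show "((\<lambda>t. B t - \<beta> * (v 0)\<^sup>2 * t) has_real_derivative \<beta> * (v u)\<^sup>2 - \<beta> * (v 0)\<^sup>2) (at u)"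
        using BT'[OF tT[OF u']] by (auto intro!: derivative_eq_intros)
      have "(v u)\<^sup>2 \<le> (v 0)\<^sup>2" using vle[OF u(1) u'] vp[OF u(1) u'] by (intro power_mono) auto
      then show "\<beta> * (v u)\<^sup>2 - \<beta> * (v 0)\<^sup>2 \<le> 0" using \<beta>_pos by simp
    qed (use t in auto)
    moreover have "\<beta> * (v 0)\<^sup>2 * t \<le> \<beta> * (v 0)\<^sup>2 * \<tau>" using \<beta>_pos t by (intro mult_left_mono) auto
    ultimately show ?thesis by simp
  qed
  have nn: "0 \<le> v 0 * \<tau>" "0 \<le> v 0" "0 \<le> B 0 + \<beta> * (v 0)\<^sup>2 * \<tau>"
    using fle[of 0] f_0 \<tau>_pos vp[of 0] Ble[of 0] B_0_pos[OF \<beta>_pos] by auto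
  show False
  proof (rule bounded_imp_False[of 0])
    fix t assume t: "0 \<le> t" "t < \<tau>"
    have "0 \<le> B t" using BT_nonneg[OF tT[OF t(2)]] .
    then show "\<bar>f t\<bar> \<le> v 0 * \<tau> + v 0 + (B 0 + \<beta> * (v 0)\<^sup>2 * \<tau>) \<and>
        \<bar>v t\<bar> \<le> v 0 * \<tau> + v 0 + (B 0 + \<beta> * (v 0)\<^sup>2 * \<tau>) \<and> \<bar>B t\<bar> \<le> v 0 * \<tau> + v 0 + (B 0 + \<beta> * (v 0)\<^sup>2 * \<tau>)"
      using nn fp[OF t] fle[OF t] vp[OF t] vle[OF t] Ble[OF t] by auto
  qed (use \<tau>_pos in auto)
qed

lemma v_neg_near: obtains s where "0 \<le> s" "s < \<tau>" "\<And>t. s \<le> t \<Longrightarrow> t < \<tau> \<Longrightarrow> v t < 0"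
proof -
  obtain r where r: "0 \<le> r" "r < \<tau>" "v r \<le> 0" using ex_v_nonpos by blast
  show ?thesis
    by (rule that[of "(r + \<tau>) / 2"]) (use r v_neg_after[OF \<beta>_pos r(3,1)] T in auto)
qed

text \<open>The blow-up must show in \<open>f\<close> itself. Were \<open>f\<close> bounded near
  \<open>\<tau>\<close>, the quotient \<open>B / - v\<close> would obey a Riccati equation with
  damping quadratic term; its boundedness makes the equation for \<open>v\<close> linear with
  bounded coefficients, and the whole state stays bounded.\<close>

lemma f_at_bot: "filterlim f at_bot (at_left \<tau>)"
proof (rule ccontr)
  assume nb: "\<not> filterlim f at_bot (at_left \<tau>)"
  obtain s where s: "0 \<le> s" "s < \<tau>" and vn: "\<And>t. s \<le> t \<Longrightarrow> t < \<tau> \<Longrightarrow> v t < 0" using v_neg_near by blast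
  have tT: "ereal t < T" if "t < \<tau>" for t using that T by simp
  have dec: "f u \<le> f t" if "s \<le> t" "t \<le> u" "u < \<tau>" for t u
    by (rule nonincreasing_of_derivative[of t u f v]) (use that fT' tT vn in \<open>auto intro: less_imp_le\<close>)
  obtain Z where Z: "\<not> (\<forall>\<^sub>F t in at_left \<tau>. f t \<le> Z)" using nb unfolding filterlim_at_bot by blast
  have fZ: "Z < f t" if t: "s \<le> t" "t < \<tau>" for t
  proof (rule ccontr)
    assume "\<not> Z < f t"
    then have "\<forall>\<^sub>F u in at_left \<tau>. f u \<le> Z"
      using eventually_at_left_from[OF t(2)] dec t by (elim eventually_mono) force
    then show False using Z by simp
  qed
  define K where "K = \<bar>Z\<bar> + \<bar>f s\<bar>"
  have K0: "0 \<le> K" by (simp add: K_def)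
  have fK: "\<bar>f t\<bar> \<le> K" if t: "s \<le> t" "t < \<tau>" for t
    using fZ[OF t] dec[of s t] t by (auto simp: K_def)
  define e where "e = (\<lambda>t. B t / - v t)"
  have e0: "0 \<le> e t" if "s \<le> t" "t < \<tau>" for t
    unfolding e_def using vn[OF that] BT_nonneg[OF tT[OF that(2)]] by (intro divide_nonneg_pos) auto
  have de: "(e has_real_derivative \<beta> * - v t - (e t)\<^sup>2 + f t * e t) (at t)" if t: "s \<le> t" "t < \<tau>" for t
  proof -
    have n: "v t \<noteq> 0" using vn[OF t] by simp
    have "(e has_real_derivative (\<beta> * (v t)\<^sup>2 * - v t - B t * - (- f t * v t - B t)) / (- v t * - v t)) (at t)"
      unfolding e_def by (intro DERIV_divide DERIV_minus BT' vT' tT t) (use n in simp)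
    also have "(\<beta> * (v t)\<^sup>2 * - v t - B t * - (- f t * v t - B t)) / (- v t * - v t) = \<beta> * - v t - (e t)\<^sup>2 + f t * e t"
      using n by (simp add: e_def field_simps power2_eq_square)
    finally show ?thesis .
  qed
  \<comment> \<open>In the function integrated below, the weight \<open>exp (- K * t)\<close>
    absorbs the term \<open>f * e\<close>, and the summand \<open>\<beta> * f\<close> absorbs the
    source \<open>\<beta> * - v\<close>.\<close>
  define E1 where "E1 = e s * exp (- K * s) + \<beta> * (f s + K)"
  have e_le: "e t \<le> E1 * exp (K * \<tau>)" if t: "s \<le> t" "t < \<tau>" for t
  proof -
    have "e t * exp (- K * t) + \<beta> * f t \<le> e s * exp (- K * s) + \<beta> * f s"
    proof (rule nonincreasing_of_derivative[of s t "\<lambda>t. e t * exp (- K * t) + \<beta> * f t"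
          "\<lambda>t. (\<beta> * - v t - (e t)\<^sup>2 + f t * e t) * exp (- K * t) + exp (- K * t) * - K * e t + \<beta> * v t"])
      fix u assume u: "s \<le> u" "u \<le> t"
      then have u': "u < \<tau>" using t by simp
      show "((\<lambda>t. e t * exp (- K * t) + \<beta> * f t) has_real_derivative
          (\<beta> * - v u - (e u)\<^sup>2 + f u * e u) * exp (- K * u) + exp (- K * u) * - K * e u + \<beta> * v u) (at u)"
        by (intro DERIV_add DERIV_mult DERIV_cmult de[OF u(1) u'] fT'[OF tT[OF u']])
          (auto intro!: derivative_eq_intros)
      have "f u * e u \<le> K * e u" using fK[OF u(1) u'] e0[OF u(1) u'] by (intro mult_right_mono) auto
      then have "(\<beta> * - v u - (e u)\<^sup>2 + f u * e u - K * e u) * exp (- K * u) \<le> (\<beta> * - v u) * exp (- K * u)"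
        using zero_le_power2[of "e u"] by (intro mult_right_mono) (linarith, simp)
      also have "\<dots> \<le> \<beta> * - v u * 1"
        using vn[OF u(1) u'] \<beta>_pos K0 s u by (intro mult_left_mono mult_nonneg_nonneg) auto
      finally show "(\<beta> * - v u - (e u)\<^sup>2 + f u * e u) * exp (- K * u) + exp (- K * u) * - K * e u + \<beta> * v u \<le> 0"
        by (simp add: algebra_simps)
    qed (use t in auto)
    moreover have "\<beta> * - f t \<le> \<beta> * K" using fK[OF t] \<beta>_pos by (intro mult_left_mono) auto
    ultimately have "e t * exp (- K * t) \<le> E1" by (simp add: E1_def algebra_simps)
    then have "e t * exp (- K * t) * exp (K * t) \<le> E1 * exp (K * t)" by (intro mult_right_mono) auto
    then have "e t \<le> E1 * exp (K * t)" by (simp add: mult.assoc exp_add[symmetric])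
    also have "0 \<le> e t * exp (- K * t)" using e0[OF t] by simp
    then have "0 \<le> E1" using \<open>e t * exp (- K * t) \<le> E1\<close> by linarith
    then have "E1 * exp (K * t) \<le> E1 * exp (K * \<tau>)" using t K0 by (intro mult_left_mono) (auto intro!: mult_left_mono)
    finally show ?thesis .
  qed
  define E2 where "E2 = E1 * exp (K * \<tau>)"
  define M where "M = - v s * exp (- (E2 + K) * s) * exp ((E2 + K) * \<tau>)"
  have E2: "0 \<le> E2" using e0[of s] e_le[of s] s by (simp add: E2_def)
  have \<nu>_le: "- v t \<le> M" if t: "s \<le> t" "t < \<tau>" for t
  proof -
    have "- v t * exp (- (E2 + K) * t) \<le> - v s * exp (- (E2 + K) * s)"
    proof (rule nonincreasing_of_derivative[of s t "\<lambda>t. - v t * exp (- (E2 + K) * t)"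
          "\<lambda>t. - (- f t * v t - B t) * exp (- (E2 + K) * t) + exp (- (E2 + K) * t) * - (E2 + K) * - v t"])
      fix u assume u: "s \<le> u" "u \<le> t"
      then have u': "u < \<tau>" using t by simp
      show "((\<lambda>t. - v t * exp (- (E2 + K) * t)) has_real_derivative
          - (- f u * v u - B u) * exp (- (E2 + K) * u) + exp (- (E2 + K) * u) * - (E2 + K) * - v u) (at u)"
        by (intro DERIV_mult DERIV_minus vT'[OF tT[OF u']]) (auto intro!: derivative_eq_intros)
      have "B u = e u * - v u" using vn[OF u(1) u'] by (simp add: e_def)
      also have "\<dots> \<le> E2 * - v u"
        using e_le[OF u(1) u'] vn[OF u(1) u'] by (intro mult_right_mono) (auto simp: E2_def)
      finally have "B u \<le> E2 * - v u" .
      moreover have "- f u * - v u \<le> K * - v u"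
        using fK[OF u(1) u'] vn[OF u(1) u'] by (intro mult_right_mono) auto
      ultimately have "(- (- f u * v u - B u) - (E2 + K) * - v u) * exp (- (E2 + K) * u) \<le> 0"
        by (intro mult_nonpos_nonneg) (auto simp: algebra_simps)
      then show "- (- f u * v u - B u) * exp (- (E2 + K) * u) + exp (- (E2 + K) * u) * - (E2 + K) * - v u \<le> 0"
        by (simp add: algebra_simps)
    qed (use t in auto)
    then have "- v t * exp (- (E2 + K) * t) * exp ((E2 + K) * t) \<le> - v s * exp (- (E2 + K) * s) * exp ((E2 + K) * t)"
      by (intro mult_right_mono) auto
    also have "- v t * exp (- (E2 + K) * t) * exp ((E2 + K) * t) = - v t"
    proof -
      have "- (E2 + K) * t + (E2 + K) * t = 0" by (simp add: algebra_simps)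
      then show ?thesis by (simp only: mult.assoc exp_add[symmetric] exp_zero mult_1_right)
    qed
    also have "- v s * exp (- (E2 + K) * s) * exp ((E2 + K) * t) \<le> M"
      unfolding M_def using vn[of s] s t E2 K0 by (intro mult_left_mono) (auto intro!: mult_left_mono mult_nonpos_nonneg)
    finally show ?thesis .
  qed
  show False
  proof (rule bounded_imp_False[OF s])
    fix t assume t: "s \<le> t" "t < \<tau>"
    have M: "0 \<le> M" using \<nu>_le[OF t] vn[OF t] by simp
    have "B t = e t * - v t" using vn[OF t] by (simp add: e_def)
    also have "\<dots> \<le> E2 * M"
      using e_le[OF t] \<nu>_le[OF t] vn[OF t] E2 by (intro mult_mono) (auto simp: E2_def)
    finally show "\<bar>f t\<bar> \<le> K + M + E2 * M \<and> \<bar>v t\<bar> \<le> K + M + E2 * M \<and> \<bar>B t\<bar> \<le> K + M + E2 * M"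
      using fK[OF t] \<nu>_le[OF t] vn[OF t] BT_nonneg[OF tT[OF t(2)]] K0 M mult_nonneg_nonneg[OF E2 M] by auto
  qed
qed

lemma f_pole: "((\<lambda>t. f t * (t - \<tau>)) \<longlongrightarrow> 6 / (3 + \<beta>)) (at_left \<tau>)"
proof -
  obtain s where s: "0 \<le> s" "s < \<tau>" and vn: "\<And>t. s \<le> t \<Longrightarrow> t < \<tau> \<Longrightarrow> v t < 0" using v_neg_near by blast
  have "\<forall>\<^sub>F t in at_left \<tau>. f t \<le> - 1" using f_at_bot unfolding filterlim_at_bot by blast
  then have "\<forall>\<^sub>F t in at_left \<tau>. f t \<le> - 1 \<and> s \<le> t"
    using eventually_at_left_from[OF s(2)] by eventually_elim auto
  then obtain r where r: "r < \<tau>" and R: "\<And>t. r \<le> t \<Longrightarrow> t < \<tau> \<Longrightarrow> f t \<le> - 1 \<and> s \<le> t"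
    by (rule eventually_at_left_interval) blast
  have tT: "ereal t < T" if "t < \<tau>" for t using that T by simp
  interpret bl: blowup \<beta> r \<tau> "\<lambda>t. - f t" "\<lambda>t. - v t" B
  proof
    fix t assume t: "r \<le> t" "t < \<tau>"
    show "((\<lambda>t. - f t) has_real_derivative - v t) (at t)" by (intro DERIV_minus fT' tT t)
    show "((\<lambda>t. - v t) has_real_derivative B t + - f t * - v t) (at t)"
      using DERIV_minus[OF vT'[OF tT[OF t(2)]]] by (simp add: add.commute)
    show "(B has_real_derivative \<beta> * (- v t)\<^sup>2) (at t)" using BT'[OF tT[OF t(2)]] by simp
    show "0 < - f t" "0 < - v t" using R[OF t] vn[of t] t by auto
    show "0 \<le> B t" by (rule BT_nonneg[OF tT[OF t(2)]])
  next
    show "filterlim (\<lambda>t. - f t) at_top (at_left \<tau>)"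
      using f_at_bot by (simp add: filterlim_uminus_at_top)
  qed (use \<beta>_pos left.\<beta>_le_1 r in auto)
  show ?thesis using bl.pole by (simp add: algebra_simps)
qed

end

end

section \<open>Comparison of the blow-up times\<close>

text \<open>Monotone convergence along the intervals \<open>{t - k..t}\<close>. It is applied to
  \<open>B / \<beta>\<close>, whose derivative is \<open>v\<^sup>2\<close>.\<close>

lemma has_integral_atMost:
  fixes F g :: "real \<Rightarrow> real"
  assumes F': "\<And>x. x \<le> t \<Longrightarrow> (F has_real_derivative g x) (at x)"
    and nonneg: "\<And>x. x \<le> t \<Longrightarrow> 0 \<le> g x" and lim: "(F \<longlongrightarrow> L) at_bot"
  shows "(g has_integral (F t - L)) {..t}"
proof -
  define h where "h = (\<lambda>(k::nat) x. if x \<in> {t - real k..t} then g x else 0)"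
  have int: "(h k has_integral (F t - F (t - real k))) {..t}" for k
  proof -
    have "(g has_integral (F t - F (t - real k))) {t - real k..t}"
      by (intro fundamental_theorem_of_calculus)
        (use F' in \<open>auto simp: has_real_derivative_iff_has_vector_derivative[symmetric] intro: has_field_derivative_at_within\<close>)
    then show ?thesis unfolding h_def by (subst has_integral_restrict) auto
  qed
  then have integral_h: "integral {..t} (h k) = F t - F (t - real k)" for k
    by (rule integral_unique)
  have "filterlim (\<lambda>k. t - real k) at_bot sequentially"
    unfolding filterlim_at_bot
  proof
    fix Z :: real
    show "\<forall>\<^sub>F k in sequentially. t - real k \<le> Z"
      using eventually_ge_at_top[of "nat \<lceil>t - Z\<rceil>"] by (rule eventually_mono) linarith
  qed
  then have lim_h: "(\<lambda>k. integral {..t} (h k)) \<longlonglongrightarrow> F t - L"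
    unfolding integral_h by (intro tendsto_intros filterlim_compose[OF lim])
  have "g integrable_on {..t} \<and> (\<lambda>k. integral {..t} (h k)) \<longlonglongrightarrow> integral {..t} g"
  proof (rule monotone_convergence_increasing)
    show "h k integrable_on {..t}" for k using int by blast
    show "h k x \<le> h (Suc k) x" if "x \<in> {..t}" for k x
      using nonneg[of x] that by (auto simp: h_def)
    show "(\<lambda>k. h k x) \<longlonglongrightarrow> g x" if "x \<in> {..t}" for x
    proof (rule tendsto_eventually)
      show "\<forall>\<^sub>F k in sequentially. h k x = g x"
        using eventually_ge_at_top[of "nat \<lceil>t - x\<rceil>"]
      proof (rule eventually_mono)
        fix k assume "nat \<lceil>t - x\<rceil> \<le> k"
        then have "t - real k \<le> x" by linarith
        then show "h k x = g x" using that by (simp add: h_def)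
      qed
    qed
    show "bounded (range (\<lambda>k. integral {..t} (h k)))"
      by (rule convergent_imp_bounded[OF lim_h])
  qed
  then show ?thesis
    using LIMSEQ_unique[OF lim_h] by (metis has_integral_integral)
qed

text \<open>With the abbreviations \<open>p\<close>, \<open>q\<close>, \<open>r\<close> of the
  proof, the coefficient of \<open>v / (2 * w)\<close> is \<open>2 * w * p - q * r / 4\<close>.
  Since \<open>p \<le> v\<close>, its first part is outweighed by \<open>v\<^sup>2\<close>, and its
  second part outweighs \<open>q\<^sup>2 / 12\<close>.\<close>

lemma cubic_rate_inequality:
  fixes b w v :: real
  assumes w: "0 < w" "w < b" and v: "2 / 3 * (b ^ 3 * w - w ^ 4) \<le> v"
  shows "(b ^ 4 - w ^ 4)\<^sup>2 / 12 - v\<^sup>2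
    + (4 / 3 * (b ^ 3 * w\<^sup>2 - w ^ 5) - 1 / 4 * ((b ^ 4 - w ^ 4) * (b + w\<^sup>2 / (3 * b)))) * (v / (2 * w)) \<le> 0"
proof -
  define p where "p = 2 / 3 * (b ^ 3 * w - w ^ 4)"
  define q where "q = b ^ 4 - w ^ 4"
  \<comment> \<open>A polynomial majorant of \<open>q / (b ^ 3 - w ^ 3)\<close>; being polynomial in
    \<open>w\<close>, it keeps the primitive \<open>A\<close> of \<open>B_left_le\<close>
    polynomial.\<close>
  define r where "r = b + w\<^sup>2 / (3 * b)"
  have b: "0 < b" using w by simp
  have q: "0 \<le> q" using w by (auto simp: q_def intro!: power_mono)
  have p0: "p = 2 / 3 * w * (b ^ 3 - w ^ 3)" by (simp add: p_def power3_eq_cube power4_eq_xxxx algebra_simps)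
  have p: "0 \<le> p" using w unfolding p0 by (intro mult_nonneg_nonneg) (auto intro!: power_mono)
  have r: "0 \<le> r" using b by (simp add: r_def)
  have "(b ^ 3 - w ^ 3) * r - q = w\<^sup>2 * (b - w) ^ 3 / (3 * b)"
    using b by (simp add: r_def q_def field_simps) (simp add: eval_nat_numeral algebra_simps)
  moreover have "0 \<le> w\<^sup>2 * (b - w) ^ 3 / (3 * b)" using w b by simp
  ultimately have qr: "q \<le> (b ^ 3 - w ^ 3) * r" by linarith
  have "q\<^sup>2 / 12 \<le> q * ((b ^ 3 - w ^ 3) * r) / 12"
    using mult_left_mono[OF qr q] by (simp add: power2_eq_square)
  also have "\<dots> = q * r / (8 * w) * p" using w by (simp add: p0 field_simps)
  also have "\<dots> \<le> q * r / (8 * w) * v"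
    using v w q r by (intro mult_left_mono) (auto simp: p_def)
  finally have 1: "q\<^sup>2 / 12 \<le> q * r / (8 * w) * v" .
  have 2: "v * p \<le> v * v" using v p by (intro mult_left_mono) (auto simp: p_def)
  have "(4 / 3 * (b ^ 3 * w\<^sup>2 - w ^ 5) - 1 / 4 * (q * r)) * (v / (2 * w)) = v * p - q * r / (8 * w) * v"
  proof -
    have "4 / 3 * (b ^ 3 * w\<^sup>2 - w ^ 5) = 2 * w * p"
      by (simp add: p_def eval_nat_numeral algebra_simps)
    then show ?thesis using w by (simp add: field_simps)
  qed
  then show ?thesis using 1 2 unfolding q_def[symmetric] r_def[symmetric] power2_eq_square[of v] by linarith
qed

context front
begin

lemma J_zero: "\<beta> = 1 \<Longrightarrow> t < S \<Longrightarrow> J t = 0"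
  using le_limit_at_bot[OF J' _ lim_J, of t] ge_limit_at_bot[OF J' _ lim_J, of t] by force

lemma G_const:
  assumes "\<beta> = 1" "t < S"
  shows "G t = 2 / 9 * a ^ 3"
proof -
  have d: "(G has_real_derivative 0) (at u)" if "u \<le> t" for u
    using G'[of u] J_zero[of u] that assms by simp
  show ?thesis
    using le_limit_at_bot[OF d _ lim_G] ge_limit_at_bot[OF d _ lim_G] by (simp add: antisym)
qed

end

context rising_front
begin

text \<open>In \<open>J' = (1 - \<beta>) * f * v\<^sup>2\<close> one factor \<open>v\<close> is
  replaced by its bound \<open>(a\<^sup>2 - f\<^sup>2) / 2\<close>; what remains is the derivative
  of a polynomial in \<open>f\<close>.\<close>

lemma J_ge:
  assumes "t < S"
  shows "- ((1 - \<beta>) * (a\<^sup>2 - (f t)\<^sup>2)\<^sup>2 / 8) \<le> J t"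
proof -
  let ?H = "\<lambda>t. (1 - \<beta>) * (a\<^sup>2 - (f t)\<^sup>2)\<^sup>2 / 8 + J t"
  have "0 \<le> ?H t"
  proof (rule ge_limit_at_bot[of t ?H "\<lambda>t. (1 - \<beta>) * (- f t * v t * ((a\<^sup>2 - (f t)\<^sup>2) / 2 - v t))" 0])
    fix u assume u: "u \<le> t"
    then have uS: "u < S" using assms by simp
    show "(?H has_real_derivative (1 - \<beta>) * (- f u * v u * ((a\<^sup>2 - (f u)\<^sup>2) / 2 - v u))) (at u)"
      by (auto intro!: derivative_eq_intros f'[OF uS] J'[OF uS] simp: power2_eq_square field_simps)
    show "0 \<le> (1 - \<beta>) * (- f u * v u * ((a\<^sup>2 - (f u)\<^sup>2) / 2 - v u))"
      using \<beta>_le_1 f_neg[OF uS] v_pos[OF uS] v_le[OF uS]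
      by (intro mult_nonneg_nonneg) auto
  next
    have "(?H \<longlongrightarrow> (1 - \<beta>) * (a\<^sup>2 - (- a)\<^sup>2)\<^sup>2 / 8 + 0) at_bot"
      by (intro tendsto_intros lim_f lim_J) auto
    then show "(?H \<longlongrightarrow> 0) at_bot" by simp
  qed
  then show ?thesis by simp
qed

text \<open>\<open>G\<close> stays below \<open>2 a ^ 3 / 9\<close> up to a multiple of a polynomial in \<open>w = sqrt (- f)\<close> that
  vanishes at \<open>w = 0\<close>.\<close>

lemma B_left_le:
  assumes "(B \<longlongrightarrow> b\<^sub>0) (at_left S)" "(v \<longlongrightarrow> v\<^sub>0) (at_left S)"
  shows "b\<^sub>0 \<le> 2 / 9 * a ^ 3"
proof -
  define b where "b = sqrt a"
  have b: "0 < b" "b\<^sup>2 = a" using a by (auto simp: b_def)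
  \<comment> \<open>\<open>A\<close> is the primitive, zero at \<open>0\<close>, of the coefficient
    in \<open>cubic_rate_inequality\<close>, so that \<open>G - (1 - \<beta>) * A w\<close> is
    nonincreasing in time. Comparing the ends \<open>w = b\<close> and \<open>w = 0\<close> gives
    the claim because \<open>A b \<ge> 0\<close>.\<close>
  define A where "A = (\<lambda>w. 4 / 9 * b ^ 3 * w ^ 3 - 2 / 9 * w ^ 6
    - 1 / 4 * (b ^ 5 * w + b ^ 3 * w ^ 3 / 9 - b * w ^ 5 / 5 - w ^ 7 / (21 * b)))"
  define A' where "A' = (\<lambda>w. 4 / 3 * (b ^ 3 * w\<^sup>2 - w ^ 5) - 1 / 4 * ((b ^ 4 - w ^ 4) * (b + w\<^sup>2 / (3 * b))))"
  have dA: "(A has_real_derivative A' w) (at w)" for w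
  proof -
    have "(A has_real_derivative 4 / 9 * b ^ 3 * (3 * w\<^sup>2) - 2 / 9 * (6 * w ^ 5)
      - 1 / 4 * (b ^ 5 + b ^ 3 * (3 * w\<^sup>2) / 9 - b * (5 * w ^ 4) / 5 - (7 * w ^ 6) / (21 * b))) (at w)"
      unfolding A_def using b by (auto intro!: derivative_eq_intros)
    also have "4 / 9 * b ^ 3 * (3 * w\<^sup>2) - 2 / 9 * (6 * w ^ 5)
      - 1 / 4 * (b ^ 5 + b ^ 3 * (3 * w\<^sup>2) / 9 - b * (5 * w ^ 4) / 5 - (7 * w ^ 6) / (21 * b)) = A' w"
      unfolding A'_def using b(1)
      by (simp add: field_simps) (simp add: eval_nat_numeral algebra_simps)
    finally show ?thesis .
  qed
  define w where "w = (\<lambda>t. sqrt (- f t))"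
  have w: "0 < w t" "w t < b" "f t = - (w t)\<^sup>2" if "t < S" for t
    using f_neg[OF that] f_gt[OF that] by (auto simp: w_def b_def)
  have dw: "(w has_real_derivative inverse (w t) / 2 * - v t) (at t)" if "t < S" for t
    unfolding w_def using f_neg[OF that] that
    by (intro DERIV_chain2[OF DERIV_real_sqrt] DERIV_minus f') auto
  let ?H = "\<lambda>t. G t - (1 - \<beta>) * A (w t)"
  have lim: "(?H \<longlongrightarrow> 2 / 9 * a ^ 3 - (1 - \<beta>) * A b) at_bot"
  proof -
    have "(w \<longlongrightarrow> sqrt (- (- a))) at_bot" unfolding w_def by (intro tendsto_intros lim_f)
    then have "(w \<longlongrightarrow> b) at_bot" by (simp add: b_def)
    then show ?thesis
      by (intro tendsto_intros lim_G isCont_tendsto_compose[OF DERIV_isCont[OF dA]])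
  qed
  have H_le: "?H t \<le> 2 / 9 * a ^ 3 - (1 - \<beta>) * A b" if "t < S" for t
  proof (rule le_limit_at_bot[OF _ _ lim])
    fix u assume "u \<le> t"
    then have uS: "u < S" using that by simp
    note wu = w[OF uS]
    show "(?H has_real_derivative - (1 - \<beta>) * (v u)\<^sup>2 - 2 / 3 * J u - (1 - \<beta>) * (A' (w u) * (inverse (w u) / 2 * - v u))) (at u)"
      by (intro DERIV_diff G' uS DERIV_cmult DERIV_chain2[OF dA dw])
    have "- J u \<le> (1 - \<beta>) * (b ^ 4 - w u ^ 4)\<^sup>2 / 8"
    proof -
      have "a\<^sup>2 - (f u)\<^sup>2 = b ^ 4 - w u ^ 4"
        by (simp add: wu(3) b(2)[symmetric] power_mult[symmetric])
      then show ?thesis using J_ge[OF uS] by simp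
    qed
    have "- (1 - \<beta>) * (v u)\<^sup>2 - 2 / 3 * J u - (1 - \<beta>) * (A' (w u) * (inverse (w u) / 2 * - v u))
      \<le> (1 - \<beta>) * ((b ^ 4 - w u ^ 4)\<^sup>2 / 12 - (v u)\<^sup>2 + A' (w u) * (v u / (2 * w u)))"
    proof -
      have "- d * y\<^sup>2 - 2 / 3 * j - d * (c * (inverse x / 2 * - y)) \<le> d * (q / 12 - y\<^sup>2 + c * (y / (2 * x)))"
        if "- j \<le> d * q / 8" for d y j c x q :: real
      proof -
        define X where "X = c * (y / (2 * x))"
        have "inverse x / 2 * - y = - (y / (2 * x))" by (cases "x = 0") (auto simp: field_simps)
        then have "c * (inverse x / 2 * - y) = - X" by (simp only: X_def mult_minus_right)
        moreover have "d * (q / 12 - y\<^sup>2 + X) = d * q / 12 - d * y\<^sup>2 + d * X"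
          by (simp add: algebra_simps)
        moreover have "- d * y\<^sup>2 - 2 / 3 * j - d * - X \<le> d * q / 12 - d * y\<^sup>2 + d * X"
          using that by simp
        ultimately show ?thesis by (simp only: X_def)
      qed
      then show ?thesis using \<open>- J u \<le> (1 - \<beta>) * (b ^ 4 - w u ^ 4)\<^sup>2 / 8\<close> by blast
    qed
    also have "\<dots> \<le> 0"
    proof (rule mult_nonneg_nonpos)
      have "2 / 3 * (b ^ 3 * w u - w u ^ 4) \<le> v u"
        using v_third[OF uS] by (simp only: w_def b_def)
      then show "(b ^ 4 - w u ^ 4)\<^sup>2 / 12 - (v u)\<^sup>2 + A' (w u) * (v u / (2 * w u)) \<le> 0"
        unfolding A'_def by (rule cubic_rate_inequality[OF wu(1,2)])
    qed (use \<beta>_le_1 in simp)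
    finally show "- (1 - \<beta>) * (v u)\<^sup>2 - 2 / 3 * J u - (1 - \<beta>) * (A' (w u) * (inverse (w u) / 2 * - v u)) \<le> 0" .
  qed
  have "(w \<longlongrightarrow> sqrt (- 0)) (at_left S)" unfolding w_def by (intro tendsto_intros f_left)
  then have w0: "(w \<longlongrightarrow> 0) (at_left S)" by simp
  have "(?H \<longlongrightarrow> (b\<^sub>0 - 2 / 3 * 0 * v\<^sub>0 - 2 / 9 * 0 ^ 3) - (1 - \<beta>) * A 0) (at_left S)"
    unfolding G_def
    by (intro tendsto_intros assms f_left isCont_tendsto_compose[OF DERIV_isCont[OF dA]] w0)
  moreover have "A 0 = 0" by (simp add: A_def)
  ultimately have "(?H \<longlongrightarrow> b\<^sub>0) (at_left S)" by simp
  then have "b\<^sub>0 \<le> 2 / 9 * a ^ 3 - (1 - \<beta>) * A b"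
  proof (rule tendsto_upperbound)
    show "\<forall>\<^sub>F t in at_left S. ?H t \<le> 2 / 9 * a ^ 3 - (1 - \<beta>) * A b"
      by (rule eventually_mono[OF eventually_at_left_from[of "S - 1" S]]) (simp, use H_le in blast)
  qed simp
  moreover have "0 \<le> (1 - \<beta>) * A b"
  proof -
    \<comment> \<open>In units of \<open>b ^ 6\<close> this is \<open>2 / 9 - 68 / 315\<close>,
      positive by a narrow margin.\<close>
    have "A b = 2 / 315 * b ^ 6"
      unfolding A_def using b(1) by (simp add: field_simps) (simp add: eval_nat_numeral algebra_simps)?
    also have "0 \<le> 2 / 315 * b ^ 6" using b(1) by simp
    finally have "0 \<le> A b" .
    then show ?thesis using \<beta>_le_1 by simp
  qed
  ultimately show ?thesis by linarith
qed

end

section \<open>The state at the zero, the explicit continuation for \<open>\<beta> = 1\<close>, and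
  the crest for \<open>\<beta> < 1\<close>\<close>

context maximal_front
begin

lemma zero_less_T: "ereal 0 < T"
  using T_pos by (simp add: zero_ereal_def)

lemma tendsto_left_0: "(f \<longlongrightarrow> f 0) (at_left 0)" "(v \<longlongrightarrow> v 0) (at_left 0)" "(B \<longlongrightarrow> B 0) (at_left 0)"
  using DERIV_isCont[OF fT'[OF zero_less_T]] DERIV_isCont[OF vT'[OF zero_less_T]] DERIV_isCont[OF BT'[OF zero_less_T]]
  by (auto simp: isCont_def filterlim_at_split)

lemma B_0_le: "B 0 \<le> 2 / 9 * a ^ 3"
  by (rule left.B_left_le[OF tendsto_left_0(3,2)])

lemma v_0_sq_le: "(v 0)\<^sup>2 \<le> (1 - \<beta>) * a ^ 4 / 4"
proof -
  have "((\<lambda>t. left.J t + (1 - \<beta>) * (a\<^sup>2 - (f t)\<^sup>2)\<^sup>2 / 8) \<longlongrightarrow>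
      (- f 0 * B 0 - (v 0)\<^sup>2 / 2) + (1 - \<beta>) * (a\<^sup>2 - (f 0)\<^sup>2)\<^sup>2 / 8) (at_left 0)"
    unfolding left.J_def by (intro tendsto_intros tendsto_left_0) auto
  then have "0 \<le> (- f 0 * B 0 - (v 0)\<^sup>2 / 2) + (1 - \<beta>) * (a\<^sup>2 - (f 0)\<^sup>2)\<^sup>2 / 8"
  proof (rule tendsto_lowerbound)
    show "\<forall>\<^sub>F t in at_left 0. 0 \<le> left.J t + (1 - \<beta>) * (a\<^sup>2 - (f t)\<^sup>2)\<^sup>2 / 8"
      using eventually_at_left_from[of "-1" 0] left.J_ge by (force elim!: eventually_mono)
  qed simp
  then show ?thesis by (simp add: f_0 power_mult[symmetric])
qed

text \<open>Before the zero \<open>J\<close> is nonpositive and strictly decreasing, so its value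
  \<open>- (v 0)\<^sup>2 / 2\<close> at the zero is negative.\<close>

lemma v_0_pos:
  assumes "\<beta> < 1"
  shows "0 < v 0"
proof -
  have "0 \<le> v 0"
    by (rule tendsto_lowerbound[OF tendsto_left_0(2)])
      (use eventually_at_left_from[of "-1" 0] left.v_pos in \<open>auto elim!: eventually_mono intro: less_imp_le\<close>)
  moreover have "v 0 \<noteq> 0"
  proof
    assume "v 0 = 0"
    obtain S where S: "0 < S" "front a \<beta> S f v B" using front_beyond[OF zero_less_T] .
    have dJ: "(left.J has_real_derivative (1 - \<beta>) * f u * (v u)\<^sup>2) (at u)" if "u \<le> 0" for u
      by (rule front.J'[OF S(2)]) (use that S(1) in simp)
    have neg: "(1 - \<beta>) * f u * (v u)\<^sup>2 < 0" if "u < 0" for u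
      using assms left.f_neg[OF that] left.v_pos[OF that] by (simp add: mult_pos_neg mult_neg_pos)
    have "left.J 0 < left.J (-1)"
    proof (rule DERIV_neg_imp_decreasing_open[of "-1" 0])
      show "continuous_on {-1..0} left.J"
        by (intro continuous_at_imp_continuous_on ballI DERIV_isCont[OF dJ]) auto
      fix u :: real assume "- 1 < u" "u < 0"
      then show "\<exists>y. (left.J has_real_derivative y) (at u) \<and> y < 0"
        using dJ[of u] neg[of u] by (intro exI[of _ "(1 - \<beta>) * f u * (v u)\<^sup>2"]) auto
    qed simp
    also have "\<dots> \<le> 0" by (rule left.J_le_0) simp
    finally show False using \<open>v 0 = 0\<close> f_0 by (simp add: left.J_def)
  qed
  ultimately show ?thesis by simp
qed

lemma time_beta_1:
  assumes \<beta>1: "\<beta> = 1" and T: "T = ereal \<tau>"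
  shows "\<tau> = 2 * pi * sqrt 3 / (3 * a)" "v 0 = 0" "B 0 = 2 / 9 * a ^ 3"
    "\<And>t. 0 < t \<Longrightarrow> t < \<tau> \<Longrightarrow> f t < 0"
proof -
  have tT: "ereal t < T" if "t < \<tau>" for t using that T by simp
  have \<tau>: "0 < \<tau>" using T T_pos by simp
  have J0: "- f t * B t - (v t)\<^sup>2 / 2 = 0" and G0: "B t - 2 / 3 * f t * v t - 2 / 9 * f t ^ 3 = 2 / 9 * a ^ 3"
    if t: "t < \<tau>" for t
  proof -
    obtain S where S: "t < S" "front a \<beta> S f v B" using front_beyond[OF tT[OF t]] .
    show "- f t * B t - (v t)\<^sup>2 / 2 = 0"
      using front.J_zero[OF S(2) \<beta>1 S(1)] by (simp add: front.J_def[OF S(2)])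
    show "B t - 2 / 3 * f t * v t - 2 / 9 * f t ^ 3 = 2 / 9 * a ^ 3"
      using front.G_const[OF S(2) \<beta>1 S(1)] by (simp add: front.G_def[OF S(2)])
  qed
  show v0: "v 0 = 0" using J0[OF \<tau>] f_0 by simp
  show "B 0 = 2 / 9 * a ^ 3" using G0[OF \<tau>] f_0 v0 by simp
  have vn: "v t < 0" if "0 < t" "t < \<tau>" for t
    by (rule v_neg_after[of 0]) (use \<beta>1 v0 that tT in auto)
  have fn: "f t < 0" if t: "0 < t" "t < \<tau>" for t
  proof -
    have "f t < f 0"
    proof (rule DERIV_neg_imp_decreasing_open[OF t(1)])
      fix u assume "0 < u" "u < t"
      then show "\<exists>y. (f has_real_derivative y) (at u) \<and> y < 0"
        using fT'[OF tT, of u] vn[of u] t by (intro exI[of _ "v u"]) auto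
    qed (rule contT(1)[OF tT[OF t(2)]])
    then show ?thesis using f_0 by simp
  qed
  then show "\<And>t. 0 < t \<Longrightarrow> t < \<tau> \<Longrightarrow> f t < 0" .
  define b where "b = sqrt a"
  have b: "0 < b" "b\<^sup>2 = a" using left.a by (auto simp: b_def)
  define w where "w = (\<lambda>t. sqrt (- f t))"
  have w: "0 < w t" "f t = - (w t)\<^sup>2" if "0 < t" "t < \<tau>" for t
    using fn[OF that] by (auto simp: w_def)
  \<comment> \<open>Eliminating \<open>B\<close> between \<open>J = 0\<close> and the constant
    \<open>G\<close> leaves a quadratic equation for \<open>v\<close>, namely
    \<open>h = 2 / 3 * b ^ 3 * w\<close> up to sign. The negative branch is the approach to the
    zero, the positive one the departure from it.\<close>
  define h where "h = (\<lambda>t. - v t - 2 / 3 * w t ^ 4)"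
  have h_sq: "(h t)\<^sup>2 = (2 / 3 * b ^ 3 * w t)\<^sup>2" if t: "0 < t" "t < \<tau>" for t
  proof -
    have "(w t)\<^sup>2 * B t = (v t)\<^sup>2 / 2" using J0[OF t(2)] by (simp add: w(2)[OF t])
    moreover have "B t + 2 / 3 * (w t)\<^sup>2 * v t + 2 / 9 * w t ^ 6 = 2 / 9 * b ^ 6"
      using G0[OF t(2)] by (simp add: w(2)[OF t] b(2)[symmetric] power_mult[symmetric])
    then have "(w t)\<^sup>2 * (B t + 2 / 3 * (w t)\<^sup>2 * v t + 2 / 9 * w t ^ 6) = (w t)\<^sup>2 * (2 / 9 * b ^ 6)" by simp
    ultimately have "(v t)\<^sup>2 / 2 + 2 / 3 * w t ^ 4 * v t + 2 / 9 * w t ^ 8 = 2 / 9 * b ^ 6 * (w t)\<^sup>2"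
      by (simp add: distrib_left) (simp add: eval_nat_numeral algebra_simps)
    then show ?thesis
      by (simp add: h_def power2_eq_square) (simp add: eval_nat_numeral algebra_simps)
  qed
  have h_nz: "h t \<noteq> 0" if t: "0 < t" "t < \<tau>" for t
    using h_sq[OF t] w(1)[OF t] b by auto
  have h_cont: "continuous_on {s..t} h" if "0 < s" "t < \<tau>" for s t
    unfolding h_def w_def using contT[OF tT[OF that(2)]] by (intro continuous_intros) auto
  have h_pos_of_small: "0 < h t" if t: "0 < t" "t < \<tau>" and "- a < f t" for t
  proof (rule ccontr)
    assume "\<not> 0 < h t"
    then have "h t < 0" using h_nz[OF t] by simp
    have "w t < b" using that(3) by (simp add: w_def b_def)
    have "\<bar>h t\<bar> = \<bar>2 / 3 * b ^ 3 * w t\<bar>" using h_sq[OF t] by (simp only: power2_eq_iff abs_eq_iff)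
    then have "h t = - (2 / 3 * b ^ 3 * w t)" using \<open>h t < 0\<close> w(1)[OF t] b by simp
    then have "- v t = - (2 / 3 * w t * (b ^ 3 - w t ^ 3))"
      by (simp add: h_def) (simp add: eval_nat_numeral algebra_simps)
    moreover have "0 \<le> 2 / 3 * w t * (b ^ 3 - w t ^ 3)"
      using w(1)[OF t] \<open>w t < b\<close> by (intro mult_nonneg_nonneg) (auto intro!: power_mono)
    ultimately show False using vn[OF t] by simp
  qed
  \<comment> \<open>\<open>h\<close> has no zero after time 0, and just after it, where
    \<open>f > - a\<close>, the negative branch would contradict \<open>v < 0\<close>; so the
    positive branch persists.\<close>
  have h_pos: "0 < h t" if t: "0 < t" "t < \<tau>" for t
  proof (rule ccontr)
    assume "\<not> 0 < h t"
    then have neg: "h t \<le> 0" by simp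
    have "(f \<longlongrightarrow> f 0) (at_right 0)"
      using DERIV_isCont[OF fT'[OF zero_less_T]] by (auto simp: isCont_def filterlim_at_split)
    then have "\<forall>\<^sub>F u in at_right 0. - a < f u \<and> u \<in> {0<..<t}"
      using eventually_at_right_real[OF t(1)] f_0 left.a by (intro eventually_conj order_tendstoD(1)) auto
    then have "\<exists>u. - a < f u \<and> u \<in> {0<..<t}"
      by (rule eventually_happens'[OF trivial_limit_at_right_real])
    then obtain u where u: "- a < f u" "0 < u" "u < t" by auto
    have "0 < h u" using h_pos_of_small[of u] u t by simp
    then obtain x where "u \<le> x" "x \<le> t" "h x = 0"
      using IVT2'[of h t 0 u] neg u h_cont[OF u(2) t(2)] by auto
    then show False using h_nz[of x] u t by auto
  qed
  have v_eq: "- v t = 2 / 3 * w t * (b ^ 3 + w t ^ 3)" if t: "0 < t" "t < \<tau>" for t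
  proof -
    have "\<bar>h t\<bar> = \<bar>2 / 3 * b ^ 3 * w t\<bar>" using h_sq[OF t] by (simp only: power2_eq_iff abs_eq_iff)
    then have "h t = 2 / 3 * b ^ 3 * w t" using h_pos[OF t] w(1)[OF t] b by simp
    then show ?thesis by (simp add: h_def) (simp add: eval_nat_numeral algebra_simps)
  qed
  \<comment> \<open>On this branch \<open>- w\<close> satisfies the equation that \<open>w\<close>
    satisfied before the zero, so the explicit solution passes through the zero by a change of sign
    of its argument.\<close>
  have "\<exists>c. \<forall>t\<in>{0<..<\<tau>}. third_time b (- w t) - t = c"
  proof (rule has_field_derivative_zero_constant)
    fix t assume "t \<in> {0<..<\<tau>}"
    then have t: "0 < t" "t < \<tau>" by auto
    have dw: "(w has_real_derivative inverse (w t) / 2 * - v t) (at t)"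
      unfolding w_def using fn[OF t] t
      by (intro DERIV_chain2[OF DERIV_real_sqrt] DERIV_minus fT' tT) auto
    have "((\<lambda>t. third_time b (- w t) - t) has_real_derivative
        (- 3 / (b ^ 3 - (- w t) ^ 3)) * - (inverse (w t) / 2 * - v t) - 1) (at t)"
      using w(1)[OF t] b(1) by (intro DERIV_diff DERIV_ident DERIV_chain2[OF third_time'] DERIV_minus dw) auto
    then have d: "((\<lambda>t. third_time b (- w t) - t) has_real_derivative
        (- 3 / (b ^ 3 + w t ^ 3)) * - (inverse (w t) / 2 * (2 / 3 * w t * (b ^ 3 + w t ^ 3))) - 1) (at t)"
      unfolding v_eq[OF t] by simp
    have "(- 3 / k) * - (inverse x / 2 * (2 / 3 * x * k)) - 1 = 0" if "0 < k" "0 < x" for k x :: real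
      using that by (simp add: field_simps)
    moreover have "0 < b ^ 3 + w t ^ 3" using w(1)[OF t] b by (intro add_pos_pos) auto
    ultimately have "((\<lambda>t. third_time b (- w t) - t) has_real_derivative 0) (at t)"
      using w(1)[OF t] by (intro DERIV_cong[OF d]) blast
    then show "((\<lambda>t. third_time b (- w t) - t) has_real_derivative 0) (at t within {0<..<\<tau>})"
      by (rule has_field_derivative_at_within)
  qed auto
  then obtain c where c: "\<And>t. 0 < t \<Longrightarrow> t < \<tau> \<Longrightarrow> third_time b (- w t) - t = c" by auto
  have "c = 0"
  proof -
    have "(f \<longlongrightarrow> f 0) (at_right 0)"
      using DERIV_isCont[OF fT'[OF zero_less_T]] by (auto simp: isCont_def filterlim_at_split)
    then have "((\<lambda>t. - sqrt (- f t)) \<longlongrightarrow> - sqrt (- f 0)) (at_right 0)"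
      by (intro tendsto_intros)
    then have "((\<lambda>t. - w t) \<longlongrightarrow> 0) (at_right 0)" by (simp add: w_def f_0)
    then have "((\<lambda>t. third_time b (- w t) - t) \<longlongrightarrow> third_time b 0 - 0) (at_right 0)"
      using b by (intro tendsto_intros isCont_tendsto_compose[OF DERIV_isCont[OF third_time']]) auto
    moreover have "\<forall>\<^sub>F t in at_right 0. third_time b (- w t) - t = c"
      using eventually_at_right_real[OF \<tau>] c by (auto elim!: eventually_mono)
    then have "((\<lambda>t. third_time b (- w t) - t) \<longlongrightarrow> c) (at_right 0)" by (rule tendsto_eventually)
    ultimately have "third_time b 0 - 0 = c"
      using tendsto_unique[OF trivial_limit_at_right_real] by blast
    then show ?thesis using b by simp
  qed
  have "filterlim f at_bot (at_left \<tau>)" by (rule f_at_bot[OF _ T]) (simp add: \<beta>1)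
  then have "filterlim (\<lambda>t. - f t) at_top (at_left \<tau>)" by (simp add: filterlim_uminus_at_top)
  then have "filterlim w at_top (at_left \<tau>)"
    unfolding w_def by (rule filterlim_compose[OF sqrt_at_top])
  then have "filterlim (\<lambda>t. - w t) at_bot (at_left \<tau>)" by (simp add: filterlim_uminus_at_top)
  then have "((\<lambda>t. third_time b (- w t)) \<longlongrightarrow> 2 * pi * sqrt 3 / (3 * b\<^sup>2)) (at_left \<tau>)"
    by (rule filterlim_compose[OF third_time_at_bot[OF b(1)]])
  then have "((\<lambda>t::real. t) \<longlongrightarrow> 2 * pi * sqrt 3 / (3 * b\<^sup>2)) (at_left \<tau>)"
  proof (rule Lim_transform_eventually)
    show "\<forall>\<^sub>F t in at_left \<tau>. third_time b (- w t) = t"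
      using eventually_at_left_real[OF \<tau>] by (rule eventually_mono) (use c \<open>c = 0\<close> in force)
  qed
  moreover have "((\<lambda>t::real. t) \<longlongrightarrow> \<tau>) (at_left \<tau>)" by (rule tendsto_ident_at)
  ultimately have "2 * pi * sqrt 3 / (3 * b\<^sup>2) = \<tau>"
    using tendsto_unique[OF trivial_limit_at_left_real] by blast
  then show "\<tau> = 2 * pi * sqrt 3 / (3 * a)" using b by simp
qed

text \<open>\<open>\<sigma>\<close> is the first zero of \<open>v\<close>. Up to it \<open>f\<close>
  and \<open>v\<close> are nonnegative on \<open>{0..\<sigma>}\<close>, hence \<open>v\<close>
  decreases there and \<open>B' = \<beta> * v\<^sup>2\<close> is controlled by
  \<open>v 0\<close>.\<close>

lemma crest:
  assumes \<beta>: "0 < \<beta>" "\<beta> < 1" and T: "T = ereal \<tau>"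
  obtains \<sigma> where "0 < \<sigma>" "\<sigma> < \<tau>" "v \<sigma> = 0" "0 < f \<sigma>" "B \<sigma> \<le> 2 / 9 * a ^ 3 + a ^ 4 / 16 * \<sigma>"
proof -
  have tT: "ereal t < T" if "t < \<tau>" for t using that T by simp
  obtain s where s: "0 \<le> s" "s < \<tau>" "v s \<le> 0" using ex_v_nonpos[OF \<beta>(1) T] by blast
  have "continuous_on {0..s} (\<lambda>t. - v t)" by (intro continuous_intros contT(2) tT s)
  moreover have "- v t < 0" if "t \<le> 0" for t
    using that left.v_pos[of t] v_0_pos[OF \<beta>(2)] by (cases "t = 0") auto
  ultimately obtain \<sigma> where \<sigma>: "0 < \<sigma>" "\<sigma> \<le> s" "- v \<sigma> = 0" "\<And>t. t < \<sigma> \<Longrightarrow> - v t < 0"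
    using first_nonneg[of 0 s "\<lambda>t. - v t"] s by auto
  have \<sigma>\<tau>: "\<sigma> < \<tau>" using \<sigma> s by simp
  have vp: "0 \<le> v t" if "t \<le> \<sigma>" for t using \<sigma>(3) \<sigma>(4)[of t] that by (cases "t = \<sigma>") auto
  have fp: "0 \<le> f t" if t: "0 \<le> t" "t \<le> \<sigma>" for t
  proof -
    have "f 0 \<le> f t"
      by (rule nondecreasing_of_derivative[of 0 t f v]) (use t \<sigma>\<tau> fT' tT vp in auto)
    then show ?thesis using f_0 by simp
  qed
  have v_le: "v t \<le> v 0" if t: "0 \<le> t" "t \<le> \<sigma>" for t
  proof (rule nonincreasing_of_derivative[of 0 t v "\<lambda>t. - f t * v t - B t"])
    fix u assume u: "0 \<le> u" "u \<le> t"
    then have u': "u < \<tau>" "u \<le> \<sigma>" using t \<sigma>\<tau> by auto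
    show "(v has_real_derivative - f u * v u - B u) (at u)" by (rule vT'[OF tT[OF u'(1)]])
    have "0 \<le> f u * v u" using fp[OF u(1) u'(2)] vp[OF u'(2)] by simp
    then show "- f u * v u - B u \<le> 0" using BT_nonneg[OF tT[OF u'(1)]] by simp
  qed (use t in auto)
  have "f 0 < f \<sigma>"
  proof (rule DERIV_pos_imp_increasing_open[OF \<sigma>(1)])
    fix u assume "0 < u" "u < \<sigma>"
    then show "\<exists>y. (f has_real_derivative y) (at u) \<and> 0 < y"
      using fT'[OF tT, of u] \<sigma>(4)[of u] \<sigma>\<tau> by (intro exI[of _ "v u"]) auto
  qed (rule contT(1)[OF tT[OF \<sigma>\<tau>]])
  then have f\<sigma>: "0 < f \<sigma>" using f_0 by simp
  have "B \<sigma> - a ^ 4 / 16 * \<sigma> \<le> B 0 - a ^ 4 / 16 * 0"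
  proof (rule nonincreasing_of_derivative[of 0 \<sigma> "\<lambda>t. B t - a ^ 4 / 16 * t" "\<lambda>t. \<beta> * (v t)\<^sup>2 - a ^ 4 / 16"])
    fix u assume u: "0 \<le> u" "u \<le> \<sigma>"
    show "((\<lambda>t. B t - a ^ 4 / 16 * t) has_real_derivative \<beta> * (v u)\<^sup>2 - a ^ 4 / 16) (at u)"
      using BT'[OF tT, of u] u \<sigma>\<tau> by (auto intro!: derivative_eq_intros)
    have "(v u)\<^sup>2 \<le> (v 0)\<^sup>2" using v_le[OF u] vp[OF u(2)] by (intro power_mono) auto
    \<comment> \<open>The factor \<open>1 - \<beta>\<close> in the bound for \<open>v 0\<close>
      gives \<open>\<beta> * (1 - \<beta>) \<le> 1 / 4\<close>, the source of the constant
      \<open>16\<close>.\<close>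
    then have "\<beta> * (v u)\<^sup>2 \<le> \<beta> * ((1 - \<beta>) * a ^ 4 / 4)"
      using v_0_sq_le \<beta> by (intro mult_left_mono) auto
    also have "\<dots> = \<beta> * (1 - \<beta>) * (a ^ 4 / 4)" by simp
    also have "\<dots> \<le> 1 / 4 * (a ^ 4 / 4)"
    proof (rule mult_right_mono)
      have "0 \<le> (1 / 2 - \<beta>)\<^sup>2" by simp
      then show "\<beta> * (1 - \<beta>) \<le> 1 / 4" by (simp add: power2_eq_square algebra_simps)
    qed simp
    finally show "\<beta> * (v u)\<^sup>2 - a ^ 4 / 16 \<le> 0" by simp
  qed (use \<sigma> in auto)
  then have "B \<sigma> \<le> 2 / 9 * a ^ 3 + a ^ 4 / 16 * \<sigma>" using B_0_le by simp
  then show ?thesis using that \<sigma> \<sigma>\<tau> f\<sigma> by simp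
qed

end

text \<open>For \<open>z = - f\<close>, \<open>\<nu> = - v\<close> the flow \<open>z' = \<nu>\<close>, \<open>\<nu>' = B + z \<nu>\<close>, \<open>B' = \<beta> \<nu>\<^sup>2\<close> is cooperative
  where \<open>\<nu> \<ge> 0\<close>. From its crest on, the solution for \<open>\<beta> < 1\<close> is therefore controlled by a
  rescaling of the solution for \<open>\<beta> = 1\<close>.\<close>

lemma blowup_time_less:
  assumes mf: "maximal_front a \<beta> (ereal \<tau>) f v B" and \<beta>: "0 < \<beta>" "\<beta> < 1"
    and mF: "maximal_front a 1 (ereal \<tau>\<^sub>1) F V C"
  shows "\<tau>\<^sub>1 < \<tau>"
proof (rule ccontr)
  assume "\<not> \<tau>\<^sub>1 < \<tau>"
  then have le: "\<tau> \<le> \<tau>\<^sub>1" by simp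
  interpret f: maximal_front a \<beta> "ereal \<tau>" f v B by (rule mf)
  interpret F: maximal_front a 1 "ereal \<tau>\<^sub>1" F V C by (rule mF)
  have a: "0 < a" by (rule f.left.a)
  note F1 = F.time_beta_1[OF refl refl]
  have \<tau>1: "0 < \<tau>\<^sub>1" using F.T_pos by simp
  obtain \<sigma> where \<sigma>: "0 < \<sigma>" "\<sigma> < \<tau>" "v \<sigma> = 0" "0 < f \<sigma>" "B \<sigma> \<le> 2 / 9 * a ^ 3 + a ^ 4 / 16 * \<sigma>"
    using f.crest[OF \<beta> refl] by blast
  \<comment> \<open>Rescaling by \<open>l\<close> multiplies position, velocity and \<open>C\<close>
    by \<open>l\<close>, \<open>l\<^sup>2\<close> and \<open>l ^ 3\<close>. This \<open>l\<close> is
    large enough to lift \<open>l ^ 3 * C 0\<close> above \<open>B \<sigma>\<close>, and small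
    enough that \<open>l * (\<tau>\<^sub>1 - \<sigma>) = \<theta> < \<tau>\<^sub>1\<close>, so the
    rescaled solution stays regular.\<close>
  define l where "l = 1 + \<sigma> / \<tau>\<^sub>1"
  have l: "1 < l" using \<sigma> \<tau>1 by (simp add: l_def)
  define \<theta> where "\<theta> = \<tau>\<^sub>1 - \<sigma>\<^sup>2 / \<tau>\<^sub>1"
  have \<theta>: "\<theta> < \<tau>\<^sub>1" using \<sigma> \<tau>1 by (simp add: \<theta>_def)
  have ls: "l * s \<le> \<theta>" if "0 \<le> s" "s < \<tau> - \<sigma>" for s
  proof -
    have "l * s \<le> l * (\<tau>\<^sub>1 - \<sigma>)" using that le l by (intro mult_left_mono) auto
    also have "\<dots> = \<theta>" using \<tau>1 by (simp add: l_def \<theta>_def field_simps power2_eq_square)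
    finally show ?thesis .
  qed
  have C_gt: "B \<sigma> < l ^ 3 * C 0"
  proof -
    \<comment> \<open>At \<open>32 / 3\<close> the growth \<open>a ^ 4 / 16 * \<sigma>\<close> of
      \<open>B\<close> up to the crest would equal the linear part of the gain from
      \<open>l ^ 3\<close>; the actual value \<open>2 * pi * sqrt 3 / 3\<close> lies well
      below.\<close>
    have "a * \<tau>\<^sub>1 \<le> 32 / 3"
    proof -
      have "sqrt 3 \<le> 2" by (rule real_le_lsqrt) auto
      then have "pi * sqrt 3 \<le> 4 * 2" using pi_less_4 by (intro mult_mono) auto
      moreover have "a * \<tau>\<^sub>1 = 2 / 3 * (pi * sqrt 3)" using F1(1) a by simp
      ultimately show ?thesis by simp
    qed
    then have "a ^ 3 * \<sigma> * (a * \<tau>\<^sub>1) \<le> a ^ 3 * \<sigma> * (32 / 3)"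
      using a \<sigma> by (intro mult_left_mono) auto
    then have "a ^ 4 * \<sigma> * \<tau>\<^sub>1 \<le> a ^ 3 * \<sigma> * (32 / 3)"
      by (simp add: power3_eq_cube power4_eq_xxxx mult_ac)
    then have 1: "a ^ 4 / 16 * \<sigma> \<le> 2 / 3 * a ^ 3 * (\<sigma> / \<tau>\<^sub>1)"
      using \<tau>1 by (simp add: field_simps)
    have "1 + 3 * x < (1 + x) ^ 3" if "0 < x" for x :: real
    proof -
      have "(1 + x) ^ 3 = 1 + 3 * x + (3 * x\<^sup>2 + x ^ 3)"
        by (simp add: power2_eq_square power3_eq_cube algebra_simps)
      moreover have "0 < 3 * x\<^sup>2 + x ^ 3" using that by (intro add_pos_pos) auto
      ultimately show ?thesis by simp
    qed
    from this[of "\<sigma> / \<tau>\<^sub>1"] have "1 + 3 * (\<sigma> / \<tau>\<^sub>1) < l ^ 3" using \<sigma> \<tau>1 by (simp add: l_def)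
    then have "(1 + 3 * (\<sigma> / \<tau>\<^sub>1)) * (2 / 9 * a ^ 3) < l ^ 3 * (2 / 9 * a ^ 3)"
      using a by (intro mult_strict_right_mono) auto
    moreover have "(1 + 3 * y) * (2 / 9 * c) = 2 / 9 * c + 2 / 3 * c * y" for y c :: real
      by (simp add: algebra_simps)
    ultimately have "2 / 9 * a ^ 3 + 2 / 3 * a ^ 3 * (\<sigma> / \<tau>\<^sub>1) < l ^ 3 * C 0"
      by (simp only: F1(3))
    then show ?thesis using \<sigma>(5) 1 by linarith
  qed
  define Z where "Z = (\<lambda>s. - (l * F (l * s)))"
  define N where "N = (\<lambda>s. - (l\<^sup>2 * V (l * s)))"
  define D where "D = (\<lambda>s. l ^ 3 * C (l * s))"
  have cl: "((\<lambda>s. l * s) has_real_derivative l) (at s)" for s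
    by (auto intro!: derivative_eq_intros)
  have dZ: "(Z has_real_derivative N s) (at s)"
    and dN: "(N has_real_derivative D s + Z s * N s) (at s)"
    and dD: "(D has_real_derivative (N s)\<^sup>2) (at s)" if "0 \<le> s" "s < \<tau> - \<sigma>" for s
  proof -
    have T: "ereal (l * s) < ereal \<tau>\<^sub>1" using ls[OF that] \<theta> by simp
    show "(Z has_real_derivative N s) (at s)"
      unfolding Z_def N_def
      by (rule DERIV_cong[OF DERIV_minus[OF DERIV_cmult[OF DERIV_chain2[OF F.fT'[OF T] cl]]]])
        (simp add: power2_eq_square)
    show "(N has_real_derivative D s + Z s * N s) (at s)"
      unfolding N_def
      by (rule DERIV_cong[OF DERIV_minus[OF DERIV_cmult[OF DERIV_chain2[OF F.vT'[OF T] cl]]]])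
        (simp add: Z_def D_def power2_eq_square power3_eq_cube algebra_simps)
    show "(D has_real_derivative (N s)\<^sup>2) (at s)"
      unfolding D_def
      by (rule DERIV_cong[OF DERIV_cmult[OF DERIV_chain2[OF F.BT'[OF T] cl]]])
        (simp add: N_def power2_eq_square power3_eq_cube algebra_simps)
  qed
  have dz: "((\<lambda>s. - f (s + \<sigma>)) has_real_derivative - v (s + \<sigma>)) (at s)"
    and dn: "((\<lambda>s. - v (s + \<sigma>)) has_real_derivative B (s + \<sigma>) + f (s + \<sigma>) * v (s + \<sigma>)) (at s)"
    and db: "((\<lambda>s. B (s + \<sigma>)) has_real_derivative \<beta> * (v (s + \<sigma>))\<^sup>2) (at s)" if "s < \<tau> - \<sigma>" for s
  proof -
    have T: "ereal (s + \<sigma>) < ereal \<tau>" using that by simp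
    show "((\<lambda>s. - f (s + \<sigma>)) has_real_derivative - v (s + \<sigma>)) (at s)"
      by (intro DERIV_minus shift_derivative f.fT' T)
    show "((\<lambda>s. - v (s + \<sigma>)) has_real_derivative B (s + \<sigma>) + f (s + \<sigma>) * v (s + \<sigma>)) (at s)"
      by (rule DERIV_cong[OF DERIV_minus[OF shift_derivative[OF f.vT'[OF T]]]]) simp
    show "((\<lambda>s. B (s + \<sigma>)) has_real_derivative \<beta> * (v (s + \<sigma>))\<^sup>2) (at s)"
      by (intro shift_derivative f.BT' T)
  qed
  have n0: "v (s + \<sigma>) \<le> 0" if "0 \<le> s" "s < \<tau> - \<sigma>" for s
    using f.v_neg_after[OF \<beta>(1), of \<sigma> "s + \<sigma>"] \<sigma> that by (cases "s = 0") auto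
  have Z0: "0 \<le> Z s" if "0 \<le> s" "s < \<tau> - \<sigma>" for s
  proof -
    have "F (l * s) \<le> 0"
      using F1(4)[of "l * s"] F.f_0 ls[OF that] \<theta> that l by (cases "s = 0") (auto intro!: less_imp_le)
    then show ?thesis using l by (simp add: Z_def mult_nonneg_nonpos)
  qed
  have Zz: "- f (t + \<sigma>) \<le> Z t" if nN: "\<And>u. 0 \<le> u \<Longrightarrow> u \<le> t \<Longrightarrow> - v (u + \<sigma>) \<le> N u" and t: "0 \<le> t" "t < \<tau> - \<sigma>" for t
  proof -
    have "Z 0 - - f (0 + \<sigma>) \<le> Z t - - f (t + \<sigma>)"
    proof (rule nondecreasing_of_derivative[of 0 t "\<lambda>s. Z s - - f (s + \<sigma>)" "\<lambda>s. N s - - v (s + \<sigma>)"])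
      fix u assume u: "0 \<le> u" "u \<le> t"
      then have u': "u < \<tau> - \<sigma>" using t by simp
      show "((\<lambda>s. Z s - - f (s + \<sigma>)) has_real_derivative N u - - v (u + \<sigma>)) (at u)"
        by (rule DERIV_diff[OF dZ[OF u(1) u'] dz[OF u']])
      show "0 \<le> N u - - v (u + \<sigma>)" using nN[OF u] by simp
    qed (rule t(1))
    then show ?thesis using \<sigma>(4) F.f_0 by (simp add: Z_def)
  qed
  \<comment> \<open>Both velocities vanish at the start. As long as \<open>N\<close> has dominated,
    integration keeps \<open>D\<close> above \<open>B\<close> and \<open>Z\<close> above
    \<open>- f\<close>; the strict gap between \<open>D\<close> and \<open>B\<close> makes the
    derivative of the difference positive even where the velocities coincide.\<close>
  have nN: "0 \<le> N t - - v (t + \<sigma>)" if t: "0 \<le> t" "t < \<tau> - \<sigma>" for t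
  proof (rule barrier[of 0 t "\<lambda>s. N s - - v (s + \<sigma>)"
        "\<lambda>s. (D s + Z s * N s) - (B (s + \<sigma>) + f (s + \<sigma>) * v (s + \<sigma>))" t])
    fix s assume s: "0 \<le> s" "s \<le> t"
    then have s': "s < \<tau> - \<sigma>" using t by simp
    show "((\<lambda>s. N s - - v (s + \<sigma>)) has_real_derivative
        (D s + Z s * N s) - (B (s + \<sigma>) + f (s + \<sigma>) * v (s + \<sigma>))) (at s)"
      by (rule DERIV_diff[OF dN[OF s(1) s'] dn[OF s']])
    assume "\<And>u. 0 \<le> u \<Longrightarrow> u \<le> s \<Longrightarrow> 0 \<le> N u - - v (u + \<sigma>)"
    then have le: "- v (u + \<sigma>) \<le> N u" if "0 \<le> u" "u \<le> s" for u using that by force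
    have "D 0 - B (0 + \<sigma>) \<le> D s - B (s + \<sigma>)"
    proof (rule nondecreasing_of_derivative[of 0 s "\<lambda>s. D s - B (s + \<sigma>)" "\<lambda>s. (N s)\<^sup>2 - \<beta> * (v (s + \<sigma>))\<^sup>2"])
      fix u assume u: "0 \<le> u" "u \<le> s"
      then have u': "u < \<tau> - \<sigma>" using s' by simp
      show "((\<lambda>s. D s - B (s + \<sigma>)) has_real_derivative (N u)\<^sup>2 - \<beta> * (v (u + \<sigma>))\<^sup>2) (at u)"
        by (rule DERIV_diff[OF dD[OF u(1) u'] db[OF u']])
      have "\<beta> * (v (u + \<sigma>))\<^sup>2 \<le> 1 * (- v (u + \<sigma>))\<^sup>2"
        using \<beta> by (intro mult_mono) auto
      also have "\<dots> \<le> (N u)\<^sup>2"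
        using le[OF u] n0[OF u(1) u'] by (simp only: mult_1) (rule power_mono, auto)
      finally show "0 \<le> (N u)\<^sup>2 - \<beta> * (v (u + \<sigma>))\<^sup>2" by simp
    qed (use s in auto)
    then have 1: "0 < D s - B (s + \<sigma>)" using C_gt by (simp add: D_def)
    have z: "- f (s + \<sigma>) \<le> Z s" by (rule Zz[OF le s(1) s'])
    have "- f (s + \<sigma>) * - v (s + \<sigma>) \<le> Z s * - v (s + \<sigma>)"
      using z n0[OF s(1) s'] by (intro mult_right_mono) auto
    also have "\<dots> \<le> Z s * N s" using le[of s] s Z0[OF s(1) s'] by (intro mult_left_mono) auto
    finally show "0 < (D s + Z s * N s) - (B (s + \<sigma>) + f (s + \<sigma>) * v (s + \<sigma>))" using 1 by simp
  qed (use t \<sigma>(3) F1(2) in \<open>auto simp: N_def\<close>)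
  obtain K where K: "0 \<le> K" "\<And>x. 0 \<le> x \<Longrightarrow> x \<le> \<theta> \<Longrightarrow> \<bar>F x\<bar> \<le> K"
    using bounded_on_Icc[OF F.contT(1)[of \<theta> 0]] \<theta> by auto
  have "- (l * K) \<le> f t" if t: "\<sigma> \<le> t" "t < \<tau>" for t
  proof -
    define s where "s = t - \<sigma>"
    have s: "0 \<le> s" "s < \<tau> - \<sigma>" using t by (auto simp: s_def)
    have "- f (s + \<sigma>) \<le> Z s" by (rule Zz[OF _ s]) (use nN s in force)
    also have "Z s = l * - F (l * s)" by (simp add: Z_def)
    also have "\<dots> \<le> l * K"
      using K(2)[of "l * s"] ls[OF s] l s by (intro mult_left_mono) auto
    finally show ?thesis by (simp add: s_def)
  qed
  moreover have "\<forall>\<^sub>F t in at_left \<tau>. f t \<le> - (l * K) - 1"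
    using f.f_at_bot[OF \<beta>(1) refl] unfolding filterlim_at_bot by blast
  then have "\<forall>\<^sub>F t in at_left \<tau>. f t \<le> - (l * K) - 1 \<and> \<sigma> \<le> t \<and> t < \<tau>"
    using eventually_at_left_from[OF \<sigma>(2)] by (rule eventually_conj)
  then have "\<exists>t. f t \<le> - (l * K) - 1 \<and> \<sigma> \<le> t \<and> t < \<tau>"
    by (rule eventually_happens'[OF trivial_limit_at_left_real])
  ultimately show False by force
qed

section \<open>The boundary value problem\<close>

lemma ode_factor:
  fixes m \<beta> :: real
  assumes "\<beta> = (1 - 2 * m) / m"
  shows "(2 * m - 1) / m = - \<beta>"
  unfolding assms minus_divide_left by simp

lemma ode_solutionI:
  assumes \<beta>: "\<beta> = (1 - 2 * m) / m"
    and f: "\<And>t. t \<in> I \<Longrightarrow> (f has_real_derivative v t) (at t)"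
    and v: "\<And>t. t \<in> I \<Longrightarrow> (v has_real_derivative - f t * v t - B t) (at t)"
    and B: "\<And>t. t \<in> I \<Longrightarrow> (B has_real_derivative \<beta> * (v t)\<^sup>2) (at t)"
  shows "ode_solution m I f v (\<lambda>t. - f t * v t - B t)"
  unfolding ode_solution_def
proof (intro ballI conjI)
  fix t assume t: "t \<in> I"
  show "(f has_real_derivative v t) (at t within I)"
    by (rule has_field_derivative_at_within[OF f[OF t]])
  show "(v has_real_derivative - f t * v t - B t) (at t within I)"
    by (rule has_field_derivative_at_within[OF v[OF t]])
  have "((\<lambda>s. - B s) has_real_derivative - (\<beta> * (v t)\<^sup>2)) (at t within I)"
    by (rule has_field_derivative_at_within[OF DERIV_minus[OF B[OF t]]])
  moreover have "- (\<beta> * (v t)\<^sup>2) = (2 * m - 1) / m * (v t)\<^sup>2"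
    unfolding ode_factor[OF \<beta>] by (rule mult_minus_left[symmetric])
  moreover have "(\<lambda>s. - f s * v s - B s + f s * v s) = (\<lambda>s. - B s)" by (rule ext) simp
  ultimately show "((\<lambda>s. - f s * v s - B s + f s * v s) has_real_derivative (2 * m - 1) / m * (v t)\<^sup>2) (at t within I)"
    by (simp only:)
qed

lemma ode_solutionD:
  assumes sol: "ode_solution m I f v f2" and \<beta>: "\<beta> = (1 - 2 * m) / m"
    and t: "t \<in> interior I"
  shows "(f has_real_derivative v t) (at t)"
    and "(v has_real_derivative - f t * v t - - (f2 t + f t * v t)) (at t)"
    and "((\<lambda>t. - (f2 t + f t * v t)) has_real_derivative \<beta> * (v t)\<^sup>2) (at t)"
proof -
  have "t \<in> I" using t interior_subset by blast
  then have "(f has_real_derivative v t) (at t within I)" "(v has_real_derivative f2 t) (at t within I)"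
    "((\<lambda>s. f2 s + f s * v s) has_real_derivative (2 * m - 1) / m * (v t)\<^sup>2) (at t within I)"
    using sol unfolding ode_solution_def by blast+
  then have d: "(f has_real_derivative v t) (at t)" "(v has_real_derivative f2 t) (at t)"
    "((\<lambda>s. f2 s + f s * v s) has_real_derivative (2 * m - 1) / m * (v t)\<^sup>2) (at t)"
    by (simp_all only: at_within_interior[OF t])
  show "(f has_real_derivative v t) (at t)" by (rule d)
  show "(v has_real_derivative - f t * v t - - (f2 t + f t * v t)) (at t)" using d(2) by simp
  have "- ((2 * m - 1) / m * (v t)\<^sup>2) = \<beta> * (v t)\<^sup>2"
    unfolding ode_factor[OF \<beta>] by (simp only: mult_minus_left minus_minus)
  then show "((\<lambda>t. - (f2 t + f t * v t)) has_real_derivative \<beta> * (v t)\<^sup>2) (at t)"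
    using DERIV_minus[OF d(3)] by simp
qed

lemma tendsto_of_exp_decay:
  fixes g :: "real \<Rightarrow> real"
  assumes "((\<lambda>t. exp (- \<epsilon> * t) * g t) \<longlongrightarrow> 0) at_bot" "0 < \<epsilon>"
  shows "(g \<longlongrightarrow> 0) at_bot"
proof -
  have "((\<lambda>t. exp (\<epsilon> * t)) \<longlongrightarrow> 0) at_bot"
    by (rule filterlim_compose[OF exp_at_bot])
      (rule filterlim_tendsto_pos_mult_at_bot[OF tendsto_const assms(2) filterlim_ident])
  from tendsto_mult[OF this assms(1)]
  have "((\<lambda>t. exp (\<epsilon> * t) * (exp (- \<epsilon> * t) * g t)) \<longlongrightarrow> 0) at_bot" by simp
  moreover have "exp (\<epsilon> * t) * (exp (- \<epsilon> * t) * g t) = g t" for t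
    by (simp add: mult.assoc[symmetric] exp_add[symmetric])
  ultimately show ?thesis by (simp only:)
qed

text \<open>At the endpoint 0 the derivatives are one-sided, so the flow is asserted below 0 only;
  continuity up to 0 is recorded in order to pass to limits there.\<close>

lemma front_of_bvp:
  assumes bvp: "bvp_solution m a g" and a: "0 < a" and \<beta>: "\<beta> = (1 - 2 * m) / m" "0 \<le> \<beta>"
  obtains v B where "front a \<beta> 0 g v B" "g 0 = 0" "continuous_on {..0} g" "continuous_on {..0} v" "continuous_on {..0} B"
proof -
  obtain v f2 where sol: "ode_solution m {..0} g v f2"
    and lims: "\<And>\<epsilon>. 0 < \<epsilon> \<and> \<epsilon> < a \<Longrightarrow>
          ((\<lambda>t. exp (- \<epsilon> * t) * (g t + a)) \<longlongrightarrow> 0) at_bot \<and>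
          ((\<lambda>t. exp (- \<epsilon> * t) * v t) \<longlongrightarrow> 0) at_bot \<and>
          ((\<lambda>t. exp (- \<epsilon> * t) * f2 t) \<longlongrightarrow> 0) at_bot"
    and g0: "g 0 = 0"
    using bvp unfolding bvp_solution_def by blast
  define B where "B = (\<lambda>t. - (f2 t + g t * v t))"
  have half: "0 < a / 2 \<and> a / 2 < a" using a by simp
  have l: "((\<lambda>t. g t + a) \<longlongrightarrow> 0) at_bot" "(v \<longlongrightarrow> 0) at_bot" "(f2 \<longlongrightarrow> 0) at_bot"
  proof -
    note L = lims[OF half]
    show "((\<lambda>t. g t + a) \<longlongrightarrow> 0) at_bot"
      by (rule tendsto_of_exp_decay[OF conjunct1[OF L] conjunct1[OF half]])
    show "(v \<longlongrightarrow> 0) at_bot"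
      by (rule tendsto_of_exp_decay[OF conjunct1[OF conjunct2[OF L]] conjunct1[OF half]])
    show "(f2 \<longlongrightarrow> 0) at_bot"
      by (rule tendsto_of_exp_decay[OF conjunct2[OF conjunct2[OF L]] conjunct1[OF half]])
  qed
  have lg: "(g \<longlongrightarrow> - a) at_bot" using tendsto_diff[OF l(1) tendsto_const[of a]] by simp
  have "(B \<longlongrightarrow> - (0 + - a * 0)) at_bot" unfolding B_def by (intro tendsto_intros l lg)
  then have lB: "(B \<longlongrightarrow> 0) at_bot" by simp
  have "front a \<beta> 0 g v B"
  proof
    fix t :: real assume "t < 0"
    then have t: "t \<in> interior {..0}" by simp
    note D = ode_solutionD[OF sol \<beta>(1) t]
    show "(g has_real_derivative v t) (at t)" by (rule D(1))
    show "(v has_real_derivative - g t * v t - B t) (at t)" using D(2) by (simp only: B_def)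
    show "(B has_real_derivative \<beta> * (v t)\<^sup>2) (at t)" using D(3) by (simp only: B_def)
  qed (rule a \<beta>(2) lg l(2) lB)+
  moreover have cont: "continuous_on {..0} g" "continuous_on {..0} v" "continuous_on {..0} (\<lambda>s. f2 s + g s * v s)"
    using sol unfolding ode_solution_def by (auto intro: DERIV_continuous_on)
  moreover have "continuous_on {..0} B" unfolding B_def by (intro continuous_on_minus cont)
  ultimately show ?thesis using that g0 by blast
qed

lemma continuous_on_atMost_left:
  fixes g :: "real \<Rightarrow> real"
  assumes "continuous_on {..c} g" "s \<le> c"
  shows "(g \<longlongrightarrow> g s) (at_left s)"
proof -
  have "(g \<longlongrightarrow> g s) (at s within {..c})" using assms by (simp add: continuous_on_def)
  then show ?thesis by (rule tendsto_within_subset) (use assms(2) in auto)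
qed

lemma no_bvp_solution:
  assumes a: "0 < a" and m: "0 < m" "m < 1 / 3"
  shows "\<not> bvp_solution m a g"
proof
  assume bvp: "bvp_solution m a g"
  define \<beta> where "\<beta> = (1 - 2 * m) / m"
  have \<beta>: "1 < \<beta>" using m by (simp add: \<beta>_def field_simps)
  have \<beta>0: "0 \<le> \<beta>" using \<beta> by simp
  obtain v B where fr: "front a \<beta> 0 g v B" and g0: "g 0 = 0"
    and c: "continuous_on {..0} g" "continuous_on {..0} v" "continuous_on {..0} B"
    by (rule front_of_bvp[OF bvp a \<beta>_def \<beta>0])
  have "\<forall>\<^sub>F t in at_bot. g t < 0"
    using front.lim_f[OF fr] a by (intro order_tendstoD(2)) auto
  then obtain s where s: "\<And>t. t \<le> s \<Longrightarrow> g t < 0" unfolding eventually_at_bot_linorder by blast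
  have "continuous_on {s..0} g" using c(1) by (rule continuous_on_subset) auto
  \<comment> \<open>The sign of \<open>g\<close> is not prescribed, so its first zero may come
    before 0; the argument applies on the part up to \<open>z\<close>.\<close>
  then obtain z where z: "s < z" "z \<le> 0" "g z = 0" "\<And>t. t < z \<Longrightarrow> g t < 0"
    using first_nonneg[of s 0 g] s g0 by auto
  have "front a \<beta> z g v B"
  proof
    fix t assume "t < z"
    then have t: "t < 0" using z by simp
    show "(g has_real_derivative v t) (at t)" by (rule front.f'[OF fr t])
    show "(v has_real_derivative - g t * v t - B t) (at t)" by (rule front.v'[OF fr t])
    show "(B has_real_derivative \<beta> * (v t)\<^sup>2) (at t)" by (rule front.B'[OF fr t])
  qed (rule a \<beta>0 front.lim_f[OF fr] front.lim_v[OF fr] front.lim_B[OF fr])+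
  then show False
    by (rule front.nonexistence[OF _ \<beta> z(4)])
      (use continuous_on_atMost_left[OF c(1) z(2)] continuous_on_atMost_left[OF c(2) z(2)]
        continuous_on_atMost_left[OF c(3) z(2)] z(3) in auto)
qed

lemma rising_front_of_bvp:
  assumes bvp: "bvp_solution m a g" and a: "0 < a" and m: "1 / 3 \<le> m" "m \<le> 1 / 2" and \<beta>: "\<beta> = (1 - 2 * m) / m"
    and cond: "m = 1 / 3 \<or> m = 1 / 2 \<or> (\<forall>t\<le>0. g t \<le> 0)"
  obtains v B where "rising_front a \<beta> 0 g v B" "g 0 = 0"
proof -
  have \<beta>0: "0 \<le> \<beta>" "\<beta> \<le> 1" using m by (auto simp: \<beta> field_simps)
  obtain v B where fr: "front a \<beta> 0 g v B" and g0: "g 0 = 0" and c: "continuous_on {..0} g"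
    by (rule front_of_bvp[OF bvp a \<beta> \<beta>0(1)])
  have left: "(g \<longlongrightarrow> 0) (at_left 0)" using continuous_on_atMost_left[OF c, of 0] g0 by simp
  have "0 < v t" if t: "t < 0" for t
  proof (cases "m = 1 / 2")
    case True
    then show ?thesis using front.rising_of_beta_0[OF fr _ left t] by (simp add: \<beta>)
  next
    case False
    have "g u \<le> 0" if "u < 0" for u
      using cond False front.nonpos_of_beta_1[OF fr _ that] that by (auto simp: \<beta>)
    then show ?thesis using front.rising_of_nonpos[OF fr _ left t] by blast
  qed
  then have "rising_front a \<beta> 0 g v B"
    by (intro rising_front.intro rising_front_axioms.intro fr \<beta>0 left)
  then show ?thesis using that g0 by blast
qed

section \<open>Inflection point, impossibility of a global extension, and the pole\<close>

context maximal_front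
begin

abbreviation "acc t \<equiv> - f t * v t - B t"

lemma acc':
  assumes "ereal t < T"
  shows "((\<lambda>t. acc t) has_real_derivative - f t * acc t - (1 + \<beta>) * (v t)\<^sup>2) (at t)"
  by (rule DERIV_cong, (rule derivative_eq_intros fT'[OF assms] vT'[OF assms] BT'[OF assms] refl)+)
    (simp add: power2_eq_square algebra_simps)

text \<open>The acceleration solves a linear equation with forcing
  \<open>- (1 + \<beta>) * v\<^sup>2 < 0\<close>, so it can change sign only once, from positive to
  negative.\<close>

lemma acc_neg_after:
  assumes "acc s \<le> 0" "s < t" "t \<le> 0"
  shows "acc t < 0"
proof -
  have T: "ereal u < T" if "u \<le> t" for u using less_T[OF _ zero_less_T] that assms by simp
  show ?thesis
  proof (rule linear_ode_neg[OF assms(2) contT(1)[OF T[OF order_refl]], where x = acc and b = "\<lambda>u. (1 + \<beta>) * (v u)\<^sup>2"])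
    fix u assume "s < u" "u < t"
    then have "0 < v u" using left.v_pos[of u] assms by simp
    then show "0 < (1 + \<beta>) * (v u)\<^sup>2" using left.\<beta> by (intro mult_pos_pos) auto
  qed (use acc' T assms in auto)
qed

text \<open>If the acceleration were nowhere positive, \<open>v\<close> could not exceed its limit 0
  at minus infinity; at the zero of \<open>f\<close> it equals \<open>- B 0 < 0\<close>.\<close>

lemma ex_acc_zero:
  assumes "0 < \<beta>"
  obtains s where "s < 0" "acc s = 0" "\<And>t. t < s \<Longrightarrow> 0 < acc t" "\<And>t. s < t \<Longrightarrow> t \<le> 0 \<Longrightarrow> acc t < 0"
proof -
  have "\<exists>r<0. 0 < acc r"
  proof (rule ccontr)
    assume "\<not> (\<exists>r<0. 0 < acc r)"
    then have neg: "acc r \<le> 0" if "r < 0" for r using that by force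
    have "v (-1) \<le> 0"
    proof (rule le_limit_at_bot[OF left.v' _ left.lim_v])
      fix x :: real assume "x \<le> - 1"
      then show "acc x \<le> 0" "x < 0" using neg[of x] by simp_all
    qed
    then show False using left.v_pos[of "-1"] by simp
  qed
  then obtain r where r: "r < 0" "0 < acc r" by blast
  have acc0: "acc 0 < 0" using B_0_pos[OF assms] f_0 by simp
  have "continuous_on {r..0} acc" by (intro continuous_intros contT zero_less_T)
  then obtain s where s: "r \<le> s" "s \<le> 0" "acc s = 0"
    using IVT2'[of acc 0 0 r] r acc0 by auto
  have "s \<noteq> 0" using s(3) acc0 by auto
  then have s0: "s < 0" using s by simp
  show ?thesis
  proof (rule that[OF s0 s(3)])
    show "0 < acc t" if "t < s" for t
      using acc_neg_after[of t s] that s by force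
    show "acc t < 0" if "s < t" "t \<le> 0" for t
      using acc_neg_after[of s t] that s by auto
  qed
qed

lemma deriv_f: "t < 0 \<Longrightarrow> deriv f t = v t"
  by (rule DERIV_imp_deriv[OF left.f'])

lemma deriv_f': "t < 0 \<Longrightarrow> (deriv f has_real_derivative acc t) (at t)"
  by (rule has_field_derivative_transform_within_open[OF left.v', of _ "{..<0}"]) (auto simp: deriv_f)

lemma inflection_point_f:
  assumes s: "s < 0" "\<And>t. t < s \<Longrightarrow> 0 < acc t" "\<And>t. s < t \<Longrightarrow> t \<le> 0 \<Longrightarrow> acc t < 0"
  shows "inflection_point f s"
  unfolding inflection_point_def
proof (intro exI[of _ "- s"] conjI)
  show "\<forall>t. \<bar>t - s\<bar> < - s \<longrightarrow> f differentiable at t \<and> deriv f differentiable at t"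
    using left.f' deriv_f' by (auto simp: real_differentiable_def abs_less_iff)
  have "deriv (deriv f) t = acc t" if "t < 0" for t
    by (rule DERIV_imp_deriv[OF deriv_f'[OF that]])
  then show "(\<forall>t\<in>{s - - s<..<s}. 0 < deriv (deriv f) t) \<and> (\<forall>t\<in>{s<..<s + - s}. deriv (deriv f) t < 0) \<or>
    (\<forall>t\<in>{s - - s<..<s}. deriv (deriv f) t < 0) \<and> (\<forall>t\<in>{s<..<s + - s}. 0 < deriv (deriv f) t)"
    using s by auto
qed (use s in simp)

text \<open>\<open>B / \<beta>\<close> is the integral of \<open>v\<^sup>2\<close> from minus
  infinity, so the relation reads \<open>f * v = - B\<close>.\<close>

lemma inflection_relation_iff:
  assumes \<beta>: "0 < \<beta>" "\<beta> = (1 - 2 * m) / m" and t: "t < 0"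
  shows "inflection_relation m f t \<longleftrightarrow> acc t = 0"
proof -
  have "((\<lambda>s. (v s)\<^sup>2) has_integral (B t / \<beta> - 0 / \<beta>)) {..t}"
  proof (rule has_integral_atMost)
    fix x assume "x \<le> t"
    then have "x < 0" using t by simp
    then show "((\<lambda>s. B s / \<beta>) has_real_derivative (v x)\<^sup>2) (at x)"
      using DERIV_cdivide[OF left.B', of x \<beta>] \<beta>(1) by simp
  next
    show "((\<lambda>s. B s / \<beta>) \<longlongrightarrow> 0 / \<beta>) at_bot"
      using \<beta> by (intro tendsto_intros left.lim_B) auto
  qed simp
  then have "((\<lambda>s. (deriv f s)\<^sup>2) has_integral (B t / \<beta>)) {..t}"
    using deriv_f t by (subst has_integral_cong[of _ _ "\<lambda>s. (v s)\<^sup>2"]) auto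
  then have i: "(\<lambda>s. (deriv f s)\<^sup>2) integrable_on {..t}" "integral {..t} (\<lambda>s. (deriv f s)\<^sup>2) = B t / \<beta>"
    by (auto simp: integral_unique has_integral_integrable)
  have "inflection_relation m f t \<longleftrightarrow> f t * v t = - \<beta> * (B t / \<beta>)"
    unfolding inflection_relation_def \<beta>(2)[symmetric] using i deriv_f[OF t] by auto
  also have "- \<beta> * (B t / \<beta>) = - B t" using \<beta>(1) by simp
  also have "f t * v t = - B t \<longleftrightarrow> acc t = 0" by auto
  finally show ?thesis .
qed

text \<open>The component \<open>C\<close> of the extension agrees with \<open>B\<close> at
  \<open>-1\<close>, an interior point of the common domain. It is positive there and nondecreasing
  afterwards, which \<open>no_global_descent\<close> excludes.\<close>

lemma no_global_extension:
  assumes \<beta>: "0 < \<beta>" "\<beta> = (1 - 2 * m) / m"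
    and sol: "solves_ode_on m UNIV F" and eq: "\<And>t. t \<le> 0 \<Longrightarrow> F t = f t"
  shows False
proof -
  obtain F1 F2 where "ode_solution m UNIV F F1 F2" using sol by (auto simp: solves_ode_on_def)
  note D = ode_solutionD[OF this \<beta>(2)]
  define C where "C = (\<lambda>t. - (F2 t + F t * F1 t))"
  have dF: "(F has_real_derivative F1 t) (at t)" and dF1: "(F1 has_real_derivative - F t * F1 t - C t) (at t)"
    and dC: "(C has_real_derivative \<beta> * (F1 t)\<^sup>2) (at t)" for t
    using D[of t] by (auto simp: C_def)
  have F1: "F1 t = v t" if "t < 0" for t
  proof -
    have "(F has_real_derivative v t) (at t)"
      by (rule has_field_derivative_transform_within_open[OF left.f'[OF that], of "{..<0}"]) (use that eq in auto)
    then show ?thesis using dF DERIV_unique by blast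
  qed
  have "(F1 has_real_derivative - f (-1) * v (-1) - B (-1)) (at (-1))"
    by (rule has_field_derivative_transform_within_open[OF left.v', of "-1" "{..<0}"]) (use F1 in auto)
  then have "- F (-1) * F1 (-1) - C (-1) = - f (-1) * v (-1) - B (-1)"
    using dF1 DERIV_unique by blast
  then have C1: "C (-1) = B (-1)" using F1[of "-1"] eq[of "-1"] by simp
  have "0 < C (-1)"
    unfolding C1 using left.B_pos[OF \<beta>(1), of "-1" "-2"] left.f_gt[of "-2"] by simp
  moreover have "C (-1) \<le> C t" if "0 \<le> t" for t
    by (rule nondecreasing_of_derivative[of "-1" t C "\<lambda>t. \<beta> * (F1 t)\<^sup>2"]) (use dC \<beta>(1) that in auto)
  ultimately show False
    by (intro no_global_descent[of F F1 C "C (-1)"] dF dF1) auto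
qed

lemma simple_pole:
  assumes \<beta>: "0 < \<beta>" "\<beta> = (1 - 2 * m) / m" and m: "0 < m" and T: "T = ereal \<tau>"
  shows "simple_pole_at m f \<tau>"
  unfolding simple_pole_at_def
proof (rule asymp_equivI')
  have "6 / (3 + \<beta>) = 6 * m / (m + 1)" using m by (simp add: \<beta>(2) field_simps)
  then have "((\<lambda>t. f t * (t - \<tau>)) \<longlongrightarrow> 6 * m / (m + 1)) (at_left \<tau>)"
    using f_pole[OF \<beta>(1) T] by simp
  then have "((\<lambda>t. f t * (t - \<tau>) / (6 * m / (m + 1))) \<longlongrightarrow> 6 * m / (m + 1) / (6 * m / (m + 1))) (at_left \<tau>)"
    using m by (intro tendsto_divide tendsto_const) auto
  then show "((\<lambda>t. f t / (6 * m / ((m + 1) * (t - \<tau>)))) \<longlongrightarrow> 1) (at_left \<tau>)"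
    using m by (simp add: field_simps)
qed

end

text \<open>The last conjunct retains the underlying flow with its lifetime, so that the blow-up
  times of different \<open>m\<close> can be compared after the solutions have been chosen.\<close>

lemma solution_exists:
  assumes a: "0 < a" and m: "1 / 3 \<le> m" "m \<le> 1 / 2"
  shows "\<exists>f \<tau>\<^sub>i \<tau>\<^sub>p. bvp_solution m a f \<and>
       (\<forall>g. bvp_solution m a g \<and> (m = 1 / 3 \<or> m = 1 / 2 \<or> (\<forall>\<tau>\<le>0. g \<tau> \<le> 0)) \<longrightarrow> (\<forall>\<tau>\<le>0. g \<tau> = f \<tau>)) \<and>
       strict_mono_on {..0} f \<and> (\<exists>d>0. lyapunov_member m a d {..0} f) \<and>
       (\<forall>\<tau>\<le>0. phi_half a \<tau> \<le> f \<tau> \<and> f \<tau> \<le> phi_third a \<tau>) \<and>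
       (m < 1 / 2 \<longrightarrow> \<tau>\<^sub>i < 0 \<and> inflection_point f \<tau>\<^sub>i \<and>
         (\<forall>\<tau><0. inflection_relation m f \<tau> \<longleftrightarrow> \<tau> = \<tau>\<^sub>i) \<and>
         \<not> (\<exists>F. solves_ode_on m UNIV F \<and> (\<forall>\<tau>\<le>0. F \<tau> = f \<tau>)) \<and> \<tau>\<^sub>p > 0 \<and>
         (\<exists>F. solves_ode_on m {..<\<tau>\<^sub>p} F \<and> (\<forall>\<tau>\<le>0. F \<tau> = f \<tau>) \<and> simple_pole_at m F \<tau>\<^sub>p) \<and>
         (\<exists>v B. maximal_front a ((1 - 2 * m) / m) (ereal \<tau>\<^sub>p) f v B))"
proof -
  define \<beta> where "\<beta> = (1 - 2 * m) / m"
  have m0: "0 < m" "m \<noteq> 0" and \<beta>: "0 \<le> \<beta>" "\<beta> \<le> 1" using m by (auto simp: \<beta>_def field_simps)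
  obtain T f v B d where mf: "maximal_front a \<beta> T f v B" and d: "0 < d"
    and series: "\<exists>\<delta>>0. \<forall>t. \<bar>d * exp (a * t)\<bar> < \<delta> \<longrightarrow> (\<lambda>l. lyapunov_coeff m a l * d ^ l * exp (real l * a * t)) sums (f t + a)"
    and lims: "\<And>\<epsilon>. \<epsilon> < a \<Longrightarrow> ((\<lambda>t. exp (- \<epsilon> * t) * (f t + a)) \<longlongrightarrow> 0) at_bot"
    "\<And>\<epsilon>. \<epsilon> < a \<Longrightarrow> ((\<lambda>t. exp (- \<epsilon> * t) * v t) \<longlongrightarrow> 0) at_bot"
    "\<And>\<epsilon>. \<epsilon> < a \<Longrightarrow> ((\<lambda>t. exp (- \<epsilon> * t) * (- f t * v t - B t)) \<longlongrightarrow> 0) at_bot"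
    by (rule maximal_front_exists[OF a m0(2) \<beta>_def \<beta>]) (rule that)
  interpret f: maximal_front a \<beta> T f v B by (rule mf)
  have sol: "ode_solution m {t. ereal t < T} f v (\<lambda>t. - f t * v t - B t)"
    by (rule ode_solutionI[OF \<beta>_def f.fT' f.vT' f.BT']) simp_all
  have sub: "ode_solution m I f v (\<lambda>t. - f t * v t - B t)" if "I \<subseteq> {t. ereal t < T}" for I
    using sol that unfolding ode_solution_def by (meson DERIV_subset subsetD)
  have sol0: "ode_solution m {..0} f v (\<lambda>t. - f t * v t - B t)"
    by (rule sub) (use f.less_T[OF _ f.zero_less_T] in auto)
  have "bvp_solution m a f"
    unfolding bvp_solution_def using sol0 lims f.f_0 by blast
  moreover have "g t = f t"
    if g: "bvp_solution m a g \<and> (m = 1 / 3 \<or> m = 1 / 2 \<or> (\<forall>\<tau>\<le>0. g \<tau> \<le> 0))" and t: "t \<le> 0" for g t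
  proof -
    obtain w C where "rising_front a \<beta> 0 g w C" "g 0 = 0"
      using rising_front_of_bvp[OF _ a m \<beta>_def] g by blast
    then show ?thesis
      using rising_front_unique[OF _ f.rising, of g w C t] t f.f_0 by (cases "t = 0") auto
  qed
  moreover have "strict_mono_on {..0} f"
    by (rule strict_mono_onI) (use f.left.f_less f.left.f_neg f.f_0 in \<open>metis atMost_iff le_less\<close>)
  moreover have "\<exists>d>0. lyapunov_member m a d {..0} f"
    using d series sol0 unfolding lyapunov_member_def solves_ode_on_def by blast
  moreover have "phi_half a t \<le> f t \<and> f t \<le> phi_third a t" if "t \<le> 0" for t
  proof (cases "t = 0")
    case True
    have "phi_third a 0 = 0" by (rule phi_third_eqI[OF a]) (use a in auto)
    then show ?thesis using True f.f_0 by (simp add: phi_half_def)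
  next
    case False
    then show ?thesis using f.left.phi_half_le[OF refl] f.left.le_phi_third[OF refl] that by simp
  qed
  moreover have "\<exists>\<tau>\<^sub>i \<tau>\<^sub>p. m < 1 / 2 \<longrightarrow> \<tau>\<^sub>i < 0 \<and> inflection_point f \<tau>\<^sub>i \<and>
         (\<forall>\<tau><0. inflection_relation m f \<tau> \<longleftrightarrow> \<tau> = \<tau>\<^sub>i) \<and>
         \<not> (\<exists>F. solves_ode_on m UNIV F \<and> (\<forall>\<tau>\<le>0. F \<tau> = f \<tau>)) \<and> \<tau>\<^sub>p > 0 \<and>
         (\<exists>F. solves_ode_on m {..<\<tau>\<^sub>p} F \<and> (\<forall>\<tau>\<le>0. F \<tau> = f \<tau>) \<and> simple_pole_at m F \<tau>\<^sub>p) \<and>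
         (\<exists>v B. maximal_front a ((1 - 2 * m) / m) (ereal \<tau>\<^sub>p) f v B)"
  proof (cases "m < 1 / 2")
    case True
    then have \<beta>p: "0 < \<beta>" using m0 by (simp add: \<beta>_def)
    obtain \<tau> where \<tau>: "T = ereal \<tau>" "0 < \<tau>" using f.T_finite[OF \<beta>p] by blast
    obtain s where s: "s < 0" "f.acc s = 0" "\<And>t. t < s \<Longrightarrow> 0 < f.acc t" "\<And>t. s < t \<Longrightarrow> t \<le> 0 \<Longrightarrow> f.acc t < 0"
      by (rule f.ex_acc_zero[OF \<beta>p]) blast
    have "inflection_relation m f t \<longleftrightarrow> t = s" if "t < 0" for t
      using f.inflection_relation_iff[OF \<beta>p \<beta>_def that] s(2) s(3)[of t] s(4)[of t] that
      by (cases t s rule: linorder_cases) auto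
    moreover have "solves_ode_on m {..<\<tau>} f"
      unfolding solves_ode_on_def using sub[of "{..<\<tau>}"] \<tau> by auto
    ultimately show ?thesis
      using s(1) f.inflection_point_f[OF s(1,3,4)] f.no_global_extension[OF \<beta>p \<beta>_def] \<tau>(2)
        f.simple_pole[OF \<beta>p \<beta>_def m0(1) \<tau>(1)] mf[unfolded \<tau>(1) \<beta>_def]
      by (intro exI[of _ s] exI[of _ \<tau>]) blast
  qed auto
  ultimately show ?thesis by blast
qed

theorem theorem3p2:
  fixes a :: real
  assumes "a > 0"
  shows "\<exists>(\<Phi> :: real \<Rightarrow> real \<Rightarrow> real) (\<tau>\<^sub>i\<^sub>n :: real \<Rightarrow> real) (\<tau>\<^sub>p :: real \<Rightarrow> real).
    (\<forall>m. 1/3 \<le> m \<and> m \<le> 1/2 \<longrightarrow>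
       bvp_solution m a (\<Phi> m) \<and>
       (\<forall>g. bvp_solution m a g \<and> (m = 1/3 \<or> m = 1/2 \<or> (\<forall>\<tau>\<le>0. g \<tau> \<le> 0))
          \<longrightarrow> (\<forall>\<tau>\<le>0. g \<tau> = \<Phi> m \<tau>)) \<and>
       strict_mono_on {..0} (\<Phi> m) \<and>
       (\<exists>d>0. lyapunov_member m a d {..0} (\<Phi> m)) \<and>
       (\<forall>\<tau>\<le>0. phi_half a \<tau> \<le> \<Phi> m \<tau> \<and> \<Phi> m \<tau> \<le> phi_third a \<tau>)) \<and>
    (\<forall>m. 1/3 \<le> m \<and> m < 1/2 \<longrightarrow>
       \<tau>\<^sub>i\<^sub>n m < 0 \<and>
       inflection_point (\<Phi> m) (\<tau>\<^sub>i\<^sub>n m) \<and>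
       (\<forall>\<tau><0. inflection_relation m (\<Phi> m) \<tau> \<longleftrightarrow> \<tau> = \<tau>\<^sub>i\<^sub>n m) \<and>
       \<not> (\<exists>F. solves_ode_on m UNIV F \<and> (\<forall>\<tau>\<le>0. F \<tau> = \<Phi> m \<tau>)) \<and>
       \<tau>\<^sub>p m > 0 \<and>
       (\<exists>F. solves_ode_on m {..<\<tau>\<^sub>p m} F \<and> (\<forall>\<tau>\<le>0. F \<tau> = \<Phi> m \<tau>) \<and>
            simple_pole_at m F (\<tau>\<^sub>p m))) \<and>
    \<tau>\<^sub>p (1/3) = 2 * pi * sqrt 3 / (3 * a) \<and>
    (\<forall>m. 1/3 < m \<and> m < 1/2 \<longrightarrow> \<tau>\<^sub>p m > \<tau>\<^sub>p (1/3)) \<and>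
    (\<forall>m. 0 < m \<and> m < 1/3 \<longrightarrow> \<not> (\<exists>f. bvp_solution m a f))"
proof -
  define P where "P = (\<lambda>m f \<tau>\<^sub>i \<tau>\<^sub>p. bvp_solution m a f \<and>
       (\<forall>g. bvp_solution m a g \<and> (m = 1 / 3 \<or> m = 1 / 2 \<or> (\<forall>\<tau>\<le>0. g \<tau> \<le> 0)) \<longrightarrow> (\<forall>\<tau>\<le>0. g \<tau> = f \<tau>)) \<and>
       strict_mono_on {..0} f \<and> (\<exists>d>0. lyapunov_member m a d {..0} f) \<and>
       (\<forall>\<tau>\<le>0. phi_half a \<tau> \<le> f \<tau> \<and> f \<tau> \<le> phi_third a \<tau>) \<and>
       (m < 1 / 2 \<longrightarrow> \<tau>\<^sub>i < 0 \<and> inflection_point f \<tau>\<^sub>i \<and>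
         (\<forall>\<tau><0. inflection_relation m f \<tau> \<longleftrightarrow> \<tau> = \<tau>\<^sub>i) \<and>
         \<not> (\<exists>F. solves_ode_on m UNIV F \<and> (\<forall>\<tau>\<le>0. F \<tau> = f \<tau>)) \<and> \<tau>\<^sub>p > 0 \<and>
         (\<exists>F. solves_ode_on m {..<\<tau>\<^sub>p} F \<and> (\<forall>\<tau>\<le>0. F \<tau> = f \<tau>) \<and> simple_pole_at m F \<tau>\<^sub>p) \<and>
         (\<exists>v B. maximal_front a ((1 - 2 * m) / m) (ereal \<tau>\<^sub>p) f v B)))"
  \<comment> \<open>With the range of \<open>m\<close> inside the existential, the choice of
    witnesses is a function of every real \<open>m\<close>.\<close>
  have "\<exists>f \<tau>\<^sub>i \<tau>\<^sub>p. 1 / 3 \<le> m \<and> m \<le> 1 / 2 \<longrightarrow> P m f \<tau>\<^sub>i \<tau>\<^sub>p" for m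
  proof (cases "1 / 3 \<le> m \<and> m \<le> 1 / 2")
    case True
    then have "\<exists>f \<tau>\<^sub>i \<tau>\<^sub>p. P m f \<tau>\<^sub>i \<tau>\<^sub>p"
      unfolding P_def by (intro solution_exists assms) auto
    then show ?thesis by blast
  qed blast
  then obtain \<Phi> \<tau>\<^sub>i\<^sub>n \<tau>\<^sub>p where "\<And>m. 1 / 3 \<le> m \<and> m \<le> 1 / 2 \<Longrightarrow> P m (\<Phi> m) (\<tau>\<^sub>i\<^sub>n m) (\<tau>\<^sub>p m)"
    by metis
  note P = this[unfolded P_def]
  have mf: "\<exists>v B. maximal_front a ((1 - 2 * m) / m) (ereal (\<tau>\<^sub>p m)) (\<Phi> m) v B" if "1 / 3 \<le> m" "m < 1 / 2" for m
    using P[of m] that by simp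
  obtain V C where F: "maximal_front a 1 (ereal (\<tau>\<^sub>p (1 / 3))) (\<Phi> (1 / 3)) V C"
    using mf[of "1 / 3"] by auto
  have "\<tau>\<^sub>p (1 / 3) = 2 * pi * sqrt 3 / (3 * a)"
    by (rule maximal_front.time_beta_1(1)[OF F refl refl])
  moreover have "\<tau>\<^sub>p (1 / 3) < \<tau>\<^sub>p m" if m: "1 / 3 < m" "m < 1 / 2" for m
  proof -
    obtain v B where "maximal_front a ((1 - 2 * m) / m) (ereal (\<tau>\<^sub>p m)) (\<Phi> m) v B"
      using mf[of m] m by auto
    then show ?thesis
      by (rule blowup_time_less[OF _ _ _ F]) (use m in \<open>auto simp: field_simps\<close>)
  qed
  ultimately show ?thesis
    using P no_bvp_solution[OF assms]
    by (intro exI[of _ \<Phi>] exI[of _ \<tau>\<^sub>i\<^sub>n] exI[of _ \<tau>\<^sub>p]) simp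
qed

end
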